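(* Let $p_0$ be an initial configuration with moving frame configuration $\widehat{p_0}\in\mathbb{R}^N$, let $\varepsilon>0$, and let $f=\widehat{g}_\varepsilon:\mathbb{C}^N\to\mathbb{C}$ be the associated $\varepsilon$-member constraint polynomial, with $\widehat{V}_\varepsilon=\{x\in\mathbb{C}^N: \widehat{g}_\varepsilon(x)=0\}$. Let $z\in\mathbb{R}$, $\gamma\in\mathbb{C}$, $y\in\mathbb{R}^N\setminus\{x\in\mathbb{R}^N: f(x)=0\}$, $\alpha=(\alpha_0,\alpha_1)\in\mathbb{C}^2$, and let $H:\mathbb{C}^N\times\mathbb{C}^2\times\mathbb{C}\to\mathbb{C}^{N+2}$ be the homotopy $$H(x,\lambda,t)=\begin{bmatrix} f(x)-t\gamma z\\ \lambda_0(x-y)+\lambda_1\nabla f(x)^T\\ \alpha_0\lambda_0+\alpha_1\lambda_1-1\end{bmatrix},\qquad \lambda=(\lambda_0,\lambda_1).$$ Assume the following. (i) The starting solutions, i.e. the solutions $(x,\lambda)\in\mathbb{C}^N\times\mathbb{C}^2$ of $H(x,\lambda,1)=0$, are finite in number and nonsingular. (ii) The number of starting solutions equals the maximum number of isolated solutions of $H(x,\lambda,1)=0$ as $(z,\gamma,y,\alpha)$ varies over $\mathbb{C}\times\mathbb{C}\times\mathbb{C}^N\times\mathbb{C}^2$. (iii) All solution paths defined by $H$ starting at $t=1$ are trackable: for each starting solution $(x^*,\lambda^* )$ there is a smooth map $\xi:(0,1]\to\mathbb{C}^N\times\mathbb{C}^2$ with $\xi(1)=(x^*,\lambda^* )$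 such that for all $t\in(0,1]$, $\xi(t)$ is a nonsingular solution of $H(\cdot,\cdot,t)=0$. (iv) Each solution path converges (as $t\to 0^+$). Let $E\subset\mathbb{C}^N\times\mathbb{C}^2$ be the set of endpoints of all solution paths, and $E_1=\pi(E)$, where $\pi(x,\lambda)=x$. If $$E_1\cap\widehat{V}_\varepsilon\cap\mathbb{R}^N=\emptyset,$$ then $p_0$ is $\varepsilon$-locally rigid.
   Context: Setting. $(V,E_G)$ is a connected graph with nodes $V=[n]=\{1,\dots,n\}$ and $m$ edges (the edge set is written $E_G$ here to distinguish it from the endpoint set $E$). An initial configuration is a map $p_0:[n]\to\mathbb{R}^d$, identified with the tuple $(p_{ik})\in\mathbb{R}^{nd}$, $p_{ik}$ being the $k$th coordinate of node $i$; it is assumed that the affine span of the $n$ nodes is $d$-dimensional. The nodes are ordered so that the affine span of nodes $1,\dots,d$ is $(d-1)$-dimensional. Moving frame. Let $N=nd-\binom{d+1}{2}$. There is a rigid motion of $\mathbb{R}^d$ (composition of translations and rotations) carrying $p_0$ to a configuration with coordinates $\widehat{p_{ik}}$ such that $\widehat{p_{ik}}=0$ whenever $i\in[d]$ and $k\ge i$. Fix such a motion. Dropping these $\binom{d+1}{2}$ coordinates, the new configuration is regarded as a point $\widehat{p_0}\in\mathbb{R}^N$. Points $x\in\mathbb{C}^N$ have coordinates $x_{ik}$ indexed by the remaining pairs $(i,k)$; by convention $x_{ik}=0$ for the dropped pairs (this identifies $\mathbb{C}^N$ with a coordinate subspace of $\mathbb{C}^{nd}$). Moving frame member constraints. $\widehat{g}=(\widehat{g_1},\dots,\widehat{g_m}):\mathbb{C}^N\to\mathbb{C}^m$,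 where if the $l$th edge is $ij$ then $$\widehat{g_l}(x)=\sum_{k=1}^d(x_{ik}-x_{jk})^2-\sum_{k=1}^d(\widehat{p_{ik}}-\widehat{p_{jk}})^2 .$$ $\varepsilon$-member constraints. $\widehat{g}_\varepsilon=\widehat{g_1}^2+\cdots+\widehat{g_m}^2+s_\varepsilon^2$, where $s_\varepsilon(x)=\varepsilon^2-\sum_{k=1}^d\sum_{i=1}^n(x_{ik}-\widehat{p_{ik}})^2$. Flexes. A deformation of $\widehat{p_0}$ is a continuous path $\widehat{p}:[0,1]\to\mathbb{R}^N$ with $\widehat{p}(0)=\widehat{p_0}$. It is a rigid motion if the squared distances between all pairs of nodes (not only those joined by edges) are constant in $t$. A flex of $\widehat{p_0}$ is a deformation with $\widehat{g}(\widehat{p}(t))=0$ for all $t\in[0,1]$ which is not a rigid motion. $\varepsilon$-local rigidity. $p_0$ is $\varepsilon$-locally rigid if every flex $\widehat{p}$ of $\widehat{p_0}$ satisfies $\widehat{p}(t)\in B_\varepsilon(\widehat{p_0})$ for all $t\in[0,1]$, where $B_\varepsilon(\widehat{p_0})\subset\mathbb{R}^N$ is the open Euclidean $\varepsilon$-ball centered at $\widehat{p_0}$. A solution of a square polynomial system is nonsingular if the Jacobian matrix (here with respect to $(x,\lambda)$) is invertible at it. $\nabla f(x)$ is the row vector of partial derivatives of $f$. *)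

theory Defs
  imports "HOL-Analysis.Analysis"
begin

text \<open>
  Nodes are the natural numbers \<open>1, ..., n\<close>. An undirected edge is represented by the pair
  of its ends in increasing order, so a simple graph is a set \<open>Es\<close> of such pairs.
\<close>

definition simple_graph :: "nat \<Rightarrow> (nat \<times> nat) set \<Rightarrow> bool" where
  "simple_graph n Es \<longleftrightarrow> Es \<subseteq> {(i, j). 1 \<le> i \<and> i < j \<and> j \<le> n}"

definition connected_graph :: "nat \<Rightarrow> (nat \<times> nat) set \<Rightarrow> bool" where
  "connected_graph n Es \<longleftrightarrow>
     simple_graph n Es \<and> (\<forall>i\<in>{1..n}. \<forall>j\<in>{1..n}. (i, j) \<in> (Es \<union> Es\<inverse>)\<^sup>*)"

text \<open>
  The ambient space is \<open>real ^ 'd\<close>. The linear order of the finite type \<open>'d\<close> numbers its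
  coordinates by \<open>1, ..., CARD('d)\<close>.
\<close>

definition coord_number :: "'d::{finite,linorder} \<Rightarrow> nat" where
  "coord_number k = card {..k}"

definition dropped :: "nat \<Rightarrow> 'd::{finite,linorder} \<Rightarrow> bool" where
  "dropped i k \<longleftrightarrow> i \<in> {1..CARD('d)} \<and> i \<le> coord_number k"

definition retained_pairs :: "nat \<Rightarrow> (nat \<times> 'd::{finite,linorder}) set" where
  "retained_pairs n = {(i, k). i \<in> {1..n} \<and> \<not> dropped i k}"

definition admissible_configuration ::
  "nat \<Rightarrow> (nat \<Rightarrow> real ^ 'd::{finite,linorder}) \<Rightarrow> bool" where
  "admissible_configuration n p0 \<longleftrightarrow>
     aff_dim (p0 ` {1..n}) = int CARD('d) \<and>
     aff_dim (p0 ` {1..CARD('d)}) = int CARD('d) - 1"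

definition rigid_motion :: "(real ^ 'd \<Rightarrow> real ^ 'd::finite) \<Rightarrow> bool" where
  "rigid_motion T \<longleftrightarrow> (\<exists>A b. rotation_matrix A \<and> (\<forall>v. T v = A *v v + b))"

text \<open>
  Points of \<open>N\<close>-dimensional space are vectors over a finite index type \<open>'N\<close>. A bijection
  \<open>idx\<close> from \<open>'N\<close> onto the retained pairs (which forces \<open>CARD('N) = N\<close>) identifies the
  components with the coordinates \<open>x\<^sub>i\<^sub>k\<close>.
\<close>

definition moving_frame_configuration ::
  "nat \<Rightarrow> ('N \<Rightarrow> nat \<times> 'd) \<Rightarrow> (nat \<Rightarrow> real ^ 'd::{finite,linorder}) \<Rightarrow> real ^ 'N::finite \<Rightarrow> bool"
where
  "moving_frame_configuration n idx p0 q \<longleftrightarrow>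
     (\<exists>T. rigid_motion T \<and>
          (\<forall>i\<in>{1..n}. \<forall>k. dropped i k \<longrightarrow> T (p0 i) $ k = 0) \<and>
          (\<forall>a. q $ a = T (p0 (fst (idx a))) $ snd (idx a)))"

definition coord :: "('N \<Rightarrow> nat \<times> 'd) \<Rightarrow> 'a::zero ^ 'N::finite \<Rightarrow> nat \<Rightarrow> 'd \<Rightarrow> 'a" where
  "coord idx x i k = (if (i, k) \<in> range idx then x $ (inv idx (i, k)) else 0)"

definition complex_vec :: "real ^ 'N \<Rightarrow> complex ^ 'N::finite" where
  "complex_vec x = (\<chi> a. complex_of_real (x $ a))"

definition sq_dist :: "('N \<Rightarrow> nat \<times> 'd::finite) \<Rightarrow> 'a::comm_ring_1 ^ 'N::finite \<Rightarrow> nat \<Rightarrow> nat \<Rightarrow> 'a"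
where
  "sq_dist idx x i j = (\<Sum>k\<in>UNIV. (coord idx x i k - coord idx x j k)\<^sup>2)"

definition member_constraint ::
  "('N \<Rightarrow> nat \<times> 'd::finite) \<Rightarrow> real ^ 'N \<Rightarrow> nat \<times> nat \<Rightarrow> complex ^ 'N::finite \<Rightarrow> complex" where
  "member_constraint idx q e x =
     sq_dist idx x (fst e) (snd e) - complex_of_real (sq_dist idx q (fst e) (snd e))"

definition sphere_constraint ::
  "nat \<Rightarrow> ('N \<Rightarrow> nat \<times> 'd::finite) \<Rightarrow> real ^ 'N \<Rightarrow> real \<Rightarrow> complex ^ 'N::finite \<Rightarrow> complex" where
  "sphere_constraint n idx q \<epsilon> x =
     (complex_of_real \<epsilon>)\<^sup>2 -
     (\<Sum>k\<in>UNIV. \<Sum>i\<in>{1..n}. (coord idx x i k - complex_of_real (coord idx q i k))\<^sup>2)"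

definition eps_member_constraint ::
  "nat \<Rightarrow> (nat \<times> nat) set \<Rightarrow> ('N \<Rightarrow> nat \<times> 'd::finite) \<Rightarrow> real ^ 'N \<Rightarrow> real
     \<Rightarrow> complex ^ 'N::finite \<Rightarrow> complex" where
  "eps_member_constraint n Es idx q \<epsilon> x =
     (\<Sum>e\<in>Es. (member_constraint idx q e x)\<^sup>2) + (sphere_constraint n idx q \<epsilon> x)\<^sup>2"

definition deformation :: "real ^ 'N \<Rightarrow> (real \<Rightarrow> real ^ 'N::finite) \<Rightarrow> bool" where
  "deformation q p \<longleftrightarrow> continuous_on {0..1} p \<and> p 0 = q"

definition rigid_path ::
  "nat \<Rightarrow> ('N \<Rightarrow> nat \<times> 'd::finite) \<Rightarrow> (real \<Rightarrow> real ^ 'N::finite) \<Rightarrow> bool" where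
  "rigid_path n idx p \<longleftrightarrow>
     (\<forall>i\<in>{1..n}. \<forall>j\<in>{1..n}. \<forall>s\<in>{0..1}. \<forall>t\<in>{0..1}.
        sq_dist idx (p s) i j = sq_dist idx (p t) i j)"

definition flex ::
  "nat \<Rightarrow> (nat \<times> nat) set \<Rightarrow> ('N \<Rightarrow> nat \<times> 'd::finite) \<Rightarrow> real ^ 'N
     \<Rightarrow> (real \<Rightarrow> real ^ 'N::finite) \<Rightarrow> bool" where
  "flex n Es idx q p \<longleftrightarrow>
     deformation q p \<and>
     (\<forall>t\<in>{0..1}. \<forall>e\<in>Es. member_constraint idx q e (complex_vec (p t)) = 0) \<and>
     \<not> rigid_path n idx p"

definition eps_locally_rigid ::
  "nat \<Rightarrow> (nat \<times> nat) set \<Rightarrow> ('N \<Rightarrow> nat \<times> 'd::finite) \<Rightarrow> real ^ 'N::finite \<Rightarrow> real \<Rightarrow> bool" where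
  "eps_locally_rigid n Es idx q \<epsilon> \<longleftrightarrow>
     (\<forall>p. flex n Es idx q p \<longrightarrow> (\<forall>t\<in>{0..1}. p t \<in> ball q \<epsilon>))"

text \<open>
  A pair \<open>(x, \<lambda>)\<close> is encoded as a vector \<open>w\<close> indexed by \<open>'N + 2\<close>, so that a map of
  \<open>complex ^ ('N + 2)\<close> into itself has a square Jacobian matrix. The two elements of the
  numeral type \<open>2\<close> are 0 and 1, the indices of the two multipliers.
\<close>

definition x_part :: "'a ^ ('N + 2) \<Rightarrow> 'a ^ 'N::finite" where
  "x_part w = (\<chi> a. w $ Inl a)"

definition lambda_part :: "'a ^ ('N::finite + 2) \<Rightarrow> 'a ^ 2" where
  "lambda_part w = (\<chi> b. w $ Inr b)"

text \<open>
  For holomorphic \<open>f\<close> the Frechet derivative is complex linear, and its value at the unit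
  vector \<open>axis a 1\<close> is the complex partial derivative in the direction \<open>a\<close>. For the same
  reason the library's \<open>jacobian\<close> is the matrix of complex partial derivatives.
\<close>

definition gradient :: "(complex ^ 'N \<Rightarrow> complex) \<Rightarrow> complex ^ 'N \<Rightarrow> complex ^ 'N::finite" where
  "gradient f x = (\<chi> a. frechet_derivative f (at x) (axis a 1))"

definition homotopy ::
  "(complex ^ 'N \<Rightarrow> complex) \<Rightarrow> complex \<Rightarrow> complex \<Rightarrow> complex ^ 'N \<Rightarrow> complex ^ 2
     \<Rightarrow> complex ^ ('N + 2) \<Rightarrow> complex \<Rightarrow> complex ^ ('N::finite + 2)" where
  "homotopy f z \<gamma> y \<alpha> w t =
     (let x = x_part w; l = lambda_part w in
      \<chi> r. case r of
             Inl a \<Rightarrow> l $ 0 * (x - y) $ a + l $ 1 * gradient f x $ a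
           | Inr b \<Rightarrow> if b = 0 then f x - t * \<gamma> * z
                      else \<alpha> $ 0 * l $ 0 + \<alpha> $ 1 * l $ 1 - 1)"

definition nonsingular_solution :: "(complex ^ 'r \<Rightarrow> complex ^ 'r) \<Rightarrow> complex ^ 'r::finite \<Rightarrow> bool"
where
  "nonsingular_solution F w \<longleftrightarrow> F w = 0 \<and> invertible (jacobian F (at w))"

definition solutions :: "(complex ^ 'r \<Rightarrow> complex ^ 'r) \<Rightarrow> (complex ^ 'r::finite) set" where
  "solutions F = {w. F w = 0}"

definition isolated_solutions :: "(complex ^ 'r \<Rightarrow> complex ^ 'r) \<Rightarrow> (complex ^ 'r::finite) set" where
  "isolated_solutions F = {w. w isolated_in solutions F}"

text \<open>Finiteness is demanded explicitly because \<open>card\<close> is 0 on infinite sets.\<close>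

definition max_isolated_solutions :: "(complex ^ 'N::finite \<Rightarrow> complex) \<Rightarrow> nat \<Rightarrow> bool" where
  "max_isolated_solutions f M \<longleftrightarrow>
     (\<forall>z \<gamma> y \<alpha>. finite (isolated_solutions (\<lambda>w. homotopy f z \<gamma> y \<alpha> w 1)) \<and>
                  card (isolated_solutions (\<lambda>w. homotopy f z \<gamma> y \<alpha> w 1)) \<le> M) \<and>
     (\<exists>z \<gamma> y \<alpha>. card (isolated_solutions (\<lambda>w. homotopy f z \<gamma> y \<alpha> w 1)) = M)"

text \<open>All derivatives exist on \<open>(0, 1]\<close>, one-sided at the end point 1.\<close>

definition smooth_path :: "(real \<Rightarrow> 'a::real_normed_vector) \<Rightarrow> bool" where
  "smooth_path \<xi> \<longleftrightarrow>
     (\<exists>D. D 0 = \<xi> \<and>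
          (\<forall>m. \<forall>t\<in>{0<..1}. (D m has_vector_derivative D (Suc m) t) (at t within {0<..1})))"

definition solution_path ::
  "(complex ^ 'r \<Rightarrow> complex \<Rightarrow> complex ^ 'r) \<Rightarrow> (real \<Rightarrow> complex ^ 'r::finite) \<Rightarrow> bool" where
  "solution_path H \<xi> \<longleftrightarrow>
     smooth_path \<xi> \<and>
     (\<forall>t\<in>{0<..1}. nonsingular_solution (\<lambda>w. H w (complex_of_real t)) (\<xi> t))"

definition endpoints ::
  "(complex ^ 'r \<Rightarrow> complex \<Rightarrow> complex ^ 'r) \<Rightarrow> (complex ^ 'r::finite) set" where
  "endpoints H = {e. \<exists>\<xi>. solution_path H \<xi> \<and> (\<xi> \<longlongrightarrow> e) (at_right 0)}"

end

theory Submission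
  imports Defs "HOL-Computational_Algebra.Polynomial" "HOL-Real_Asymp.Real_Asymp"
begin

text \<open>
  A flex that leaves the ball crosses its boundary sphere, so it suffices to derive a
  contradiction from a real zero of \<open>f\<close>. Real zeros of \<open>f\<close> are minima, since \<open>f\<close> is a sum of
  squares. For a large penalty \<open>\<mu>\<close>, a real minimiser \<open>x\<close> of \<open>|x - y|\<^sup>2 + 2 \<mu> f(x)\<close> is a critical
  point of the distance to \<open>y\<close> on a level set \<open>f = s\<close>, and \<open>s\<close> tends to \<open>0\<close> from above as \<open>\<mu>\<close>
  tends to infinity.

  Critical points on \<open>f = s\<close> are the points over \<open>(y, s)\<close> of the polynomial map
  \<open>F(x, \<mu>) = (x + \<mu> \<nabla>f(x), f(x))\<close>. By maximality of the number \<open>M\<close> of starting solutions, no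
  fibre of \<open>F\<close> has more than \<open>M\<close> regular points, while the solution paths provide exactly \<open>M\<close>
  of them over \<open>(y, t \<gamma> z)\<close>. The coordinates of the regular points over \<open>(y, s)\<close>, and the Jacobian
  determinants there, are algebraic over \<open>s\<close>. Hence there are \<open>M\<close> regular points for every small
  \<open>s \<noteq> 0\<close>, and the number of those in a given cluster does not change while \<open>s\<close> moves in a
  punctured disc. This rotates the direction \<open>\<gamma> z\<close> of the homotopy into the positive real one.
  The minimisers are among the \<open>M\<close> regular points, because they become regular after moving
  \<open>y\<close> slightly and there is no room for an additional point. So a cluster of minimisers also
  contains points of a solution path, whose endpoint is then a real zero of \<open>f\<close>.
\<close>

section \<open>Polynomial functions of several variables\<close>

text \<open>Polynomials enter as functions rather than as formal expressions. What is used of them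
  is mainly closure under arithmetic and partial derivatives, continuity, and a degree bound in each
  variable, all of which follow by induction on this predicate.\<close>

inductive poly_fun :: "(complex ^ 'n \<Rightarrow> complex) \<Rightarrow> bool" where
  const: "poly_fun (\<lambda>v. c)"
| component: "poly_fun (\<lambda>v. v $ a)"
| add: "poly_fun p \<Longrightarrow> poly_fun q \<Longrightarrow> poly_fun (\<lambda>v. p v + q v)"
| mult: "poly_fun p \<Longrightarrow> poly_fun q \<Longrightarrow> poly_fun (\<lambda>v. p v * q v)"

lemma poly_fun_diff:
  assumes "poly_fun p" "poly_fun q"
  shows "poly_fun (\<lambda>v. p v - q v)"
proof -
  have "poly_fun (\<lambda>v. p v + (-1) * q v)"
    by (intro poly_fun.intros assms)
  then show ?thesis by simp
qed

lemma poly_fun_sum: "(\<And>i. i \<in> I \<Longrightarrow> poly_fun (p i)) \<Longrightarrow> poly_fun (\<lambda>v. \<Sum>i\<in>I. p i v)"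
  by (induction I rule: infinite_finite_induct) (auto intro: poly_fun.intros)

lemma poly_fun_prod: "(\<And>i. i \<in> I \<Longrightarrow> poly_fun (p i)) \<Longrightarrow> poly_fun (\<lambda>v. \<Prod>i\<in>I. p i v)"
  by (induction I rule: infinite_finite_induct) (auto intro: poly_fun.intros)

lemma poly_fun_power: "poly_fun p \<Longrightarrow> poly_fun (\<lambda>v. p v ^ k)"
  by (induction k) (auto intro: poly_fun.intros)

lemmas poly_fun_intros = poly_fun.intros poly_fun_diff poly_fun_sum poly_fun_prod poly_fun_power

lemma poly_fun_det:
  assumes "\<And>a b. poly_fun (\<lambda>v. A v $ a $ b)"
  shows "poly_fun (\<lambda>v. det (A v))"
  unfolding det_def by (intro poly_fun_intros assms)

text \<open>Keeping the partial derivatives in the same class allows a second application, which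
  yields the Hessian.\<close>

lemma poly_fun_has_derivative:
  assumes "poly_fun (p :: complex ^ 'n::finite \<Rightarrow> complex)"
  shows "\<exists>D. (\<forall>a. poly_fun (D a)) \<and>
     (\<forall>v. (p has_derivative (\<lambda>h. \<Sum>a\<in>UNIV. D a v * h $ a)) (at v))"
  using assms
proof induction
  case (const c)
  show ?case
    by (intro exI[of _ "\<lambda>a v. 0"]) (auto intro: poly_fun.intros)
next
  case (component b)
  have "((\<lambda>v::complex^'n. v $ b) has_derivative
      (\<lambda>h. \<Sum>a\<in>UNIV. (if a = b then 1 else 0) * h $ a)) (at v)" for v
    by (simp add: if_distrib[of "\<lambda>x. x * _"] cong: if_cong)
       (rule bounded_linear_imp_has_derivative[OF bounded_linear_vec_nth])
  then show ?case
    by (intro exI[of _ "\<lambda>a v. if a = b then 1 else 0"]) (auto intro: poly_fun.intros)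
next
  case (add p q)
  then obtain D E where D: "\<forall>a. poly_fun (D a)"
      "\<And>v. (p has_derivative (\<lambda>h. \<Sum>a\<in>UNIV. D a v * h $ a)) (at v)"
    and E: "\<forall>a. poly_fun (E a)"
      "\<And>v. (q has_derivative (\<lambda>h. \<Sum>a\<in>UNIV. E a v * h $ a)) (at v)"
    by blast
  have "((\<lambda>v. p v + q v) has_derivative (\<lambda>h. \<Sum>a\<in>UNIV. (D a v + E a v) * h $ a)) (at v)" for v
    using has_derivative_add[OF D(2) E(2)] by (simp add: sum.distrib distrib_right)
  then show ?case
    using D(1) E(1) by (intro exI[of _ "\<lambda>a v. D a v + E a v"]) (auto intro: poly_fun.intros)
next
  case (mult p q)
  then obtain D E where D: "\<forall>a. poly_fun (D a)"
      "\<And>v. (p has_derivative (\<lambda>h. \<Sum>a\<in>UNIV. D a v * h $ a)) (at v)"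
    and E: "\<forall>a. poly_fun (E a)"
      "\<And>v. (q has_derivative (\<lambda>h. \<Sum>a\<in>UNIV. E a v * h $ a)) (at v)"
    by blast
  have "((\<lambda>v. p v * q v) has_derivative
      (\<lambda>h. \<Sum>a\<in>UNIV. (p v * E a v + D a v * q v) * h $ a)) (at v)" for v
    using has_derivative_mult[OF D(2)[of v] E(2)[of v]]
    by (simp add: sum.distrib sum_distrib_left algebra_simps)
  then show ?case
    using D(1) E(1) mult.hyps
    by (intro exI[of _ "\<lambda>a v. p v * E a v + D a v * q v"]) (auto intro!: poly_fun.intros)
qed

lemma poly_fun_continuous_on: "poly_fun p \<Longrightarrow> continuous_on S p"
  by (induction rule: poly_fun.induct) (auto intro!: continuous_intros)

section \<open>Degree in each variable and vanishing on a grid\<close>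

definition upd :: "'a ^ 'n \<Rightarrow> 'n \<Rightarrow> 'a \<Rightarrow> 'a ^ 'n" where
  "upd v a t = (\<chi> b. if b = a then t else v $ b)"

text \<open>The degree is bounded in each variable separately while the others stay fixed, and
  \<open>q\<close> may change with \<open>v\<close>. This weak form is stable under sums and
  products and still lets a grid detect the zero function.\<close>

definition coord_poly :: "nat \<Rightarrow> (complex ^ 'n \<Rightarrow> complex) \<Rightarrow> bool" where
  "coord_poly d h \<longleftrightarrow> (\<forall>v a. \<exists>q. degree q \<le> d \<and> (\<forall>t. h (upd v a t) = poly q t))"

lemma coord_poly_const: "coord_poly d (\<lambda>v. c)"
  unfolding coord_poly_def by (intro allI exI[of _ "[:c:]"]) auto

lemma coord_poly_mono: "coord_poly d h \<Longrightarrow> d \<le> d' \<Longrightarrow> coord_poly d' h"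
  unfolding coord_poly_def using le_trans by blast

lemma coord_poly_component: "coord_poly (Suc 0) (\<lambda>v. v $ b)"
  unfolding coord_poly_def
proof (intro allI)
  fix v :: "complex ^ 'a" and a
  show "\<exists>q. degree q \<le> Suc 0 \<and> (\<forall>t. upd v a t $ b = poly q t)"
    by (cases "b = a")
       (auto simp: upd_def intro: exI[of _ "[:0, 1:]"] exI[of _ "[:v $ b:]"])
qed

lemma coord_poly_add:
  assumes "coord_poly d p" "coord_poly d q"
  shows "coord_poly d (\<lambda>v. p v + q v)"
  unfolding coord_poly_def
proof (intro allI)
  fix v a
  obtain p' q' where "degree p' \<le> d" "\<forall>t. p (upd v a t) = poly p' t"
    "degree q' \<le> d" "\<forall>t. q (upd v a t) = poly q' t"
    using assms unfolding coord_poly_def by meson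
  then show "\<exists>r. degree r \<le> d \<and> (\<forall>t. p (upd v a t) + q (upd v a t) = poly r t)"
    by (intro exI[of _ "p' + q'"]) (auto intro: degree_add_le)
qed

lemma coord_poly_mult:
  assumes "coord_poly d p" "coord_poly e q"
  shows "coord_poly (d + e) (\<lambda>v. p v * q v)"
  unfolding coord_poly_def
proof (intro allI)
  fix v a
  obtain p' q' where "degree p' \<le> d" "\<forall>t. p (upd v a t) = poly p' t"
    "degree q' \<le> e" "\<forall>t. q (upd v a t) = poly q' t"
    using assms unfolding coord_poly_def by meson
  then show "\<exists>r. degree r \<le> d + e \<and> (\<forall>t. p (upd v a t) * q (upd v a t) = poly r t)"
    by (intro exI[of _ "p' * q'"]) (auto intro: order_trans[OF degree_mult_le])
qed

lemma coord_poly_power: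
  assumes "coord_poly d p"
  shows "coord_poly (k * d) (\<lambda>v. p v ^ k)"
  by (induction k) (use assms coord_poly_mult in \<open>auto intro: coord_poly_const\<close>)

lemma coord_poly_sum:
  "(\<And>i. i \<in> I \<Longrightarrow> coord_poly d (p i)) \<Longrightarrow> coord_poly d (\<lambda>v. \<Sum>i\<in>I. p i v)"
  by (induction I rule: infinite_finite_induct) (auto intro: coord_poly_const coord_poly_add)

lemma coord_poly_prod:
  "(\<And>i. i \<in> I \<Longrightarrow> coord_poly d (p i)) \<Longrightarrow> coord_poly (card I * d) (\<lambda>v. \<Prod>i\<in>I. p i v)"
  by (induction I rule: infinite_finite_induct) (auto intro: coord_poly_const coord_poly_mult)

lemma poly_fun_coord_poly: "poly_fun p \<Longrightarrow> \<exists>d. coord_poly d p"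
proof (induction rule: poly_fun.induct)
  case (const c)
  show ?case using coord_poly_const by blast
next
  case (component a)
  show ?case using coord_poly_component by blast
next
  case (add p q)
  then obtain d e where "coord_poly d p" "coord_poly e q" by blast
  then have "coord_poly (max d e) (\<lambda>v. p v + q v)"
    by (intro coord_poly_add) (auto elim: coord_poly_mono)
  then show ?case by blast
next
  case (mult p q)
  then show ?case using coord_poly_mult by blast
qed

definition grid :: "nat \<Rightarrow> (complex ^ 'n) set" where
  "grid d = {v. \<forall>a. v $ a \<in> of_nat ` {..d}}"

text \<open>The coordinates are freed from the grid one at a time: as a function of the freed
  coordinate, \<open>h\<close> has degree at most \<open>d\<close> and the \<open>d + 1\<close> grid
  values as roots.\<close>

lemma coord_poly_eq_0:
  fixes h :: "complex ^ 'n::finite \<Rightarrow> complex"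
  assumes h: "coord_poly d h" and grid: "\<And>v. v \<in> grid d \<Longrightarrow> h v = 0"
  shows "h v = 0"
proof -
  let ?G = "of_nat ` {..d} :: complex set"
  have "\<forall>v. (\<forall>a. a \<notin> S \<longrightarrow> v $ a \<in> ?G) \<longrightarrow> h v = 0" if "finite S" for S :: "'n set"
    using that
  proof (induction S)
    case empty
    then show ?case using grid by (auto simp: grid_def)
  next
    case (insert b S)
    show ?case
    proof (intro allI impI)
      fix v :: "complex ^ 'n"
      assume v: "\<forall>a. a \<notin> insert b S \<longrightarrow> v $ a \<in> ?G"
      obtain q where q: "degree q \<le> d" "\<And>t. h (upd v b t) = poly q t"
        using h unfolding coord_poly_def by meson
      have roots: "?G \<subseteq> {t. poly q t = 0}"
      proof
        fix t assume "t \<in> ?G"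
        then have "\<forall>a. a \<notin> S \<longrightarrow> upd v b t $ a \<in> ?G"
          using v by (auto simp: upd_def)
        then show "t \<in> {t. poly q t = 0}"
          using insert.IH q(2)[of t] by simp
      qed
      have "q = 0"
      proof (rule ccontr)
        assume "q \<noteq> 0"
        then have "card ?G \<le> degree q"
          using card_mono[OF poly_roots_finite roots] card_poly_roots_bound[of q] by linarith
        moreover have "card ?G = Suc d"
          by (subst card_image) (auto simp: inj_on_def)
        ultimately show False using q(1) by simp
      qed
      moreover have "upd v b (v $ b) = v"
        by (simp add: upd_def vec_eq_iff)
      ultimately show "h v = 0"
        using q(2)[of "v $ b"] by simp
    qed
  qed
  from this[of UNIV] show ?thesis by simp
qed

section \<open>Linear dependence of polynomial functions by counting grid points\<close>

lemma finite_grid: "finite (grid d :: (complex ^ 'n::finite) set)"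
  and card_grid_le: "card (grid d :: (complex ^ 'n::finite) set) \<le> Suc d ^ CARD('n)"
proof -
  let ?G = "of_nat ` {..d} :: complex set"
  let ?P = "PiE (UNIV :: 'n set) (\<lambda>_. ?G)"
  have fin: "finite ?P" by (intro finite_PiE) auto
  have sub: "(grid d :: (complex ^ 'n) set) \<subseteq> vec_lambda ` ?P"
  proof
    fix v :: "complex ^ 'n" assume "v \<in> grid d"
    then show "v \<in> vec_lambda ` ?P"
      by (intro image_eqI[of _ _ "vec_nth v"]) (auto simp: grid_def)
  qed
  show "finite (grid d :: (complex ^ 'n) set)"
    using finite_subset[OF sub] fin by blast
  have "card (grid d :: (complex ^ 'n) set) \<le> card ?P"
    using surj_card_le[OF fin sub] .
  also have "\<dots> = Suc d ^ CARD('n)"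
    by (simp add: card_PiE card_image inj_on_def)
  finally show "card (grid d :: (complex ^ 'n) set) \<le> Suc d ^ CARD('n)" .
qed

text \<open>Gaussian elimination, one equation per induction step.\<close>

lemma underdetermined_system:
  fixes A :: "'e \<Rightarrow> 'i \<Rightarrow> 'a::field"
  assumes "finite E" "finite I" "card E < card I"
  shows "\<exists>c. (\<exists>i\<in>I. c i \<noteq> 0) \<and> (\<forall>e\<in>E. (\<Sum>i\<in>I. c i * A e i) = 0)"
  using assms
proof (induction E arbitrary: I A rule: finite_induct)
  case empty
  then have "I \<noteq> {}" by auto
  then show ?case by (intro exI[of _ "\<lambda>_. 1"]) auto
next
  case (insert e E)
  show ?case
  proof (cases "\<forall>i\<in>I. A e i = 0")
    case True
    from insert have "\<exists>c. (\<exists>i\<in>I. c i \<noteq> 0) \<and> (\<forall>e\<in>E. (\<Sum>i\<in>I. c i * A e i) = 0)"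
      by auto
    with True show ?thesis by auto
  next
    case False
    then obtain k where k: "k \<in> I" "A e k \<noteq> 0" by auto
    \<comment> \<open>Equation \<open>e\<close> is solved for the unknown \<open>k\<close>, and the
      solution is substituted into the remaining equations.\<close>
    let ?J = "I - {k}"
    have "card E < card ?J" using insert k by auto
    then have "\<exists>c. (\<exists>i\<in>?J. c i \<noteq> 0) \<and>
        (\<forall>e'\<in>E. (\<Sum>i\<in>?J. c i * (A e' i - A e' k * A e i / A e k)) = 0)"
      using insert.IH[of ?J "\<lambda>e' i. A e' i - A e' k * A e i / A e k"] insert.prems by blast
    then obtain c where c: "\<exists>i\<in>?J. c i \<noteq> 0"
      "\<And>e'. e' \<in> E \<Longrightarrow> (\<Sum>i\<in>?J. c i * (A e' i - A e' k * A e i / A e k)) = 0"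
      by blast
    define c' where "c' = c(k := - (\<Sum>i\<in>?J. c i * A e i) / A e k)"
    have *: "(\<Sum>i\<in>I. c' i * B i) =
        - (\<Sum>i\<in>?J. c i * A e i) / A e k * B k + (\<Sum>i\<in>?J. c i * B i)" for B
      using insert.prems k by (subst sum.remove[of _ k]) (auto simp: c'_def intro: sum.cong)
    have "(\<Sum>i\<in>I. c' i * A e i) = 0"
      using k by (simp add: *)
    moreover have "(\<Sum>i\<in>I. c' i * A e' i) = 0" if "e' \<in> E" for e'
      using c(2)[OF that]
      by (simp add: * algebra_simps sum_subtractf sum_distrib_left sum_divide_distrib)
    moreover have "\<exists>i\<in>I. c' i \<noteq> 0" using c(1) by (auto simp: c'_def)
    ultimately show ?thesis by (intro exI[of _ c']) auto
  qed
qed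

text \<open>The grid points are the equations and the coefficients \<open>c i\<close> the unknowns;
  by the degree bound, a combination that vanishes on the grid vanishes everywhere.\<close>

lemma coord_poly_dependent:
  fixes \<Phi> :: "'i \<Rightarrow> complex ^ 'n::finite \<Rightarrow> complex"
  assumes "\<And>i. i \<in> I \<Longrightarrow> coord_poly d (\<Phi> i)" "finite I" "Suc d ^ CARD('n) < card I"
  shows "\<exists>c. (\<exists>i\<in>I. c i \<noteq> 0) \<and> (\<forall>v. (\<Sum>i\<in>I. c i * \<Phi> i v) = 0)"
proof -
  have "card (grid d :: (complex ^ 'n) set) < card I"
    using card_grid_le assms(3) le_less_trans by blast
  from underdetermined_system[OF finite_grid assms(2) this, of "\<lambda>v i. \<Phi> i v"]
  obtain c where c: "\<exists>i\<in>I. c i \<noteq> 0" "\<And>v. v \<in> grid d \<Longrightarrow> (\<Sum>i\<in>I. c i * \<Phi> i v) = 0"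
    by blast
  have "coord_poly d (\<lambda>v. \<Sum>i\<in>I. c i * \<Phi> i v)"
    using assms(1) coord_poly_mult[OF coord_poly_const[of 0]] by (intro coord_poly_sum) auto
  from coord_poly_eq_0[OF this c(2)] c(1) show ?thesis by blast
qed

lemma sum_digits:
  fixes m B :: nat
  shows "(\<Sum>i<n. (m div B ^ i mod B) * B ^ i) = m mod B ^ n"
proof (induction n)
  case (Suc n)
  have "m mod B ^ Suc n = B ^ n * (m div B ^ n mod B) + m mod B ^ n"
    using mod_mult2_eq[of m "B ^ n" B] by (simp add: mult.commute)
  with Suc show ?case by (simp add: mult.commute)
qed auto

section \<open>Algebraic dependence along a line\<close>

text \<open>Local openness at one point is all that the dependence argument takes from regularity:
  it supplies preimages near \<open>v\<close> of targets close to \<open>F v\<close>.\<close>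

definition open_at :: "('a::topological_space \<Rightarrow> 'b::topological_space) \<Rightarrow> 'a \<Rightarrow> bool" where
  "open_at F v \<longleftrightarrow> (\<forall>U. open U \<longrightarrow> v \<in> U \<longrightarrow> F v \<in> interior (F ` U))"

text \<open>
  Counting dimensions gives a nontrivial polynomial relation between \<open>h\<close> and the components of
  \<open>F\<close>, but it may vanish identically on the given line. The target is therefore perturbed along
  a curve in a parameter \<open>\<tau>\<close>, and the relation is divided by its lowest power of \<open>\<tau>\<close>. In the index
  \<open>(m, k, j)\<close> of a monomial, the digits of \<open>m\<close> in base \<open>B\<close> are the exponents of the components
  of \<open>F\<close> other than \<open>b\<close>; along the curve this monomial becomes \<open>\<tau>\<^sup>m s\<^sup>k h\<^sup>j\<close>.
\<close>

lemma algebraic_dependence: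
  fixes F :: "complex ^ 'r::finite \<Rightarrow> complex ^ 'r" and b :: 'r
  assumes F: "\<And>a. poly_fun (\<lambda>v. F v $ a)" and h: "poly_fun h"
  obtains D :: nat and q where "\<exists>k\<le>D. \<exists>j\<le>D. q k j \<noteq> 0"
    "\<And>s v. F v = upd c b s \<Longrightarrow> open_at F v \<Longrightarrow> (\<Sum>k\<le>D. \<Sum>j\<le>D. q k j * s ^ k * h v ^ j) = 0"
proof -
  let ?r = "CARD('r)" and ?R = "UNIV - {b}"
  have r: "?r = Suc (?r - 1)" by simp
  have "\<exists>d. (\<forall>a. coord_poly d (\<lambda>v. F v $ a)) \<and> coord_poly d h"
  proof -
    have "\<forall>a. \<exists>d. coord_poly d (\<lambda>v. F v $ a)"
      using F poly_fun_coord_poly by blast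
    then obtain df where df: "\<And>a. coord_poly (df a) (\<lambda>v. F v $ a)" by metis
    obtain dh where dh: "coord_poly dh h" using h poly_fun_coord_poly by blast
    have "df a \<le> (\<Sum>a\<in>UNIV. df a) + dh" for a
      using member_le_sum[of a UNIV df] by (simp add: trans_le_add1)
    then show ?thesis
      using df dh by (intro exI[of _ "(\<Sum>a\<in>UNIV. df a) + dh"]) (auto intro: coord_poly_mono)
  qed
  then obtain d where dF: "\<And>a. coord_poly d (\<lambda>v. F v $ a)" and dh: "coord_poly d h"
    by blast
  \<comment> \<open>With this \<open>B\<close>, the \<open>B ^ (?r + 1)\<close> monomials in the
    \<open>?r + 1\<close> functions outnumber the points of the grid that detects their
    combinations.\<close>
  define B where "B = ((?r + 1) * d + 1) ^ ?r + 1"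
  have "B > 0" by (simp add: B_def)
  have "card ?R = ?r - 1" by (simp add: card_Diff_singleton)
  \<comment> \<open>\<open>e\<close> gives each component other than \<open>b\<close> a digit
    position.\<close>
  then obtain e where e: "bij_betw e ?R {..<?r - 1}"
    using ex_bij_betw_finite_nat[of ?R] by (auto simp: lessThan_atLeast0)
  define dig where "dig m a = m div B ^ e a mod B" for m a
  have dig_lt: "dig m a < B" for m a
    using \<open>B > 0\<close> by (simp add: dig_def)
  have dig_sum: "(\<Sum>a\<in>?R. dig m a * B ^ e a) = m" if "m < B ^ (?r - 1)" for m
  proof -
    have "(\<Sum>a\<in>?R. dig m a * B ^ e a) = (\<Sum>i<?r - 1. (m div B ^ i mod B) * B ^ i)"
      unfolding dig_def by (rule sum.reindex_bij_betw[OF e])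
    then show ?thesis using that by (simp add: sum_digits)
  qed
  define \<Phi> where "\<Phi> = (\<lambda>(m, k, j) v.
    (\<Prod>a\<in>?R. (F v $ a - c $ a) ^ dig m a) * (F v $ b) ^ k * h v ^ j)"
  define I where "I = {..<B ^ (?r - 1)} \<times> {..<B} \<times> {..<B}"
  have finI: "finite I" by (simp add: I_def)
  have "card I = B ^ (?r - 1) * B * B" by (simp add: I_def)
  also have "\<dots> = B ^ ?r * B" by (metis r power_Suc2)
  finally have cardI: "card I = B ^ ?r * B" .
  \<comment> \<open>Each of the \<open>?r + 1\<close> factors is a power, with exponent below
    \<open>B\<close>, of a function of degree at most \<open>d\<close> in each variable.\<close>
  have deg: "coord_poly ((?r + 1) * (B * d)) (\<Phi> i)" if "i \<in> I" for i
  proof -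
    obtain m k j where i: "i = (m, k, j)" "k < B" "j < B"
      using \<open>i \<in> I\<close> by (auto simp: I_def)
    have pw: "coord_poly (B * d) (\<lambda>v. p v ^ l)" if "coord_poly d p" "l < B" for p :: "complex ^ 'r \<Rightarrow> complex" and l
      using coord_poly_mono[OF coord_poly_power[OF that(1), of l], of "B * d"] that(2) by simp
    have "coord_poly (card ?R * (B * d) + B * d + B * d) (\<Phi> i)"
      unfolding \<Phi>_def i(1) prod.case
    proof (intro coord_poly_mult coord_poly_prod pw dF dh i dig_lt)
      show "coord_poly d (\<lambda>v. F v $ a - c $ a)" for a
        using coord_poly_add[OF dF coord_poly_const[of d "- c $ a"]] by simp
    qed
    moreover have "card ?R * (B * d) + B * d + B * d = (?r + 1) * (B * d)"
    proof -
      have "?r + 1 = card ?R + 2" using r \<open>card ?R = ?r - 1\<close> by linarith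
      then show ?thesis by (simp only:) (simp add: algebra_simps)
    qed
    ultimately show ?thesis by (simp only:)
  qed
  have "Suc ((?r + 1) * (B * d)) ^ ?r \<le> (B * ((?r + 1) * d + 1)) ^ ?r"
    using \<open>B > 0\<close> by (intro power_mono) (simp_all add: algebra_simps)
  also have "\<dots> = B ^ ?r * ((?r + 1) * d + 1) ^ ?r" by (rule power_mult_distrib)
  also have "\<dots> < B ^ ?r * B"
  proof (rule mult_strict_left_mono)
    show "((?r + 1) * d + 1) ^ ?r < B" unfolding B_def by (rule less_add_one)
  qed (simp add: \<open>B > 0\<close>)
  finally have "Suc ((?r + 1) * (B * d)) ^ ?r < card I" unfolding cardI .
  with deg finI have "\<exists>w. (\<exists>i\<in>I. w i \<noteq> 0) \<and> (\<forall>v. (\<Sum>i\<in>I. w i * \<Phi> i v) = 0)"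
    by (rule coord_poly_dependent)
  then obtain w where w: "\<exists>i\<in>I. w i \<noteq> 0" and rel: "\<And>v. (\<Sum>i\<in>I. w i * \<Phi> i v) = 0"
    by (elim exE conjE) (rule that, assumption, erule spec)
  \<comment> \<open>The lowest power of \<tau> that carries a nonzero coefficient.\<close>
  define K where "K = (LEAST m. \<exists>k j. (m, k, j) \<in> I \<and> w (m, k, j) \<noteq> 0)"
  have ex: "\<exists>m k j. (m, k, j) \<in> I \<and> w (m, k, j) \<noteq> 0"
    using w(1) by auto
  then have K: "\<exists>k j. (K, k, j) \<in> I \<and> w (K, k, j) \<noteq> 0"
    unfolding K_def by (rule LeastI_ex)
  have below: "w (m, k, j) = 0" if "m < K" "(m, k, j) \<in> I" for m k j
    using not_less_Least[of m "\<lambda>m. \<exists>k j. (m, k, j) \<in> I \<and> w (m, k, j) \<noteq> 0"] that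
    unfolding K_def by blast
  have KB: "K < B ^ (?r - 1)" using K by (auto simp: I_def)
  \<comment> \<open>The relation along the curve divided by \<open>\<tau> ^ K\<close>, with
    \<open>p\<close> standing for the pair of \<tau> and the value of \<open>h\<close>. At \<tau> =
    0 only the terms with \<open>m = K\<close> survive, and these give the desired relation.\<close>
  define R where "R s p = (\<Sum>(m, k, j)\<in>I. w (m, k, j) * fst p ^ (m - K) * s ^ k * snd p ^ j)"
    for s :: complex and p :: "complex \<times> complex"
  show thesis
  proof (rule that[of "B - 1" "\<lambda>k j. w (K, k, j)"])
    obtain k j where "(K, k, j) \<in> I" "w (K, k, j) \<noteq> 0" using K by blast
    then show "\<exists>k\<le>B - 1. \<exists>j\<le>B - 1. w (K, k, j) \<noteq> 0"
      by (intro exI[of _ k] exI[of _ j] conjI) (auto simp: I_def)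
  next
    fix s v
    assume v: "F v = upd c b s" and opn: "open_at F v"
    have "R s (0, h v) = (\<Sum>(m, k, j)\<in>I. if m = K then w (K, k, j) * s ^ k * h v ^ j else 0)"
      unfolding R_def
    proof (intro sum.cong refl, clarify)
      fix m k j assume "(m, k, j) \<in> I"
      then show "w (m, k, j) * fst (0, h v) ^ (m - K) * s ^ k * snd (0, h v) ^ j =
          (if m = K then w (K, k, j) * s ^ k * h v ^ j else 0)"
        using below[of m k j] by (cases m K rule: linorder_cases) auto
    qed
    also have "\<dots> = (\<Sum>m<B ^ (?r - 1). \<Sum>k<B. \<Sum>j<B. if m = K then w (K, k, j) * s ^ k * h v ^ j else 0)"
      by (simp add: I_def sum.cartesian_product)
    also have "\<dots> = (\<Sum>m<B ^ (?r - 1). if m = K then \<Sum>k<B. \<Sum>j<B. w (K, k, j) * s ^ k * h v ^ j else 0)"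
      by (intro sum.cong) auto
    also have "\<dots> = (\<Sum>k<B. \<Sum>j<B. w (K, k, j) * s ^ k * h v ^ j)"
      using KB by simp
    also have "\<dots> = (\<Sum>k\<le>B - 1. \<Sum>j\<le>B - 1. w (K, k, j) * s ^ k * h v ^ j)"
    proof -
      have "{..<B} = {..B - 1}" using \<open>B > 0\<close> by auto
      then show ?thesis by (simp only:)
    qed
    finally have R0: "R s (0, h v) = (\<Sum>k\<le>B - 1. \<Sum>j\<le>B - 1. w (K, k, j) * s ^ k * h v ^ j)" .
    \<comment> \<open>Otherwise \<open>R s\<close> is nonzero for small \<tau> and points
      \<open>u\<close> near \<open>v\<close>. Openness yields such a \<open>u\<close> over the
      perturbed target with \<tau> nonzero, where the relation forces \<open>R s\<close> to
      vanish.\<close>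
    have "R s (0, h v) = 0"
    proof (rule ccontr)
      assume nz: "R s (0, h v) \<noteq> 0"
      have conth: "continuous_on UNIV h" using h by (rule poly_fun_continuous_on)
      have "continuous_on UNIV (\<lambda>p. R s (fst p, h (snd p)))"
        unfolding R_def case_prod_unfold
        by (intro continuous_intros continuous_on_compose2[OF conth]) auto
      then have "open ((\<lambda>p. R s (fst p, h (snd p))) -` (- {0}))"
        by (intro open_vimage) auto
      then obtain T U where TU: "open T" "open U" "(0, v) \<in> T \<times> U"
        "T \<times> U \<subseteq> (\<lambda>p. R s (fst p, h (snd p))) -` (- {0})"
        by (rule open_prod_elim[where x = "(0, v)"]) (use nz in auto)
      \<comment> \<open>The curve starts at \<open>F v\<close>. The exponents \<open>B ^ e a\<close>
        turn the digits of \<open>m\<close> into the single power \<open>\<tau> ^ m\<close>, so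
        distinct \<open>m\<close> give distinct powers.\<close>
      define g where "g \<tau> = (\<chi> a. if a = b then s else c $ a + \<tau> ^ (B ^ e a))" for \<tau> :: complex
      have contg: "continuous_on UNIV g"
        unfolding g_def
      proof (rule continuous_on_vec_lambda)
        show "continuous_on UNIV (\<lambda>\<tau>. if a = b then s else c $ a + \<tau> ^ (B ^ e a))" for a
          by (cases "a = b") (auto intro!: continuous_intros)
      qed
      have g0: "g 0 = F v"
        using \<open>B > 0\<close> by (auto simp: g_def v upd_def vec_eq_iff)
      have "open (g -` interior (F ` U) \<inter> T)"
        using contg TU(1) by (intro open_Int open_vimage) auto
      moreover have "0 \<in> g -` interior (F ` U) \<inter> T"
        using opn TU by (auto simp: open_at_def g0)
      ultimately obtain \<delta> where \<delta>: "\<delta> > 0" "ball 0 \<delta> \<subseteq> g -` interior (F ` U) \<inter> T"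
        using open_contains_ball by blast
      define \<tau> where "\<tau> = complex_of_real (\<delta> / 2)"
      have \<tau>: "\<tau> \<noteq> 0" "\<tau> \<in> ball 0 \<delta>"
        using \<delta>(1) by (auto simp: \<tau>_def)
      then obtain u where u: "u \<in> U" "F u = g \<tau>"
        using \<delta>(2) interior_subset[of "F ` U"] by fastforce
      have "0 = (\<Sum>i\<in>I. w i * \<Phi> i u)" by (simp add: rel)
      also have "\<dots> = (\<Sum>(m, k, j)\<in>I. \<tau> ^ K * (w (m, k, j) * \<tau> ^ (m - K) * s ^ k * h u ^ j))"
      proof (intro sum.cong refl, clarify)
        fix m k j assume i: "(m, k, j) \<in> I"
        have "(\<Prod>a\<in>?R. (F u $ a - c $ a) ^ dig m a) = (\<Prod>a\<in>?R. \<tau> ^ (dig m a * B ^ e a))"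
          by (intro prod.cong refl) (simp add: u g_def power_mult[symmetric] mult.commute)
        also have "\<dots> = \<tau> ^ m"
          using i dig_sum[of m] by (simp add: power_sum[symmetric] I_def)
        finally have "\<Phi> (m, k, j) u = \<tau> ^ m * s ^ k * h u ^ j"
          by (simp add: \<Phi>_def u g_def)
        then show "w (m, k, j) * \<Phi> (m, k, j) u = \<tau> ^ K * (w (m, k, j) * \<tau> ^ (m - K) * s ^ k * h u ^ j)"
          using below[of m k j] i
          by (cases "m < K") (auto simp: power_add[symmetric] mult_ac)
      qed
      also have "\<dots> = \<tau> ^ K * R s (\<tau>, h u)"
        by (simp add: R_def sum_distrib_left case_prod_unfold)
      finally have "R s (\<tau>, h u) = 0" using \<tau> by simp
      moreover have "(\<tau>, u) \<in> T \<times> U" using \<tau> \<delta>(2) u by blast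
      ultimately show False using TU(4) by auto
    qed
    then show "(\<Sum>k\<le>B - 1. \<Sum>j\<le>B - 1. w (K, k, j) * s ^ k * h v ^ j) = 0"
      using R0 by simp
  qed
qed

section \<open>Roots of a polynomial with polynomial coefficients\<close>

text \<open>Continuity at \<open>(s0, 0)\<close>, where only the terms with \<open>j = 0\<close>
  survive.\<close>

lemma nonvanishing_near:
  fixes q :: "nat \<Rightarrow> nat \<Rightarrow> complex"
  assumes "(\<Sum>k\<le>D. q k 0 * s0 ^ k) \<noteq> 0"
  obtains \<delta> where "\<delta> > 0"
    "\<And>s u. dist s s0 < \<delta> \<Longrightarrow> norm u < \<delta> \<Longrightarrow> (\<Sum>k\<le>D. \<Sum>j\<le>E. q k j * s ^ k * u ^ j) \<noteq> 0"
proof -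
  let ?R = "\<lambda>p :: complex \<times> complex. \<Sum>k\<le>D. \<Sum>j\<le>E. q k j * fst p ^ k * snd p ^ j"
  have "?R (s0, 0) = (\<Sum>k\<le>D. q k 0 * s0 ^ k)"
    by (intro sum.cong refl) (simp add: power_0_left if_distrib[of "\<lambda>x. _ * x"] cong: if_cong)
  then have "?R (s0, 0) \<noteq> 0" using assms by simp
  moreover have "open (?R -` (- {0}))"
    by (intro open_vimage continuous_intros)
  ultimately obtain S U where SU: "open S" "open U" "(s0, 0) \<in> S \<times> U" "S \<times> U \<subseteq> ?R -` (- {0})"
    by (elim open_prod_elim[where x = "(s0, 0)"]) auto
  obtain d e where "d > 0" "ball s0 d \<subseteq> S" "e > 0" "ball 0 e \<subseteq> U"
    using SU open_contains_ball by (metis mem_Sigma_iff)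
  with SU(4) show thesis
    by (intro that[of "min d e"]) (auto simp: subset_iff dist_commute)
qed

text \<open>Divide by the lowest power \<open>u ^ J\<close> that occurs. The cofactor is nonzero
  near \<open>(s0, 0)\<close> unless \<open>s0\<close> is one of the finitely many roots of the
  coefficient of that power.\<close>

lemma roots_bounded_away_from_zero:
  fixes q :: "nat \<Rightarrow> nat \<Rightarrow> complex"
  assumes "\<exists>k\<le>D. \<exists>j\<le>D. q k j \<noteq> 0"
  obtains S where "finite S"
    "\<And>s0. s0 \<notin> S \<Longrightarrow> \<exists>\<delta>>0. \<forall>s u. dist s s0 < \<delta> \<longrightarrow> u \<noteq> 0 \<longrightarrow>
        (\<Sum>k\<le>D. \<Sum>j\<le>D. q k j * s ^ k * u ^ j) = 0 \<longrightarrow> norm u \<ge> \<delta>"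
proof -
  define J where "J = (LEAST j. \<exists>k\<le>D. q k j \<noteq> 0)"
  obtain j0 where j0: "j0 \<le> D" "\<exists>k\<le>D. q k j0 \<noteq> 0" using assms by blast
  then have J: "\<exists>k\<le>D. q k J \<noteq> 0" unfolding J_def by (intro LeastI)
  have "J \<le> D" 
    
    unfolding J_def by (rule le_trans[OF Least_le[where P = "\<lambda>j. \<exists>k\<le>D. q k j \<noteq> 0", OF j0(2)] j0(1)])
  have low: "q k j = 0" if "j < J" "k \<le> D" for k j
    using not_less_Least[of j "\<lambda>j. \<exists>k\<le>D. q k j \<noteq> 0"] that unfolding J_def by blast
  define S where "S = {s. (\<Sum>k\<le>D. q k J * s ^ k) = 0}"
  show thesis
  proof (rule that[of S])
    show "finite S" unfolding S_def using J by (simp add: polyfun_finite_roots)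
    fix s0 assume "s0 \<notin> S"
    then have "(\<Sum>k\<le>D. q k (0 + J) * s0 ^ k) \<noteq> 0" by (simp add: S_def)
    then obtain \<delta> where \<delta>: "\<delta> > 0" "\<And>s u. dist s s0 < \<delta> \<Longrightarrow> norm u < \<delta> \<Longrightarrow>
        (\<Sum>k\<le>D. \<Sum>j\<le>D - J. q k (j + J) * s ^ k * u ^ j) \<noteq> 0"
      using nonvanishing_near[of "\<lambda>k j. q k (j + J)"] by blast
    have factor: "(\<Sum>k\<le>D. \<Sum>j\<le>D. q k j * s ^ k * u ^ j) =
        u ^ J * (\<Sum>k\<le>D. \<Sum>j\<le>D - J. q k (j + J) * s ^ k * u ^ j)" for s u
    proof -
      have "(\<Sum>j\<le>D. q k j * s ^ k * u ^ j) = u ^ J * (\<Sum>j\<le>D - J. q k (j + J) * s ^ k * u ^ j)"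
        if "k \<le> D" for k
      proof -
        have "(\<Sum>j\<le>D. q k j * s ^ k * u ^ j) = (\<Sum>j\<in>{J..D}. q k j * s ^ k * u ^ j)"
          using low that by (intro sum.mono_neutral_right) auto
        also have "\<dots> = (\<Sum>j\<in>{0 + J..(D - J) + J}. q k j * s ^ k * u ^ j)"
          using \<open>J \<le> D\<close> by simp
        also have "\<dots> = (\<Sum>j\<in>{0..D - J}. q k (j + J) * s ^ k * u ^ (j + J))"
          by (rule sum.shift_bounds_cl_nat_ivl)
        finally show ?thesis
          by (simp add: sum_distrib_left power_add mult_ac atLeast0AtMost)
      qed
      then show ?thesis by (simp add: sum_distrib_left)
    qed
    show "\<exists>\<delta>>0. \<forall>s u. dist s s0 < \<delta> \<longrightarrow> u \<noteq> 0 \<longrightarrow>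
        (\<Sum>k\<le>D. \<Sum>j\<le>D. q k j * s ^ k * u ^ j) = 0 \<longrightarrow> norm u \<ge> \<delta>"
    proof (intro exI[of _ \<delta>] conjI allI impI \<delta>(1))
      fix s u
      assume "dist s s0 < \<delta>" "u \<noteq> 0" "(\<Sum>k\<le>D. \<Sum>j\<le>D. q k j * s ^ k * u ^ j) = 0"
      then show "norm u \<ge> \<delta>"
        using \<delta>(2)[of s u] factor[of s u] by (cases "norm u < \<delta>") auto
    qed
  qed
qed

text \<open>The reciprocals of the nonzero roots are the roots of the reversed polynomial.\<close>

lemma roots_locally_bounded:
  fixes q :: "nat \<Rightarrow> nat \<Rightarrow> complex"
  assumes "\<exists>k\<le>D. \<exists>j\<le>D. q k j \<noteq> 0"
  obtains S where "finite S"
    "\<And>s0. s0 \<notin> S \<Longrightarrow> \<exists>\<delta>>0. \<exists>C. \<forall>s u. dist s s0 < \<delta> \<longrightarrow>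
        (\<Sum>k\<le>D. \<Sum>j\<le>D. q k j * s ^ k * u ^ j) = 0 \<longrightarrow> norm u \<le> C"
proof -
  have "\<exists>k\<le>D. \<exists>j\<le>D. q k (D - j) \<noteq> 0"
    using assms by (metis diff_diff_cancel diff_le_self)
  then obtain S where S: "finite S"
    "\<And>s0. s0 \<notin> S \<Longrightarrow> \<exists>\<delta>>0. \<forall>s u. dist s s0 < \<delta> \<longrightarrow> u \<noteq> 0 \<longrightarrow>
        (\<Sum>k\<le>D. \<Sum>j\<le>D. q k (D - j) * s ^ k * u ^ j) = 0 \<longrightarrow> norm u \<ge> \<delta>"
    using roots_bounded_away_from_zero[of D "\<lambda>k j. q k (D - j)"] by blast
  show thesis
  proof (rule that[OF S(1)])
    fix s0 assume "s0 \<notin> S"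
    then obtain \<delta> where \<delta>: "\<delta> > 0"
      "\<And>s u. dist s s0 < \<delta> \<Longrightarrow> u \<noteq> 0 \<Longrightarrow>
        (\<Sum>k\<le>D. \<Sum>j\<le>D. q k (D - j) * s ^ k * u ^ j) = 0 \<Longrightarrow> norm u \<ge> \<delta>"
      using S(2) by blast
    have "norm u \<le> 1 / \<delta>"
      if s: "dist s s0 < \<delta>" and r: "(\<Sum>k\<le>D. \<Sum>j\<le>D. q k j * s ^ k * u ^ j) = 0" for s u
    proof (cases "u = 0")
      case False
      have "(\<Sum>j\<le>D. q k (D - j) * s ^ k * (1 / u) ^ j) =
          (1 / u) ^ D * (\<Sum>j\<le>D. q k j * s ^ k * u ^ j)" for k
      proof -
        have "(\<Sum>j\<le>D. q k (D - j) * s ^ k * (1 / u) ^ j) = (\<Sum>j\<le>D. q k j * s ^ k * (1 / u) ^ (D - j))"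
          by (rule sum.reindex_bij_witness[of _ "\<lambda>j. D - j" "\<lambda>j. D - j"]) auto
        also have "\<dots> = (\<Sum>j\<le>D. (1 / u) ^ D * (q k j * s ^ k * u ^ j))"
          using False by (intro sum.cong refl) (simp add: power_diff power_one_over field_simps)
        finally show ?thesis by (simp add: sum_distrib_left)
      qed
      then have "(\<Sum>k\<le>D. \<Sum>j\<le>D. q k (D - j) * s ^ k * (1 / u) ^ j) = 0"
        using r by (simp add: sum_distrib_left[symmetric])
      with \<delta>(2)[OF s, of "1 / u"] False have "norm (1 / u) \<ge> \<delta>" by simp
      then show ?thesis using \<delta>(1) False by (simp add: norm_divide field_simps)
    qed (use \<delta> in simp)
    then show "\<exists>\<delta>>0. \<exists>C. \<forall>s u. dist s s0 < \<delta> \<longrightarrow>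
        (\<Sum>k\<le>D. \<Sum>j\<le>D. q k j * s ^ k * u ^ j) = 0 \<longrightarrow> norm u \<le> C"
      using \<delta>(1) by blast
  qed
qed

text \<open>As \<open>s\<close> tends to \<open>0\<close>, roots cluster at finitely many points and at infinity.\<close>

lemma roots_cluster:
  fixes q :: "nat \<Rightarrow> nat \<Rightarrow> complex"
  assumes "\<exists>k\<le>D. \<exists>j\<le>D. q k j \<noteq> 0"
  obtains R where "finite R"
    "\<And>K. compact K \<Longrightarrow> K \<inter> R = {} \<Longrightarrow> \<exists>\<delta>>0. \<forall>s u. norm s < \<delta> \<longrightarrow> s \<noteq> 0 \<longrightarrow> u \<in> K \<longrightarrow>
        (\<Sum>k\<le>D. \<Sum>j\<le>D. q k j * s ^ k * u ^ j) \<noteq> 0"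
proof -
  \<comment> \<open>The relation is divided by the lowest power of \<open>s\<close>. What remains at
    \<open>s = 0\<close> is a nonzero polynomial in \<open>u\<close>, and its roots are the cluster
    points.\<close>
  define l where "l = (LEAST k. \<exists>j\<le>D. q k j \<noteq> 0)"
  obtain k0 where k0: "k0 \<le> D" "\<exists>j\<le>D. q k0 j \<noteq> 0" using assms by blast
  then have l: "\<exists>j\<le>D. q l j \<noteq> 0" unfolding l_def by (intro LeastI)
  have "l \<le> D" 
    
    unfolding l_def by (rule le_trans[OF Least_le[where P = "\<lambda>k. \<exists>j\<le>D. q k j \<noteq> 0", OF k0(2)] k0(1)])
  have low: "q k j = 0" if "k < l" "j \<le> D" for k j
    using not_less_Least[of k "\<lambda>k. \<exists>j\<le>D. q k j \<noteq> 0"] that unfolding l_def by blast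
  define T where "T p = (\<Sum>k\<le>D. \<Sum>j\<le>D. q k j * fst p ^ (k - l) * snd p ^ j)"
    for p :: "complex \<times> complex"
  have T0: "T (0, u) = (\<Sum>j\<le>D. q l j * u ^ j)" for u
  proof -
    have "T (0, u) = (\<Sum>k\<le>D. if k = l then \<Sum>j\<le>D. q l j * u ^ j else 0)"
      unfolding T_def
    proof (intro sum.cong refl)
      fix k
      show "(\<Sum>j\<le>D. q k j * fst (0, u) ^ (k - l) * snd (0, u) ^ j) =
          (if k = l then \<Sum>j\<le>D. q l j * u ^ j else 0)"
        using low by (cases k l rule: linorder_cases) (auto simp: power_0_left)
    qed
    then show ?thesis using \<open>l \<le> D\<close> by simp
  qed
  have Ts: "(\<Sum>k\<le>D. \<Sum>j\<le>D. q k j * s ^ k * u ^ j) = s ^ l * T (s, u)" for s u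
    unfolding T_def sum_distrib_left
  proof (intro sum.cong refl)
    fix k j assume "j \<in> {..D}"
    then show "q k j * s ^ k * u ^ j = s ^ l * (q k j * fst (s, u) ^ (k - l) * snd (s, u) ^ j)"
      using low[of k j] by (cases "k < l") (auto simp: power_add[symmetric] mult_ac)
  qed
  define R where "R = {u. (\<Sum>j\<le>D. q l j * u ^ j) = 0}"
  show thesis
  proof (rule that[of R])
    show "finite R" unfolding R_def using l by (simp add: polyfun_finite_roots)
    fix K assume K: "compact K" "K \<inter> R = {}"
    have "open (T -` (- {0}))"
      unfolding T_def by (intro open_vimage continuous_intros)
    moreover have "{0} \<times> K \<subseteq> T -` (- {0})"
      using K by (auto simp: R_def T0)
    \<comment> \<open>Compactness of \<open>K\<close> makes the range of \<open>s\<close> uniform in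
      \<open>u\<close>.\<close>
    ultimately obtain U V where UV: "open U" "0 \<in> U" "K \<subseteq> V" "U \<times> V \<subseteq> T -` (- {0})"
      using tube_lemma_right[of euclidean euclidean "T -` (- {0})" K 0] K
      by (auto simp: prod_topology_euclidean)
    obtain \<delta> where "\<delta> > 0" "ball 0 \<delta> \<subseteq> U" using UV open_contains_ball by blast
    with UV show "\<exists>\<delta>>0. \<forall>s u. norm s < \<delta> \<longrightarrow> s \<noteq> 0 \<longrightarrow> u \<in> K \<longrightarrow>
        (\<Sum>k\<le>D. \<Sum>j\<le>D. q k j * s ^ k * u ^ j) \<noteq> 0"
      by (intro exI[of _ \<delta>]) (auto simp: Ts subset_iff)
  qed
qed

section \<open>Regular points of the fibres of a polynomial map\<close>

locale polynomial_map =
  fixes F :: "complex ^ 'r::finite \<Rightarrow> complex ^ 'r"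
    and A :: "complex ^ 'r \<Rightarrow> complex ^ 'r ^ 'r"
  assumes F_poly: "poly_fun (\<lambda>v. F v $ a)"
    and A_poly: "poly_fun (\<lambda>v. A v $ a $ b)"
    and F_deriv: "(F has_derivative (\<lambda>h. A v *v h)) (at v)"
begin

text \<open>Singular points are left out because a whole fibre may be infinite, whereas regular
  points are isolated.\<close>

definition regular_fibre :: "complex ^ 'r \<Rightarrow> (complex ^ 'r) set" where
  "regular_fibre c = {v. F v = c \<and> det (A v) \<noteq> 0}"

lemma det_poly: "poly_fun (\<lambda>v. det (A v))"
  by (intro poly_fun_det A_poly)

lemma continuous_on_det: "continuous_on S (\<lambda>v. det (A v))"
  by (rule poly_fun_continuous_on[OF det_poly])

lemma continuous_on_F: "continuous_on S F"
  using F_deriv has_derivative_continuous continuous_at_imp_continuous_on by blast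

text \<open>The inverse function theorem, on a neighbourhood where the determinant stays nonzero.
  The derivative is wrapped as a bounded linear map to express its continuity in the operator
  norm.\<close>

lemma local_inverse:
  assumes "det (A v) \<noteq> 0" "open W" "v \<in> W"
  obtains U where "open U" "v \<in> U" "U \<subseteq> W" "inj_on F U" "open (F ` U)"
    "\<And>u. u \<in> U \<Longrightarrow> det (A u) \<noteq> 0"
proof -
  define f' where "f' v = Blinfun (\<lambda>h. A v *v h)" for v
  have f': "blinfun_apply (f' v) = (\<lambda>h. A v *v h)" for v
    unfolding f'_def by (rule bounded_linear_Blinfun_apply) simp
  obtain B where B: "B ** A v = mat 1"
    using assms(1) by (auto simp: invertible_det_nz[symmetric] invertible_def)
  define W' where "W' = W \<inter> (\<lambda>v. det (A v)) -` (- {0})"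
  have "open W'"
    unfolding W'_def using assms(2) by (intro open_Int open_vimage continuous_on_det) auto
  moreover have "(F has_derivative (blinfun_apply (f' x))) (at x)" for x
    unfolding f' by (rule F_deriv)
  moreover have "continuous_on W' f'"
  proof (rule continuous_on_blinfun_componentwise)
    fix i :: "complex ^ 'r"
    show "continuous_on W' (\<lambda>x. blinfun_apply (f' x) i)"
      unfolding f' matrix_vector_mult_def
      by (intro continuous_on_vec_lambda continuous_intros poly_fun_continuous_on[OF A_poly])
  qed
  moreover have "v \<in> W'" using assms by (simp add: W'_def)
  moreover have "Blinfun (\<lambda>h. B *v h) o\<^sub>L f' v = id_blinfun"
    by (rule blinfun_eqI) (simp add: f' bounded_linear_Blinfun_apply matrix_vector_mul_assoc B)
  ultimately obtain U V g where "open U" "U \<subseteq> W'" "v \<in> U" "open V" "homeomorphism U V F g"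
    by (rule inverse_function_theorem) auto
  moreover from this have "F ` U = V" "inj_on F U"
    by (auto simp: homeomorphism_def intro: inj_on_inverseI)
  ultimately show thesis
    by (intro that[of U]) (auto simp: W'_def)
qed

lemma open_at_regular_point: "det (A v) \<noteq> 0 \<Longrightarrow> open_at F v"
  unfolding open_at_def
proof (intro allI impI)
  fix W assume "det (A v) \<noteq> 0" "open W" "v \<in> W"
  then obtain U where "v \<in> U" "U \<subseteq> W" "open (F ` U)" by (rule local_inverse)
  then show "F v \<in> interior (F ` W)"
    by (meson image_eqI image_mono interiorI)
qed

text \<open>Balls whose radius is half the distance to the rest of the fibre are disjoint; the local
  inverses are taken inside them.\<close>

lemma disjoint_local_inverses:
  assumes fin: "finite (regular_fibre c)"
    and W: "\<forall>v\<in>regular_fibre c. open (W v) \<and> v \<in> W v"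
  obtains U where "\<forall>v\<in>regular_fibre c. open (U v) \<and> v \<in> U v \<and> U v \<subseteq> W v \<and>
      inj_on F (U v) \<and> open (F ` U v) \<and> (\<forall>u\<in>U v. det (A u) \<noteq> 0)"
    "\<forall>v\<in>regular_fibre c. \<forall>w\<in>regular_fibre c. v \<noteq> w \<longrightarrow> U v \<inter> U w = {}"
proof -
  have "\<forall>v. \<exists>d>0. \<forall>w\<in>regular_fibre c. w \<noteq> v \<longrightarrow> d \<le> dist v w"
    using finite_set_avoid[OF fin] by blast
  then obtain d where d: "\<And>v. d v > 0"
    "\<And>v w. w \<in> regular_fibre c \<Longrightarrow> w \<noteq> v \<Longrightarrow> d v \<le> dist v w" by metis
  have "\<forall>v\<in>regular_fibre c. \<exists>U. open U \<and> v \<in> U \<and> U \<subseteq> W v \<inter> ball v (d v / 2) \<and>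
      inj_on F U \<and> open (F ` U) \<and> (\<forall>u\<in>U. det (A u) \<noteq> 0)"
  proof
    fix v assume v: "v \<in> regular_fibre c"
    then have "det (A v) \<noteq> 0" "open (W v \<inter> ball v (d v / 2))" "v \<in> W v \<inter> ball v (d v / 2)"
      using W d(1) by (auto simp: regular_fibre_def)
    then show "\<exists>U. open U \<and> v \<in> U \<and> U \<subseteq> W v \<inter> ball v (d v / 2) \<and>
      inj_on F U \<and> open (F ` U) \<and> (\<forall>u\<in>U. det (A u) \<noteq> 0)"
      by (rule local_inverse) blast
  qed
  from bchoice[OF this] obtain U where U: "\<forall>v\<in>regular_fibre c. open (U v) \<and> v \<in> U v \<and>
      U v \<subseteq> W v \<inter> ball v (d v / 2) \<and> inj_on F (U v) \<and> open (F ` U v) \<and>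
      (\<forall>u\<in>U v. det (A u) \<noteq> 0)"
    by blast
  have "U v \<inter> U w = {}" if "v \<in> regular_fibre c" "w \<in> regular_fibre c" "v \<noteq> w" for v w
  proof (rule ccontr)
    assume "U v \<inter> U w \<noteq> {}"
    then obtain x where "x \<in> U v" "x \<in> U w" by blast
    then have "x \<in> ball v (d v / 2)" "x \<in> ball w (d w / 2)"
      using U that by blast+
    then have "dist v x < d v / 2" "dist w x < d w / 2" by simp_all
    moreover have "d v \<le> dist v w" "d w \<le> dist w v" using d(2) that by auto
    moreover have "dist v w \<le> dist v x + dist w x" by (rule dist_triangle2)
    ultimately show False by (simp add: dist_commute)
  qed
  with U show thesis by (intro that[of U]) auto
qed

text \<open>Each point of the fibre continues to exactly one nearby point, by local inversion. By
  \<open>usc\<close> no further points appear, and since none lies on the boundary of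
  \<open>Q\<close>, none crosses it.\<close>

lemma card_fibre_locally_constant:
  fixes g :: "'t \<Rightarrow> complex ^ 'r"
  assumes fin: "finite (regular_fibre c)" and lim: "(g \<longlongrightarrow> c) G"
    and Q: "open Q" "regular_fibre c \<inter> closure Q \<subseteq> Q"
    and usc: "\<And>U. open U \<Longrightarrow> regular_fibre c \<subseteq> U \<Longrightarrow> \<forall>\<^sub>F x in G. regular_fibre (g x) \<subseteq> U"
  shows "\<forall>\<^sub>F x in G. card (regular_fibre (g x) \<inter> Q) = card (regular_fibre c \<inter> Q)"
proof -
  \<comment> \<open>Each neighbourhood lies wholly inside \<open>Q\<close> or wholly off its
    closure, so a continued point is in \<open>Q\<close> exactly when the original one is.\<close>
  define W where "W v = (if v \<in> Q then Q else - closure Q)" for v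
  have "\<forall>v\<in>regular_fibre c. open (W v) \<and> v \<in> W v"
    using Q by (auto simp: W_def)
  from disjoint_local_inverses[OF fin this]
  obtain U where U0: "\<forall>v\<in>regular_fibre c. open (U v) \<and> v \<in> U v \<and> U v \<subseteq> W v \<and>
      inj_on F (U v) \<and> open (F ` U v) \<and> (\<forall>u\<in>U v. det (A u) \<noteq> 0)"
    "\<forall>v\<in>regular_fibre c. \<forall>w\<in>regular_fibre c. v \<noteq> w \<longrightarrow> U v \<inter> U w = {}"
    by blast
  then have U: "\<And>v. v \<in> regular_fibre c \<Longrightarrow> open (F ` U v)"
    "\<And>v. v \<in> regular_fibre c \<Longrightarrow> open (U v)"
    "\<And>v. v \<in> regular_fibre c \<Longrightarrow> v \<in> U v" "\<And>v. v \<in> regular_fibre c \<Longrightarrow> U v \<subseteq> W v"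
    "\<And>v. v \<in> regular_fibre c \<Longrightarrow> inj_on F (U v)"
    "\<And>v u. v \<in> regular_fibre c \<Longrightarrow> u \<in> U v \<Longrightarrow> det (A u) \<noteq> 0"
    "\<And>v w. v \<in> regular_fibre c \<Longrightarrow> w \<in> regular_fibre c \<Longrightarrow> v \<noteq> w \<Longrightarrow> U v \<inter> U w = {}"
    by blast+
  have "\<forall>\<^sub>F x in G. g x \<in> F ` U v" if v: "v \<in> regular_fibre c" for v
  proof -
    have "c \<in> F ` U v" using U(3)[OF v] v by (auto simp: regular_fibre_def)
    then show ?thesis using topological_tendstoD[OF lim U(1)[OF v]] by simp
  qed
  then have "\<forall>\<^sub>F x in G. \<forall>v\<in>regular_fibre c. g x \<in> F ` U v"
    using fin by (simp add: eventually_ball_finite)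
  moreover have "\<forall>\<^sub>F x in G. regular_fibre (g x) \<subseteq> (\<Union>v\<in>regular_fibre c. U v)"
    using U by (intro usc) auto
  ultimately show ?thesis
  proof eventually_elim
    case (elim x)
    then have "\<forall>v\<in>regular_fibre c. \<exists>u. u \<in> U v \<and> F u = g x"
      by (simp add: image_iff Bex_def) metis
    then obtain s where s: "\<And>v. v \<in> regular_fibre c \<Longrightarrow> s v \<in> U v \<and> F (s v) = g x" by metis
    have inQ: "s v \<in> Q \<longleftrightarrow> v \<in> Q" if "v \<in> regular_fibre c" for v
      using s[OF that] U(4)[OF that] closure_subset[of Q] by (auto simp: W_def split: if_splits)
    have "inj_on s (regular_fibre c)"
      using s U(7) by (intro inj_onI) (metis disjoint_iff)
    then have "inj_on s (regular_fibre c \<inter> Q)" by (rule inj_on_subset) auto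
    moreover have "s ` (regular_fibre c \<inter> Q) = regular_fibre (g x) \<inter> Q"
    proof
      show "s ` (regular_fibre c \<inter> Q) \<subseteq> regular_fibre (g x) \<inter> Q"
        using s U(6) inQ by (auto simp: regular_fibre_def[of "g x"])
      show "regular_fibre (g x) \<inter> Q \<subseteq> s ` (regular_fibre c \<inter> Q)"
      proof
        fix u assume u: "u \<in> regular_fibre (g x) \<inter> Q"
        then obtain v where v: "v \<in> regular_fibre c" "u \<in> U v" using elim(2) by blast
        then have "u = s v"
          using s[OF v(1)] U(5)[OF v(1)] u by (auto simp: regular_fibre_def inj_on_def)
        then show "u \<in> s ` (regular_fibre c \<inter> Q)" using inQ[OF v(1)] v u by auto
      qed
    qed
    ultimately show ?case using card_image by fastforce
  qed
qed

text \<open>If the fibre over \<open>c\<close> has the largest possible number of points, then the nearby fibres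
  have no room for points far from it.\<close>

lemma maximal_fibre_upper_semicontinuous:
  assumes fin: "\<And>c. finite (regular_fibre c)" and max: "\<And>c'. card (regular_fibre c') \<le> card (regular_fibre c)"
    and W: "open W" "regular_fibre c \<subseteq> W"
  shows "\<forall>\<^sub>F c' in nhds c. regular_fibre c' \<subseteq> W"
proof -
  have "\<forall>v\<in>regular_fibre c. open W \<and> v \<in> W" using W by auto
  from disjoint_local_inverses[OF fin this]
  obtain U where U0: "\<forall>v\<in>regular_fibre c. open (U v) \<and> v \<in> U v \<and> U v \<subseteq> W \<and>
      inj_on F (U v) \<and> open (F ` U v) \<and> (\<forall>u\<in>U v. det (A u) \<noteq> 0)"
    "\<forall>v\<in>regular_fibre c. \<forall>w\<in>regular_fibre c. v \<noteq> w \<longrightarrow> U v \<inter> U w = {}"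
    by blast
  then have U: "\<And>v. v \<in> regular_fibre c \<Longrightarrow> open (F ` U v)"
    "\<And>v. v \<in> regular_fibre c \<Longrightarrow> v \<in> U v" "\<And>v. v \<in> regular_fibre c \<Longrightarrow> U v \<subseteq> W"
    "\<And>v u. v \<in> regular_fibre c \<Longrightarrow> u \<in> U v \<Longrightarrow> det (A u) \<noteq> 0"
    "\<And>v w. v \<in> regular_fibre c \<Longrightarrow> w \<in> regular_fibre c \<Longrightarrow> v \<noteq> w \<Longrightarrow> U v \<inter> U w = {}"
    by blast+
  have "\<forall>\<^sub>F c' in nhds c. c' \<in> F ` U v" if v: "v \<in> regular_fibre c" for v
  proof -
    have "c \<in> F ` U v" using U(2)[OF v] v by (auto simp: regular_fibre_def)
    then show ?thesis using U(1)[OF v] by (rule eventually_nhds_in_open[rotated])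
  qed
  then have "\<forall>\<^sub>F c' in nhds c. \<forall>v\<in>regular_fibre c. c' \<in> F ` U v"
    using fin by (simp add: eventually_ball_finite)
  then show ?thesis
  proof eventually_elim
    case (elim c')
    then have "\<forall>v\<in>regular_fibre c. \<exists>u. u \<in> U v \<and> F u = c'" by auto
    then obtain s where s: "\<And>v. v \<in> regular_fibre c \<Longrightarrow> s v \<in> U v \<and> F (s v) = c'" by metis
    have "inj_on s (regular_fibre c)"
      using s U(5) by (intro inj_onI) (metis disjoint_iff)
    then have "card (s ` regular_fibre c) = card (regular_fibre c)" by (rule card_image)
    moreover have "s ` regular_fibre c \<subseteq> regular_fibre c'"
      using s U(4) by (auto simp: regular_fibre_def[of c'])
    \<comment> \<open>The continued points already reach the maximal number, so they exhaust the
      fibre over \<open>c'\<close>.\<close>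
    ultimately have "regular_fibre c' = s ` regular_fibre c"
      using fin max[of c'] by (intro card_seteq[symmetric]) auto
    moreover have "s v \<in> W" if "v \<in> regular_fibre c" for v
      using s[OF that] U(3)[OF that] by blast
    ultimately show ?case by auto
  qed
qed

end

lemma continuous_on_upd: "continuous_on S (upd (c :: complex ^ 'n::finite) b)"
  unfolding upd_def
proof (rule continuous_on_vec_lambda)
  show "continuous_on S (\<lambda>t. if a = b then t else c $ a)" for a
    by (cases "a = b") (auto intro!: continuous_intros)
qed

section \<open>Regular fibres over a line in the target space\<close>

context polynomial_map
begin

text \<open>\<open>upd c b s\<close> runs through the line through \<open>c\<close> in direction
  \<open>b\<close>. Since regular points are points of local openness, one relation serves all
  regular fibres over this line. It is applied to the coordinates and to the Jacobian
  determinant.\<close>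

lemma line_coordinates:
  assumes "poly_fun h"
  obtains D :: nat and q where "\<exists>k\<le>D. \<exists>j\<le>D. q k j \<noteq> 0"
    "\<And>s v. v \<in> regular_fibre (upd c b s) \<Longrightarrow> (\<Sum>k\<le>D. \<Sum>j\<le>D. q k j * s ^ k * h v ^ j) = 0"
proof (rule algebraic_dependence[OF F_poly assms])
  fix D :: nat and q
  assume "\<exists>k\<le>D. \<exists>j\<le>D. q k j \<noteq> 0"
    and "\<And>s v. F v = upd c b s \<Longrightarrow> open_at F v \<Longrightarrow> (\<Sum>k\<le>D. \<Sum>j\<le>D. q k j * s ^ k * h v ^ j) = 0"
  then show thesis
    using open_at_regular_point by (intro that[of D q]) (auto simp: regular_fibre_def)
qed

text \<open>Each coordinate of a regular point is a root of a polynomial over \<open>s\<close>, and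
  such roots are locally bounded off finitely many \<open>s\<close>; the exceptional sets of all
  coordinates are united.\<close>

lemma fibre_locally_bounded:
  obtains S where "finite S"
    "\<And>s0. s0 \<notin> S \<Longrightarrow> \<exists>\<delta>>0. \<exists>C. \<forall>s v. dist s s0 < \<delta> \<longrightarrow> v \<in> regular_fibre (upd c b s) \<longrightarrow> norm v \<le> C"
proof -
  have "\<exists>S. finite S \<and> (\<forall>s0. s0 \<notin> S \<longrightarrow> (\<exists>\<delta>>0. \<exists>C. \<forall>s v. dist s s0 < \<delta> \<longrightarrow>
      v \<in> regular_fibre (upd c b s) \<longrightarrow> norm (v $ a) \<le> C))" for a
  proof -
    obtain D q where q: "\<exists>k\<le>D. \<exists>j\<le>D. q k j \<noteq> 0"
      "\<And>s v. v \<in> regular_fibre (upd c b s) \<Longrightarrow> (\<Sum>k\<le>D. \<Sum>j\<le>D. q k j * s ^ k * v $ a ^ j) = 0"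
      by (rule line_coordinates[where h = "\<lambda>v. v $ a" and c = c and b = b, OF poly_fun.component]) (rule that)
    obtain S where S: "finite S"
      "\<And>s0. s0 \<notin> S \<Longrightarrow> \<exists>\<delta>>0. \<exists>C. \<forall>s u. dist s s0 < \<delta> \<longrightarrow>
        (\<Sum>k\<le>D. \<Sum>j\<le>D. q k j * s ^ k * u ^ j) = 0 \<longrightarrow> norm u \<le> C"
      using roots_locally_bounded[OF q(1)] by blast
    show ?thesis
    proof (intro exI[of _ S] conjI S(1) allI impI)
      fix s0 assume "s0 \<notin> S"
      then obtain \<delta> C where "\<delta> > 0" "\<And>s u. dist s s0 < \<delta> \<Longrightarrow>
        (\<Sum>k\<le>D. \<Sum>j\<le>D. q k j * s ^ k * u ^ j) = 0 \<Longrightarrow> norm u \<le> C"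
        using S(2) by blast
      then show "\<exists>\<delta>>0. \<exists>C. \<forall>s v. dist s s0 < \<delta> \<longrightarrow> v \<in> regular_fibre (upd c b s) \<longrightarrow> norm (v $ a) \<le> C"
        using q(2) by (intro exI[of _ \<delta>] exI[of _ C] conjI allI impI) auto
    qed
  qed
  then have "\<exists>S. \<forall>a. finite (S a) \<and> (\<forall>s0. s0 \<notin> S a \<longrightarrow> (\<exists>\<delta>>0. \<exists>C. \<forall>s v. dist s s0 < \<delta> \<longrightarrow>
      v \<in> regular_fibre (upd c b s) \<longrightarrow> norm (v $ a) \<le> C))"
    by (intro choice allI)
  then obtain S where S': "\<forall>a. finite (S a) \<and> (\<forall>s0. s0 \<notin> S a \<longrightarrow> (\<exists>\<delta>>0. \<exists>C. \<forall>s v. dist s s0 < \<delta> \<longrightarrow>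
      v \<in> regular_fibre (upd c b s) \<longrightarrow> norm (v $ a) \<le> C))"
    by (rule exE)
  have S: "finite (S a)" "s0 \<notin> S a \<Longrightarrow> \<exists>\<delta>>0. \<exists>C. \<forall>s v. dist s s0 < \<delta> \<longrightarrow>
      v \<in> regular_fibre (upd c b s) \<longrightarrow> norm (v $ a) \<le> C" for a s0
    by (rule S'[THEN spec, THEN conjunct1], rule S'[THEN spec, THEN conjunct2, THEN spec, THEN mp])
  show thesis
  proof (rule that[of "\<Union>a. S a"])
    show "finite (\<Union>a. S a)" using S(1) by simp
    fix s0 assume "s0 \<notin> (\<Union>a. S a)"
    then have "\<forall>a. \<exists>p. fst p > 0 \<and> (\<forall>s v. dist s s0 < fst p \<longrightarrow>
      v \<in> regular_fibre (upd c b s) \<longrightarrow> norm (v $ a) \<le> snd p)"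
      using S(2) by (auto 0 4)
    from choice[OF this] obtain p where p: "\<And>a. fst (p a) > 0" "\<And>a s v. dist s s0 < fst (p a) \<Longrightarrow>
      v \<in> regular_fibre (upd c b s) \<Longrightarrow> norm (v $ a) \<le> snd (p a)"
      by blast
    define \<delta> where "\<delta> = Min (range (\<lambda>a. fst (p a)))"
    have "\<delta> > 0" using p(1) by (auto simp: \<delta>_def)
    moreover have "norm v \<le> (\<Sum>a\<in>UNIV. snd (p a))"
      if "dist s s0 < \<delta>" "v \<in> regular_fibre (upd c b s)" for s v
    proof -
      have "norm v \<le> (\<Sum>a\<in>UNIV. norm (v $ a))"
        unfolding norm_vec_def by (rule L2_set_le_sum) simp
      also have "\<dots> \<le> (\<Sum>a\<in>UNIV. snd (p a))"
        using that by (intro sum_mono p(2)[of s]) (auto simp: \<delta>_def)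
      finally show ?thesis .
    qed
    ultimately show "\<exists>\<delta>>0. \<exists>C. \<forall>s v. dist s s0 < \<delta> \<longrightarrow> v \<in> regular_fibre (upd c b s) \<longrightarrow> norm v \<le> C"
      by blast
  qed
qed

text \<open>Off finitely many parameters, regular points stay bounded and their determinants stay
  away from 0. Hence limits of regular points are regular points of the limit fibre, and none can
  escape an open neighbourhood of it.\<close>

lemma fibre_upper_semicontinuous:
  obtains S where "finite S"
    "\<And>s0 W. s0 \<notin> S \<Longrightarrow> open W \<Longrightarrow> regular_fibre (upd c b s0) \<subseteq> W \<Longrightarrow>
      \<forall>\<^sub>F s in nhds s0. regular_fibre (upd c b s) \<subseteq> W"
proof -
  obtain S1 where S1: "finite S1"
    "\<And>s0. s0 \<notin> S1 \<Longrightarrow> \<exists>\<delta>>0. \<exists>C. \<forall>s v. dist s s0 < \<delta> \<longrightarrow> v \<in> regular_fibre (upd c b s) \<longrightarrow> norm v \<le> C"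
    by (rule fibre_locally_bounded[where c = c and b = b]) (rule that)
  obtain D q where q: "\<exists>k\<le>D. \<exists>j\<le>D. q k j \<noteq> 0"
    "\<And>s v. v \<in> regular_fibre (upd c b s) \<Longrightarrow> (\<Sum>k\<le>D. \<Sum>j\<le>D. q k j * s ^ k * det (A v) ^ j) = 0"
    by (rule line_coordinates[where c = c and b = b, OF det_poly]) (rule that)
  obtain S2 where S2: "finite S2"
    "\<And>s0. s0 \<notin> S2 \<Longrightarrow> \<exists>\<delta>>0. \<forall>s u. dist s s0 < \<delta> \<longrightarrow> u \<noteq> 0 \<longrightarrow>
        (\<Sum>k\<le>D. \<Sum>j\<le>D. q k j * s ^ k * u ^ j) = 0 \<longrightarrow> norm u \<ge> \<delta>"
    using roots_bounded_away_from_zero[OF q(1)] by blast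
  show thesis
  proof (rule that[of "S1 \<union> S2"])
    show "finite (S1 \<union> S2)" using S1(1) S2(1) by simp
    fix s0 W
    assume s0: "s0 \<notin> S1 \<union> S2" and W: "open W" "regular_fibre (upd c b s0) \<subseteq> W"
    obtain \<delta>1 C where d1: "\<delta>1 > 0"
      "\<And>s v. dist s s0 < \<delta>1 \<Longrightarrow> v \<in> regular_fibre (upd c b s) \<Longrightarrow> norm v \<le> C"
      using S1(2) s0 by blast
    obtain \<delta>2 where d2: "\<delta>2 > 0" "\<And>s u. dist s s0 < \<delta>2 \<Longrightarrow> u \<noteq> 0 \<Longrightarrow>
        (\<Sum>k\<le>D. \<Sum>j\<le>D. q k j * s ^ k * u ^ j) = 0 \<Longrightarrow> norm u \<ge> \<delta>2"
      using S2(2) s0 by blast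
    show "\<forall>\<^sub>F s in nhds s0. regular_fibre (upd c b s) \<subseteq> W"
    proof (rule ccontr)
      assume neg: "\<not> (\<forall>\<^sub>F s in nhds s0. regular_fibre (upd c b s) \<subseteq> W)"
      have "\<exists>p. dist (fst p) s0 < min (min \<delta>1 \<delta>2) (1 / Suc n) \<and>
          snd p \<in> regular_fibre (upd c b (fst p)) \<and> snd p \<notin> W" for n
      proof (rule ccontr)
        assume "\<nexists>p. dist (fst p) s0 < min (min \<delta>1 \<delta>2) (1 / Suc n) \<and>
          snd p \<in> regular_fibre (upd c b (fst p)) \<and> snd p \<notin> W"
        then have "\<forall>s. dist s s0 < min (min \<delta>1 \<delta>2) (1 / Suc n) \<longrightarrow> regular_fibre (upd c b s) \<subseteq> W"
          by auto
        moreover have "min (min \<delta>1 \<delta>2) (1 / Suc n) > 0" using d1 d2 by simp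
        ultimately show False using neg unfolding eventually_nhds_metric by blast
      qed
      \<comment> \<open>\<open>p n\<close> pairs a parameter tending to \<open>s0\<close> with a
        regular point outside \<open>W\<close> over that parameter.\<close>
      then have "\<exists>p. \<forall>n. dist (fst (p n)) s0 < min (min \<delta>1 \<delta>2) (1 / Suc n) \<and>
          snd (p n) \<in> regular_fibre (upd c b (fst (p n))) \<and> snd (p n) \<notin> W"
        by (intro choice allI)
      then obtain p where p: "\<And>n. dist (fst (p n)) s0 < min (min \<delta>1 \<delta>2) (1 / Suc n)"
        "\<And>n. snd (p n) \<in> regular_fibre (upd c b (fst (p n)))" "\<And>n. snd (p n) \<notin> W"
        by blast
      have inK: "\<forall>n. snd (p n) \<in> cball 0 C \<inter> - W"
        using d1(2) p by (metis Compl_iff IntI dist_0_norm mem_cball min_less_iff_conj)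
      have "compact (cball 0 C \<inter> - W)"
        using W by (intro compact_Int_closed) auto
      then obtain l r where l: "l \<in> cball 0 C \<inter> - W" "strict_mono r"
        "((\<lambda>n. snd (p n)) \<circ> r) \<longlonglongrightarrow> l"
        using inK by (rule seq_compactE[OF compact_imp_seq_compact]) (rule that)
      have "(\<lambda>n. fst (p n)) \<longlonglongrightarrow> s0"
      proof (rule tendstoI)
        fix e :: real assume "e > 0"
        then have "\<forall>\<^sub>F n in sequentially. 1 / Suc n < e"
          using order_tendstoD(2)[OF LIMSEQ_inverse_real_of_nat] by (simp add: inverse_eq_divide)
        then show "\<forall>\<^sub>F n in sequentially. dist (fst (p n)) s0 < e"
        proof eventually_elim
          case (elim n)
          then show ?case using p(1)[of n] by linarith
        qed
      qed
      from LIMSEQ_subseq_LIMSEQ[OF this l(2)]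
      have s: "(\<lambda>n. fst (p (r n))) \<longlonglongrightarrow> s0" by (simp add: o_def)
      have v: "(\<lambda>n. snd (p (r n))) \<longlonglongrightarrow> l" using l(3) by (simp add: o_def)
      have "(\<lambda>n. F (snd (p (r n)))) \<longlonglongrightarrow> F l"
        using continuous_on_tendsto_compose[where s = UNIV, OF continuous_on_F v] by simp
      moreover have "(\<lambda>n. upd c b (fst (p (r n)))) \<longlonglongrightarrow> upd c b s0"
        using continuous_on_tendsto_compose[where s = UNIV, OF continuous_on_upd s] by simp
      moreover have "F (snd (p n)) = upd c b (fst (p n))" for n
        using p(2)[of n] by (simp add: regular_fibre_def)
      ultimately have "F l = upd c b s0"
        by (simp add: LIMSEQ_unique)
      \<comment> \<open>The determinants are nonzero roots of the relation \<open>q\<close>, so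
        their lower bound passes to the limit.\<close>
      moreover have "norm (det (A l)) \<ge> \<delta>2"
      proof (rule tendsto_lowerbound)
        show "(\<lambda>n. norm (det (A (snd (p (r n)))))) \<longlonglongrightarrow> norm (det (A l))"
          using continuous_on_tendsto_compose[where s = UNIV, OF continuous_on_det v] by (intro tendsto_norm) simp
        show "\<forall>\<^sub>F n in sequentially. \<delta>2 \<le> norm (det (A (snd (p (r n)))))"
        proof (intro always_eventually allI)
          fix n
          show "\<delta>2 \<le> norm (det (A (snd (p (r n)))))"
            using p(1)[of "r n"] p(2)[of "r n"]
            by (intro d2(2)[OF _ _ q(2)]) (auto simp: regular_fibre_def)
        qed
      qed simp
      ultimately have "l \<in> regular_fibre (upd c b s0)"
        using d2(1) by (auto simp: regular_fibre_def)
      then show False using W(2) l(1) by blast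
    qed
  qed
qed

text \<open>As \<open>s\<close> tends to 0, each coordinate of the regular points accumulates only
  at finitely many values or at infinity. A circle about \<open>e $ a\<close> that misses these
  values is therefore avoided for all small \<open>s\<close>.\<close>

lemma fibre_clusters:
  assumes "\<eta>0 > 0"
  obtains \<eta> \<delta> where "0 < \<eta>" "\<eta> < \<eta>0" "\<delta> > 0"
    "\<And>s v a. s \<noteq> 0 \<Longrightarrow> norm s < \<delta> \<Longrightarrow> v \<in> regular_fibre (upd c b s) \<Longrightarrow> dist (v $ a) (e $ a) \<noteq> \<eta>"
proof -
  have "\<exists>R. finite R \<and> (\<forall>K. compact K \<longrightarrow> K \<inter> R = {} \<longrightarrow> (\<exists>\<delta>>0. \<forall>s v. norm s < \<delta> \<longrightarrow> s \<noteq> 0 \<longrightarrow>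
      v \<in> regular_fibre (upd c b s) \<longrightarrow> v $ a \<notin> K))" for a
  proof -
    obtain D q where q: "\<exists>k\<le>D. \<exists>j\<le>D. q k j \<noteq> 0"
      "\<And>s v. v \<in> regular_fibre (upd c b s) \<Longrightarrow> (\<Sum>k\<le>D. \<Sum>j\<le>D. q k j * s ^ k * v $ a ^ j) = 0"
      by (rule line_coordinates[where h = "\<lambda>v. v $ a" and c = c and b = b, OF poly_fun.component]) (rule that)
    obtain R where R: "finite R"
      "\<And>K. compact K \<Longrightarrow> K \<inter> R = {} \<Longrightarrow> \<exists>\<delta>>0. \<forall>s u. norm s < \<delta> \<longrightarrow> s \<noteq> 0 \<longrightarrow> u \<in> K \<longrightarrow>
        (\<Sum>k\<le>D. \<Sum>j\<le>D. q k j * s ^ k * u ^ j) \<noteq> 0"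
      using roots_cluster[OF q(1)] by blast
    show ?thesis
    proof (intro exI[of _ R] conjI R(1) allI impI)
      fix K assume "compact K" "K \<inter> R = {}"
      then obtain \<delta> where "\<delta> > 0" "\<And>s u. norm s < \<delta> \<Longrightarrow> s \<noteq> 0 \<Longrightarrow> u \<in> K \<Longrightarrow>
        (\<Sum>k\<le>D. \<Sum>j\<le>D. q k j * s ^ k * u ^ j) \<noteq> 0"
        using R(2) by blast
      then show "\<exists>\<delta>>0. \<forall>s v. norm s < \<delta> \<longrightarrow> s \<noteq> 0 \<longrightarrow> v \<in> regular_fibre (upd c b s) \<longrightarrow> v $ a \<notin> K"
        using q(2) by (intro exI[of _ \<delta>] conjI allI impI notI) auto
    qed
  qed
  then have "\<exists>R. \<forall>a. finite (R a) \<and> (\<forall>K. compact K \<longrightarrow> K \<inter> R a = {} \<longrightarrow> (\<exists>\<delta>>0. \<forall>s v. norm s < \<delta> \<longrightarrow> s \<noteq> 0 \<longrightarrow>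
      v \<in> regular_fibre (upd c b s) \<longrightarrow> v $ a \<notin> K))"
    by (intro choice allI)
  then obtain R where R': "\<forall>a. finite (R a) \<and> (\<forall>K. compact K \<longrightarrow> K \<inter> R a = {} \<longrightarrow>
      (\<exists>\<delta>>0. \<forall>s v. norm s < \<delta> \<longrightarrow> s \<noteq> 0 \<longrightarrow> v \<in> regular_fibre (upd c b s) \<longrightarrow> v $ a \<notin> K))"
    by (rule exE)
  have R: "finite (R a)" "compact K \<Longrightarrow> K \<inter> R a = {} \<Longrightarrow>
      \<exists>\<delta>>0. \<forall>s v. norm s < \<delta> \<longrightarrow> s \<noteq> 0 \<longrightarrow> v \<in> regular_fibre (upd c b s) \<longrightarrow> v $ a \<notin> K" for a K
    by (rule R'[THEN spec, THEN conjunct1], rule R'[THEN spec, THEN conjunct2, THEN spec, THEN mp, THEN mp])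
  \<comment> \<open>Only finitely many radii are forbidden, so one radius works for all
    coordinates.\<close>
  have "infinite ({0<..<\<eta>0} - (\<Union>a. (\<lambda>u. dist u (e $ a)) ` R a))"
    using assms R(1) by (intro Diff_infinite_finite) auto
  then obtain \<eta> where \<eta>: "\<eta> \<in> {0<..<\<eta>0}" "\<eta> \<notin> (\<Union>a. (\<lambda>u. dist u (e $ a)) ` R a)"
    using infinite_imp_nonempty by blast
  have "\<forall>a. \<exists>\<delta>>0. \<forall>s v. norm s < \<delta> \<longrightarrow> s \<noteq> 0 \<longrightarrow> v \<in> regular_fibre (upd c b s) \<longrightarrow> v $ a \<notin> sphere (e $ a) \<eta>"
  proof (intro allI R(2) compact_sphere)
    fix a
    show "sphere (e $ a) \<eta> \<inter> R a = {}"
    proof (rule ccontr)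
      assume "sphere (e $ a) \<eta> \<inter> R a \<noteq> {}"
      then obtain u where "u \<in> R a" "u \<in> sphere (e $ a) \<eta>" by blast
      moreover from this have "\<eta> = dist u (e $ a)" by (simp add: dist_commute)
      ultimately have "\<eta> \<in> (\<Union>a. (\<lambda>u. dist u (e $ a)) ` R a)" by blast
      then show False using \<eta>(2) by contradiction
    qed
  qed
  from choice[OF this] obtain \<delta> where \<delta>: "\<And>a. \<delta> a > 0"
    "\<And>a s v. norm s < \<delta> a \<Longrightarrow> s \<noteq> 0 \<Longrightarrow> v \<in> regular_fibre (upd c b s) \<Longrightarrow> v $ a \<notin> sphere (e $ a) \<eta>"
    by blast
  show thesis
  proof (rule that[of \<eta> "Min (range \<delta>)"])
    show "Min (range \<delta>) > 0" using \<delta>(1) by auto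
    fix s v a
    assume "s \<noteq> 0" "norm s < Min (range \<delta>)" "v \<in> regular_fibre (upd c b s)"
    then show "dist (v $ a) (e $ a) \<noteq> \<eta>"
      using \<delta>(2)[of s a v] by (auto simp: dist_commute)
  qed (use \<eta> in auto)
qed

text \<open>The count is locally constant off finitely many parameters, and a small punctured disc
  avoids them and is connected. \<open>X\<close> selects the coordinates that are confined to the
  cluster; an empty \<open>X\<close> counts the whole regular fibre.\<close>

lemma cluster_card_constant:
  assumes fin: "\<And>c. finite (regular_fibre c)" and "\<eta>0 > 0"
  obtains \<eta> \<delta> where "0 < \<eta>" "\<eta> < \<eta>0" "\<delta> > 0"
    "\<And>s t. s \<in> ball 0 \<delta> - {0} \<Longrightarrow> t \<in> ball 0 \<delta> - {0} \<Longrightarrow>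
      card (regular_fibre (upd c b s) \<inter> {v. \<forall>a\<in>X. dist (v $ a) (e $ a) < \<eta>}) =
      card (regular_fibre (upd c b t) \<inter> {v. \<forall>a\<in>X. dist (v $ a) (e $ a) < \<eta>})"
proof -
  obtain S where S: "finite S" "\<And>s0 W. s0 \<notin> S \<Longrightarrow> open W \<Longrightarrow> regular_fibre (upd c b s0) \<subseteq> W \<Longrightarrow>
      \<forall>\<^sub>F s in nhds s0. regular_fibre (upd c b s) \<subseteq> W"
    by (rule fibre_upper_semicontinuous[where c = c and b = b]) (rule that)
  obtain \<eta> \<delta> where \<eta>: "0 < \<eta>" "\<eta> < \<eta>0" "\<delta> > 0"
    "\<And>s v a. s \<noteq> 0 \<Longrightarrow> norm s < \<delta> \<Longrightarrow> v \<in> regular_fibre (upd c b s) \<Longrightarrow> dist (v $ a) (e $ a) \<noteq> \<eta>"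
    by (rule fibre_clusters[where c = c and b = b and e = e, OF assms(2)]) (rule that)
  obtain \<delta>' where \<delta>': "\<delta>' > 0" "\<And>s. s \<in> S \<Longrightarrow> s \<noteq> 0 \<Longrightarrow> \<delta>' \<le> dist 0 s"
    using finite_set_avoid[OF S(1)] by blast
  define \<rho> where "\<rho> = min \<delta> \<delta>'"
  define Q where "Q = {v :: complex ^ 'r. \<forall>a\<in>X. dist (v $ a) (e $ a) < \<eta>}"
  have "open Q"
    unfolding Q_def Collect_ball_eq
    by (intro open_INT ballI open_Collect_less continuous_intros) auto
  have "closed {v :: complex ^ 'r. \<forall>a\<in>X. dist (v $ a) (e $ a) \<le> \<eta>}"
    unfolding Collect_ball_eq by (intro closed_INT ballI closed_Collect_le continuous_intros)
  then have clQ: "closure Q \<subseteq> {v. \<forall>a\<in>X. dist (v $ a) (e $ a) \<le> \<eta>}"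
    by (intro closure_minimal) (auto simp: Q_def intro: less_imp_le)
  show thesis
  proof (rule that[OF \<eta>(1,2), of \<rho>], unfold Q_def[symmetric])
    show "\<rho> > 0" using \<eta>(3) \<delta>'(1) by (simp add: \<rho>_def)
    fix s t :: complex assume st: "s \<in> ball 0 \<rho> - {0}" "t \<in> ball 0 \<rho> - {0}"
    show "card (regular_fibre (upd c b s) \<inter> Q) = card (regular_fibre (upd c b t) \<inter> Q)"
    proof (rule connected_local_const[OF _ st])
      show "connected (ball 0 \<rho> - {0} :: complex set)"
        by (rule connected_punctured_ball) simp
      show "\<forall>s\<in>ball 0 \<rho> - {0}. \<forall>\<^sub>F t in at s within ball 0 \<rho> - {0}.
          card (regular_fibre (upd c b s) \<inter> Q) = card (regular_fibre (upd c b t) \<inter> Q)"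
      proof
        fix s :: complex assume s: "s \<in> ball 0 \<rho> - {0}"
        then have "s \<notin> S" using \<delta>'(2)[of s] by (auto simp: \<rho>_def)
        have "\<forall>\<^sub>F t in nhds s. card (regular_fibre (upd c b t) \<inter> Q) = card (regular_fibre (upd c b s) \<inter> Q)"
        proof (rule card_fibre_locally_constant[OF fin _ \<open>open Q\<close>])
          show "(upd c b \<longlongrightarrow> upd c b s) (nhds s)"
            using continuous_on_upd[of UNIV c b]
            by (metis UNIV_I continuous_on_eq_continuous_at isCont_def open_UNIV tendsto_at_iff_tendsto_nhds)
          show "regular_fibre (upd c b s) \<inter> closure Q \<subseteq> Q"
          proof
            fix v assume v: "v \<in> regular_fibre (upd c b s) \<inter> closure Q"
            show "v \<in> Q"
              unfolding Q_def
            proof (intro CollectI ballI)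
              fix a assume "a \<in> X"
              then have "dist (v $ a) (e $ a) \<le> \<eta>" using v clQ by blast
              moreover have "dist (v $ a) (e $ a) \<noteq> \<eta>"
                using s v by (intro \<eta>(4)[of s]) (auto simp: \<rho>_def)
              ultimately show "dist (v $ a) (e $ a) < \<eta>" by simp
            qed
          qed
        qed (rule S(2)[OF \<open>s \<notin> S\<close>])
        then have "\<forall>\<^sub>F t in at s within ball 0 \<rho> - {0}.
            card (regular_fibre (upd c b t) \<inter> Q) = card (regular_fibre (upd c b s) \<inter> Q)"
          by (rule filter_leD[rotated]) (rule at_within_le_nhds)
        then show "\<forall>\<^sub>F t in at s within ball 0 \<rho> - {0}.
            card (regular_fibre (upd c b s) \<inter> Q) = card (regular_fibre (upd c b t) \<inter> Q)"
          by (rule eventually_mono) simp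
      qed
    qed
  qed
qed

end

section \<open>Critical points of the distance function on level sets\<close>

lemma has_derivative_vec:
  fixes f :: "'a::real_normed_vector \<Rightarrow> 'b::euclidean_space ^ 'n::finite"
  assumes "\<And>i. ((\<lambda>x. f x $ i) has_derivative (\<lambda>h. f' h $ i)) (at x)"
  shows "(f has_derivative f') (at x)"
proof -
  have "((\<lambda>x. f x \<bullet> k) has_derivative (\<lambda>h. f' h \<bullet> k)) (at x within UNIV)" if "k \<in> Basis" for k
  proof -
    obtain i b where "k = axis i b" using \<open>k \<in> Basis\<close> by (auto simp: Basis_vec_def)
    then show ?thesis using assms[of i] by (auto simp: inner_axis intro: has_derivative_inner_left)
  qed
  then show ?thesis by (subst has_derivative_componentwise_within) auto
qed

lemma poly_fun_reindex: "poly_fun p \<Longrightarrow> poly_fun (\<lambda>v. p (\<chi> a. v $ e a))"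
  by (induction rule: poly_fun.induct) (auto intro: poly_fun.intros)

lemma sum_UNIV_option: "(\<Sum>i\<in>UNIV. g i) = g None + (\<Sum>a\<in>UNIV. g (Some (a::'n::finite)))"
  by (simp add: UNIV_option_conv sum.reindex)

text \<open>A Frechet derivative is a priori only real linear; complex linearity makes the matrix of
  its values on unit vectors represent it.\<close>

lemma jacobian_mult:
  assumes "(F has_derivative L) (at w)" "Vector_Spaces.linear (*s) (*s) L"
  shows "jacobian F (at w) *v h = L h"
  unfolding jacobian_def frechet_derivative_at[OF assms(1), symmetric]
  by (rule matrix_works[OF assms(2)])

lemma det_nz_iff_ker:
  fixes A :: "'a::field ^ 'n ^ 'n"
  shows "det A \<noteq> 0 \<longleftrightarrow> (\<forall>h. A *v h = 0 \<longrightarrow> h = 0)"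
  by (simp add: invertible_det_nz[symmetric] invertible_left_inverse matrix_left_invertible_ker)

text \<open>
  A critical point \<open>x\<close> of the squared distance to \<open>y\<close> on the level set \<open>f = s\<close>, with multiplier
  \<open>\<mu> = \<lambda>\<^sub>1 / \<lambda>\<^sub>0\<close>, is a point of the fibre over \<open>(y, s)\<close> of the map
  \<open>(x, \<mu>) \<mapsto> (x + \<mu> \<nabla>f(x), f(x))\<close>. The index \<open>None\<close> stands for \<open>\<mu>\<close> in the domain and for
  \<open>f\<close> in the codomain.
\<close>

definition point :: "'a ^ 'n \<Rightarrow> 'a \<Rightarrow> 'a ^ ('n option)" where
  "point x \<mu> = (\<chi> i. case i of None \<Rightarrow> \<mu> | Some a \<Rightarrow> x $ a)"

definition proj :: "'a ^ ('n option) \<Rightarrow> 'a ^ 'n" where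
  "proj v = (\<chi> a. v $ Some a)"

lemma point_simps [simp]: "point x \<mu> $ None = \<mu>" "point x \<mu> $ Some a = x $ a"
  "proj (point x \<mu>) = x" "proj v $ a = v $ Some a"
  by (simp_all add: point_def proj_def vec_eq_iff)

lemma point_eq_iff: "v = point x \<mu> \<longleftrightarrow> proj v = x \<and> v $ None = \<mu>"
  by (auto simp: vec_eq_iff split_option_all)

lemma point_proj: "point (proj v) (v $ None) = v"
  using point_eq_iff by metis

lemma upd_point: "upd (point y 0) None s = point y s"
  by (auto simp: upd_def point_def vec_eq_iff split: option.split)

lemma eq_0_iff_components:
  fixes u :: "complex ^ ('n::finite + 2)"
  shows "u = 0 \<longleftrightarrow> (\<forall>a. u $ Inl a = 0) \<and> u $ Inr 0 = 0 \<and> u $ Inr 1 = 0"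
proof -
  have "b = 0 \<or> b = 1" for b :: 2 using exhaust_2[of b] by auto
  then show ?thesis by (auto simp: vec_eq_iff split_sum_all) (metis)
qed

locale twice_differentiable_polynomial =
  fixes f :: "complex ^ 'n::finite \<Rightarrow> complex"
    and D :: "'n \<Rightarrow> complex ^ 'n \<Rightarrow> complex"
    and E :: "'n \<Rightarrow> 'n \<Rightarrow> complex ^ 'n \<Rightarrow> complex"
  assumes f_poly: "poly_fun f" and D_poly: "poly_fun (D a)" and E_poly: "poly_fun (E a b)"
    and f_deriv: "(f has_derivative (\<lambda>h. \<Sum>a\<in>UNIV. D a x * h $ a)) (at x)"
    and D_deriv: "(D a has_derivative (\<lambda>h. \<Sum>b\<in>UNIV. E a b x * h $ b)) (at x)"
begin

definition crit :: "complex ^ ('n option) \<Rightarrow> complex ^ ('n option)" where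
  "crit v = point (\<chi> a. v $ Some a + v $ None * D a (proj v)) (f (proj v))"

text \<open>The bordered Hessian: the identity plus \<mu> times the Hessian of \<open>f\<close>,
  bordered by the gradient of \<open>f\<close>.\<close>

definition crit_deriv :: "complex ^ ('n option) \<Rightarrow> complex ^ ('n option) ^ ('n option)" where
  "crit_deriv v = (\<chi> i j. case i of
       None \<Rightarrow> (case j of None \<Rightarrow> 0 | Some b \<Rightarrow> D b (proj v))
     | Some a \<Rightarrow> (case j of None \<Rightarrow> D a (proj v)
         | Some b \<Rightarrow> (if a = b then 1 else 0) + v $ None * E a b (proj v)))"

lemma crit_deriv_mult:
  "(crit_deriv v *v h) $ None = (\<Sum>b\<in>UNIV. D b (proj v) * h $ Some b)"
  "(crit_deriv v *v h) $ Some a =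
     h $ Some a + v $ None * (\<Sum>b\<in>UNIV. E a b (proj v) * h $ Some b) + D a (proj v) * h $ None"
  unfolding matrix_vector_mult_def vec_lambda_beta sum_UNIV_option
  by (simp_all add: crit_deriv_def distrib_right sum.distrib sum_distrib_left mult.assoc
      if_distrib[of "\<lambda>x. x * _"] cong: if_cong)

lemma has_derivative_proj: "(proj has_derivative (\<lambda>h. proj h :: complex ^ 'n)) (at v)"
  by (intro has_derivative_vec) (auto intro!: bounded_linear_imp_has_derivative bounded_linear_vec_nth)

lemma crit_has_derivative: "(crit has_derivative (\<lambda>h. crit_deriv v *v h)) (at v)"
proof (rule has_derivative_vec)
  fix i
  have f: "((\<lambda>v. f (proj v)) has_derivative (\<lambda>h. \<Sum>b\<in>UNIV. D b (proj v) * h $ Some b)) (at v)"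
    using has_derivative_compose[OF has_derivative_proj f_deriv] by simp
  have D: "((\<lambda>v. D a (proj v)) has_derivative (\<lambda>h. \<Sum>b\<in>UNIV. E a b (proj v) * h $ Some b)) (at v)" for a
    using has_derivative_compose[OF has_derivative_proj D_deriv] by simp
  have nth: "((\<lambda>v. v $ j :: complex) has_derivative (\<lambda>h. h $ j)) (at v)" for j :: "'n option"
    by (intro bounded_linear_imp_has_derivative bounded_linear_vec_nth)
  show "((\<lambda>v. crit v $ i) has_derivative (\<lambda>h. (crit_deriv v *v h) $ i)) (at v)"
  proof (cases i)
    case None
    then show ?thesis using f by (simp add: crit_def crit_deriv_mult)
  next
    case (Some a)
    have "((\<lambda>v. v $ Some a + v $ None * D a (proj v)) has_derivative
        (\<lambda>h. h $ Some a + (v $ None * (\<Sum>b\<in>UNIV. E a b (proj v) * h $ Some b) + h $ None * D a (proj v)))) (at v)"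
      by (intro has_derivative_add has_derivative_mult nth D)
    then show ?thesis using Some by (simp add: crit_def crit_deriv_mult algebra_simps)
  qed
qed

sublocale polynomial_map crit crit_deriv
proof
  have "poly_fun (\<lambda>v. p (proj v))" if "poly_fun p" for p :: "complex ^ 'n \<Rightarrow> complex"
    using poly_fun_reindex[OF that, of Some] by (simp add: proj_def)
  note intros = poly_fun.intros this
  show "poly_fun (\<lambda>v. crit v $ i)" for i
    by (cases i) (auto simp: crit_def intro!: intros f_poly D_poly)
  show "poly_fun (\<lambda>v. crit_deriv v $ i $ j)" for i j
    by (cases i; cases j) (auto simp: crit_deriv_def intro!: intros D_poly E_poly)
qed (rule crit_has_derivative)

lemma crit_point:
  "crit v = point y s \<longleftrightarrow> f (proj v) = s \<and> (\<forall>a. v $ Some a - y $ a + v $ None * D a (proj v) = 0)"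
proof -
  have "u - w + r = 0 \<longleftrightarrow> u + r = w" for u w r :: complex
    by (simp add: diff_add_eq)
  then show ?thesis
    by (auto simp: crit_def vec_eq_iff split_option_all)
qed

section \<open>Solutions of the homotopy as points of the fibres\<close>

lemma gradient_eq: "gradient f x = (\<chi> a. D a x)"
  unfolding gradient_def frechet_derivative_at[OF f_deriv, symmetric]
  by (simp add: vec_eq_iff axis_def if_distrib[of "\<lambda>x. _ * x"] cong: if_cong)

lemma homotopy_components:
  "homotopy f z \<gamma> y \<alpha> w t $ Inl a =
     w $ Inr 0 * (w $ Inl a - y $ a) + w $ Inr 1 * D a (x_part w)"
  "homotopy f z \<gamma> y \<alpha> w t $ Inr 0 = f (x_part w) - t * \<gamma> * z"
  "homotopy f z \<gamma> y \<alpha> w t $ Inr 1 = \<alpha> $ 0 * w $ Inr 0 + \<alpha> $ 1 * w $ Inr 1 - 1"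
  by (simp_all add: homotopy_def Let_def gradient_eq lambda_part_def x_part_def)

text \<open>The maximality assumption ranges over all parameters. For a suitable choice of them the
  solutions at \<open>t = 1\<close> are exactly the lifted points of the fibre over
  \<open>c\<close>, and regular points lift to isolated solutions.\<close>

lemma fibre_card_le:
  assumes "max_isolated_solutions f M"
  shows "finite (regular_fibre c)" and "card (regular_fibre c) \<le> M"
proof -
  define y s where "y = proj c" and "s = c $ None"
  have c: "c = point y s" by (simp add: y_def s_def point_proj)
  \<comment> \<open>This \<alpha> normalises the multipliers to \<lambda>_0 = 1, so that \<lambda>_1
    is the coordinate \<mu> itself.\<close>
  define \<alpha> :: "complex ^ 2" where "\<alpha> = (\<chi> b. if b = 0 then 1 else 0)"
  define H where "H = (\<lambda>w. homotopy f s 1 y \<alpha> w 1)"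
  define lift :: "complex ^ ('n option) \<Rightarrow> complex ^ ('n + 2)"
    where "lift v = (\<chi> i. case i of Inl a \<Rightarrow> v $ Some a | Inr b \<Rightarrow> if b = 0 then 1 else v $ None)" for v
  define unlift :: "complex ^ ('n + 2) \<Rightarrow> complex ^ ('n option)"
    where "unlift w = point (x_part w) (w $ Inr 1)" for w
  have unlift_lift: "unlift (lift v) = v" for v
    by (simp add: unlift_def lift_def point_eq_iff[symmetric] x_part_def vec_eq_iff split_option_all)
  have sol: "w \<in> solutions H \<longleftrightarrow> w = lift (unlift w) \<and> crit (unlift w) = c" for w
  proof -
    have "w = lift (unlift w) \<longleftrightarrow> w $ Inr 0 = 1"
      unfolding eq_iff_diff_eq_0[of w] eq_0_iff_components
      by (simp add: lift_def unlift_def x_part_def)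
    then show ?thesis
      unfolding solutions_def H_def mem_Collect_eq eq_0_iff_components homotopy_components c crit_point
      by (auto simp: \<alpha>_def unlift_def x_part_def)
  qed
  have iso: "lift v \<in> isolated_solutions H" if "v \<in> regular_fibre c" for v
  proof -
    have v: "crit v = c" "det (crit_deriv v) \<noteq> 0" using that by (auto simp: regular_fibre_def)
    obtain U where U: "open U" "v \<in> U" "inj_on crit U"
      by (rule local_inverse[OF v(2) open_UNIV UNIV_I])
    have "continuous_on UNIV unlift"
      unfolding unlift_def point_def x_part_def
    proof (rule continuous_on_vec_lambda)
      show "continuous_on UNIV (\<lambda>w. case i of None \<Rightarrow> w $ Inr 1 | Some a \<Rightarrow> (\<chi> a. w $ Inl a) $ a)"
        for i :: "'n option"
        by (cases i) (auto intro!: continuous_intros)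
    qed
    then have "open (unlift -` U)" using U(1) by (rule open_vimage[rotated])
    moreover have "lift v \<in> solutions H" using v(1) by (simp add: sol unlift_lift)
    moreover have "w = lift v" if "w \<in> unlift -` U" "w \<in> solutions H" for w
      using that U v(1) unfolding sol inj_on_def by (metis vimageE)
    ultimately have "unlift -` U \<inter> solutions H = {lift v}"
      using U(2) by (auto simp: unlift_lift)
    with \<open>open (unlift -` U)\<close> \<open>lift v \<in> solutions H\<close> show ?thesis
      by (auto simp: isolated_solutions_def intro: isolated_inI)
  qed
  have inj: "inj_on lift (regular_fibre c)"
    by (rule inj_on_inverseI[of _ unlift]) (rule unlift_lift)
  have img: "lift ` regular_fibre c \<subseteq> isolated_solutions H" using iso by auto
  have fin: "finite (isolated_solutions H)" and le: "card (isolated_solutions H) \<le> M"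
    using assms unfolding max_isolated_solutions_def H_def by auto
  show "finite (regular_fibre c)"
    using finite_subset[OF img fin] inj by (rule finite_imageD)
  show "card (regular_fibre c) \<le> M"
    using card_inj_on_le[OF inj img fin] le by simp
qed

text \<open>Passage to the affine multiplier \<mu> = \<lambda>_1 / \<lambda>_0, meaningful when
  \<lambda>_0 is nonzero.\<close>

definition ratio :: "complex ^ ('n + 2) \<Rightarrow> complex ^ ('n option)" where
  "ratio w = point (x_part w) (w $ Inr 1 / w $ Inr 0)"

lemma homotopy_has_derivative:
  "((\<lambda>w. homotopy f z \<gamma> y \<alpha> w t) has_derivative (\<lambda>h. \<chi> i. case i of
       Inl a \<Rightarrow> w $ Inr 0 * h $ Inl a + h $ Inr 0 * (w $ Inl a - y $ a) +
         (w $ Inr 1 * (\<Sum>b\<in>UNIV. E a b (x_part w) * h $ Inl b) + h $ Inr 1 * D a (x_part w))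
     | Inr b \<Rightarrow> if b = 0 then \<Sum>a\<in>UNIV. D a (x_part w) * h $ Inl a
         else \<alpha> $ 0 * h $ Inr 0 + \<alpha> $ 1 * h $ Inr 1)) (at w)"
proof (rule has_derivative_vec)
  fix i :: "'n + 2"
  have x: "(x_part has_derivative (x_part :: complex ^ ('n + 2) \<Rightarrow> complex ^ 'n)) (at w)"
    by (intro has_derivative_vec)
       (auto simp: x_part_def intro!: bounded_linear_imp_has_derivative bounded_linear_vec_nth)
  have f: "((\<lambda>w. f (x_part w)) has_derivative (\<lambda>h. \<Sum>b\<in>UNIV. D b (x_part w) * h $ Inl b)) (at w)"
    using has_derivative_compose[OF x f_deriv] by (simp add: x_part_def)
  have D: "((\<lambda>w. D a (x_part w)) has_derivative (\<lambda>h. \<Sum>b\<in>UNIV. E a b (x_part w) * h $ Inl b)) (at w)" for a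
    using has_derivative_compose[OF x D_deriv] by (simp add: x_part_def)
  have nth: "((\<lambda>w. w $ j :: complex) has_derivative (\<lambda>h. h $ j)) (at w)" for j :: "'n + 2"
    by (intro bounded_linear_imp_has_derivative bounded_linear_vec_nth)
  consider a where "i = Inl a" | "i = Inr 0" | "i = Inr 1"
  proof (cases i)
    case (Inr b)
    then show thesis using that(2,3) exhaust_2[of b] by auto
  qed (use that(1) in blast)
  then show "((\<lambda>w. homotopy f z \<gamma> y \<alpha> w t $ i) has_derivative (\<lambda>h. (\<chi> i. case i of
       Inl a \<Rightarrow> w $ Inr 0 * h $ Inl a + h $ Inr 0 * (w $ Inl a - y $ a) +
         (w $ Inr 1 * (\<Sum>b\<in>UNIV. E a b (x_part w) * h $ Inl b) + h $ Inr 1 * D a (x_part w))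
     | Inr b \<Rightarrow> if b = 0 then \<Sum>a\<in>UNIV. D a (x_part w) * h $ Inl a
         else \<alpha> $ 0 * h $ Inr 0 + \<alpha> $ 1 * h $ Inr 1) $ i)) (at w)"
  proof cases
    case (1 a)
    have "((\<lambda>w. w $ Inr 0 * (w $ Inl a - y $ a) + w $ Inr 1 * D a (x_part w)) has_derivative
       (\<lambda>h. w $ Inr 0 * (h $ Inl a - 0) + h $ Inr 0 * (w $ Inl a - y $ a) +
         (w $ Inr 1 * (\<Sum>b\<in>UNIV. E a b (x_part w) * h $ Inl b) + h $ Inr 1 * D a (x_part w)))) (at w)"
      by (intro has_derivative_add has_derivative_mult has_derivative_diff has_derivative_const nth D)
    then show ?thesis by (simp add: 1 homotopy_components)
  next
    case 2
    then show ?thesis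
      using has_derivative_diff[OF f has_derivative_const] by (simp add: homotopy_components)
  next
    case 3
    have "((\<lambda>w. \<alpha> $ 0 * w $ Inr 0 + \<alpha> $ 1 * w $ Inr 1 - 1) has_derivative
       (\<lambda>h. \<alpha> $ 0 * h $ Inr 0 + \<alpha> $ 1 * h $ Inr 1 - 0)) (at w)"
      by (intro has_derivative_add has_derivative_diff has_derivative_const nth
          bounded_linear.has_derivative[OF bounded_linear_mult_right])
    then show ?thesis by (simp add: 3 homotopy_components)
  qed
qed

text \<open>If \<lambda>_0 = 0, the gradient vanishes and the Jacobian has a zero row. Otherwise a
  kernel vector of the bordered Hessian lifts to one of the Jacobian of the homotopy, and so it must
  be 0.\<close>

lemma nonsingular_solution_ratio:
  assumes "nonsingular_solution (\<lambda>w. homotopy f z \<gamma> y \<alpha> w t) w"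
  shows "w $ Inr 0 \<noteq> 0" and "ratio w \<in> regular_fibre (point y (t * \<gamma> * z))"
proof -
  let ?H = "\<lambda>w. homotopy f z \<gamma> y \<alpha> w t"
  let ?x = "x_part w" and ?l0 = "w $ Inr 0" and ?l1 = "w $ Inr 1"
  define L :: "complex ^ ('n + 2) \<Rightarrow> complex ^ ('n + 2)" where "L h = (\<chi> i. case i of
       Inl a \<Rightarrow> ?l0 * h $ Inl a + h $ Inr 0 * (w $ Inl a - y $ a) +
         (?l1 * (\<Sum>b\<in>UNIV. E a b ?x * h $ Inl b) + h $ Inr 1 * D a ?x)
     | Inr b \<Rightarrow> if b = 0 then \<Sum>a\<in>UNIV. D a ?x * h $ Inl a
         else \<alpha> $ 0 * h $ Inr 0 + \<alpha> $ 1 * h $ Inr 1)" for h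
  have "(?H has_derivative L) (at w)"
    unfolding L_def by (rule homotopy_has_derivative)
  moreover have "Vector_Spaces.linear (*s) (*s) L"
    unfolding Vector_Spaces.linear_iff
    by (auto simp: L_def vec_eq_iff vec.vector_space_axioms algebra_simps sum.distrib sum_distrib_left split: sum.split)
  ultimately have J: "jacobian ?H (at w) *v h = L h" for h by (rule jacobian_mult)
  have inv: "invertible (jacobian ?H (at w))" and sol: "?H w = 0"
    using assms by (auto simp: nonsingular_solution_def)
  have ker: "h = 0" if "L h = 0" for h
    using inv that J unfolding invertible_left_inverse matrix_left_invertible_ker by metis
  have surj: "\<exists>h. L h = u" for u
    using inv J unfolding invertible_right_inverse matrix_right_invertible_surjective surj_def by metis
  have eqs: "\<And>a. ?l0 * (w $ Inl a - y $ a) + ?l1 * D a ?x = 0" "f ?x = t * \<gamma> * z"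
    "\<alpha> $ 0 * ?l0 + \<alpha> $ 1 * ?l1 = 1"
    using sol unfolding eq_0_iff_components homotopy_components by auto
  show l0: "?l0 \<noteq> 0"
  proof
    assume "?l0 = 0"
    then have "?l1 \<noteq> 0" "\<And>a. ?l1 * D a ?x = 0" using eqs(1,3) by auto
    then have "D a ?x = 0" for a by simp
    moreover obtain h where "L h = axis (Inr 0) 1" using surj by blast
    then have "L h $ Inr 0 = 1" by simp
    ultimately show False by (simp add: L_def)
  qed
  define \<mu> where "\<mu> = ?l1 / ?l0"
  have l1: "?l1 = ?l0 * \<mu>" using l0 by (simp add: \<mu>_def)
  have yD: "w $ Inl a - y $ a = - \<mu> * D a ?x" for a
  proof -
    have "?l0 * ((w $ Inl a - y $ a) + \<mu> * D a ?x) = 0" using eqs(1)[of a] by (simp add: l1 algebra_simps)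
    then show ?thesis using l0 by (simp add: eq_neg_iff_add_eq_0)
  qed
  have \<kappa>: "?l0 * (\<alpha> $ 0 + \<alpha> $ 1 * \<mu>) = 1" using eqs(3) by (simp add: l1 algebra_simps)
  have ratio: "proj (ratio w) = ?x" "ratio w $ None = \<mu>" "ratio w $ Some a = w $ Inl a" for a
    by (simp_all add: ratio_def \<mu>_def x_part_def)
  have "crit (ratio w) = point y (t * \<gamma> * z)"
    unfolding crit_point using eqs(2) by (simp add: ratio yD)
  moreover have "det (crit_deriv (ratio w)) \<noteq> 0"
    unfolding det_nz_iff_ker
  proof (intro allI impI)
    fix h assume "crit_deriv (ratio w) *v h = 0"
    then have h: "(\<Sum>b\<in>UNIV. D b ?x * h $ Some b) = 0"
      "\<And>a. h $ Some a + \<mu> * (\<Sum>b\<in>UNIV. E a b ?x * h $ Some b) + D a ?x * h $ None = 0"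
      using crit_deriv_mult[of "ratio w" h] by (simp_all add: ratio)
    \<comment> \<open>The variation of the multipliers is a multiple of (-\<alpha>_1, \<alpha>_0),
      which preserves the normalising equation. The factor \<open>c\<close> is the one for which the
      induced variation of \<lambda>_1 / \<lambda>_0 equals \<open>h $ None\<close>.\<close>
    define c where "c = ?l0 * ?l0 * h $ None"
    define k :: "complex ^ ('n + 2)" where "k = (\<chi> i. case i of Inl a \<Rightarrow> h $ Some a
        | Inr b \<Rightarrow> if b = 0 then - \<alpha> $ 1 * c else \<alpha> $ 0 * c)"
    have k: "k $ Inl a = h $ Some a" "k $ Inr 0 = - \<alpha> $ 1 * c" "k $ Inr 1 = \<alpha> $ 0 * c" for a
      by (simp_all add: k_def)
    have c\<kappa>: "(\<alpha> $ 0 + \<alpha> $ 1 * \<mu>) * c = ?l0 * h $ None"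
      using \<kappa> by (simp add: c_def mult.assoc[symmetric] mult.commute[of "\<alpha> $ 0 + \<alpha> $ 1 * \<mu>"])
    have "L k = 0"
      unfolding eq_0_iff_components
    proof (intro conjI allI)
      fix a
      have "L k $ Inl a = ?l0 * (h $ Some a + \<mu> * (\<Sum>b\<in>UNIV. E a b ?x * h $ Some b))
          + D a ?x * ((\<alpha> $ 0 + \<alpha> $ 1 * \<mu>) * c)"
        by (simp add: L_def k l1 yD algebra_simps)
      also have "\<dots> = ?l0 * (h $ Some a + \<mu> * (\<Sum>b\<in>UNIV. E a b ?x * h $ Some b) + D a ?x * h $ None)"
        unfolding c\<kappa> by (simp add: algebra_simps)
      finally show "L k $ Inl a = 0" using h(2)[of a] by simp
    qed (use h(1) in \<open>simp_all add: L_def k\<close>)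
    then have "k = 0" by (rule ker)
    then have "h $ Some a = 0" "\<alpha> $ 1 * c = 0" "\<alpha> $ 0 * c = 0" for a
      using k by (metis zero_index neg_equal_0_iff_equal mult_minus_left)+
    moreover from this have "?l0 * h $ None = 0"
      unfolding c\<kappa>[symmetric] by (auto simp: distrib_right)
    ultimately show "h = 0" using l0 by (auto simp: vec_eq_iff split_option_all)
  qed
  ultimately show "ratio w \<in> regular_fibre (point y (t * \<gamma> * z))"
    by (simp add: regular_fibre_def)
qed

end

section \<open>Solution paths\<close>

lemma smooth_path_continuous_on:
  assumes "smooth_path \<xi>"
  shows "continuous_on {0<..1} \<xi>"
proof -
  obtain D where "D 0 = \<xi>"
    "\<And>m t. t \<in> {0<..1} \<Longrightarrow> (D m has_vector_derivative D (Suc m) t) (at t within {0<..1})"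
    using assms unfolding smooth_path_def by blast
  then have "(\<xi> has_vector_derivative D (Suc 0) t) (at t within {0<..1})" if "t \<in> {0<..1}" for t
    using that by metis
  then show ?thesis
    using has_vector_derivative_continuous continuous_on_eq_continuous_within by blast
qed

context twice_differentiable_polynomial
begin

lemma continuous_on_ratio:
  assumes "continuous_on S \<xi>" "\<And>t. t \<in> S \<Longrightarrow> \<xi> t $ Inr 0 \<noteq> 0"
  shows "continuous_on S (\<lambda>t. ratio (\<xi> t))"
  unfolding ratio_def point_def x_part_def
proof (rule continuous_on_vec_lambda)
  fix i :: "'n option"
  show "continuous_on S (\<lambda>t. case i of None \<Rightarrow> \<xi> t $ Inr 1 / \<xi> t $ Inr 0 | Some a \<Rightarrow> (\<chi> a. \<xi> t $ Inl a) $ a)"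
    using assms by (cases i) (auto intro!: continuous_intros)
qed

text \<open>The normalising equation reads \<lambda>_0 (\<alpha>_0 + \<alpha>_1 \<mu>) = 1, which
  recovers \<lambda>_0 from \<mu>.\<close>

lemma ratio_eq_imp_eq:
  assumes "homotopy f z \<gamma> y \<alpha> w t = 0" "homotopy f z \<gamma> y \<alpha> w' t' = 0"
    "w $ Inr 0 \<noteq> 0" "w' $ Inr 0 \<noteq> 0" "ratio w = ratio w'"
  shows "w = w'"
proof -
  define \<mu> where "\<mu> = w $ Inr 1 / w $ Inr 0"
  have x: "w $ Inl a = w' $ Inl a" for a
    using assms(5) by (metis ratio_def point_simps(2) x_part_def vec_lambda_beta)
  have \<mu>: "w' $ Inr 1 / w' $ Inr 0 = \<mu>"
    using assms(5) by (metis ratio_def point_simps(1) \<mu>_def)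
  have l: "w $ Inr 1 = w $ Inr 0 * \<mu>" "w' $ Inr 1 = w' $ Inr 0 * \<mu>"
    using assms(3,4) \<mu> by (auto simp: \<mu>_def field_simps)
  have "\<alpha> $ 0 * w $ Inr 0 + \<alpha> $ 1 * w $ Inr 1 = 1" "\<alpha> $ 0 * w' $ Inr 0 + \<alpha> $ 1 * w' $ Inr 1 = 1"
    using assms(1,2) unfolding eq_0_iff_components homotopy_components by auto
  then have "w $ Inr 0 * (\<alpha> $ 0 + \<alpha> $ 1 * \<mu>) = 1" "w' $ Inr 0 * (\<alpha> $ 0 + \<alpha> $ 1 * \<mu>) = 1"
    unfolding l by (simp_all add: algebra_simps)
  then have "w $ Inr 0 = w' $ Inr 0"
    by (metis mult_right_cancel mult_zero_right zero_neq_one)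
  then show ?thesis
    using x l unfolding eq_iff_diff_eq_0[of w] eq_0_iff_components by simp
qed

lemma ratio_path:
  assumes "solution_path (homotopy f z \<gamma> y \<alpha>) \<xi>"
  shows "continuous_on {0<..1} (\<lambda>t. ratio (\<xi> t))"
    and "t \<in> {0<..1} \<Longrightarrow> ratio (\<xi> t) \<in> regular_fibre (point y (complex_of_real t * \<gamma> * z))"
    and "t \<in> {0<..1} \<Longrightarrow> \<xi> t $ Inr 0 \<noteq> 0"
    and "t \<in> {0<..1} \<Longrightarrow> homotopy f z \<gamma> y \<alpha> (\<xi> t) (complex_of_real t) = 0"
proof -
  have ns: "nonsingular_solution (\<lambda>w. homotopy f z \<gamma> y \<alpha> w (complex_of_real t)) (\<xi> t)"
    if "t \<in> {0<..1}" for t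
    using assms that unfolding solution_path_def by blast
  note ns' = nonsingular_solution_ratio[OF ns]
  show "continuous_on {0<..1} (\<lambda>t. ratio (\<xi> t))"
    using assms unfolding solution_path_def
    by (intro continuous_on_ratio smooth_path_continuous_on ns') auto
  assume "t \<in> {0<..1}"
  then show "ratio (\<xi> t) \<in> regular_fibre (point y (complex_of_real t * \<gamma> * z))"
    "\<xi> t $ Inr 0 \<noteq> 0" "homotopy f z \<gamma> y \<alpha> (\<xi> t) (complex_of_real t) = 0"
    using ns' ns by (auto simp: nonsingular_solution_def)
qed

text \<open>The times at which both ratios agree form a closed set by continuity and an open one by
  local injectivity of \<open>crit\<close> at regular points. Connectedness of the interval carries
  agreement to time 1.\<close>

lemma solution_paths_do_not_meet:
  assumes p: "solution_path (homotopy f z \<gamma> y \<alpha>) \<xi>" "solution_path (homotopy f z \<gamma> y \<alpha>) \<zeta>"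
    and t: "t \<in> {0<..1}" "ratio (\<xi> t) = ratio (\<zeta> t)"
  shows "\<xi> 1 = \<zeta> 1"
proof -
  note P = ratio_path[OF p(1)] and Q = ratio_path[OF p(2)]
  let ?g = "\<lambda>t. ratio (\<xi> t)" and ?h = "\<lambda>t. ratio (\<zeta> t)"
  have "\<forall>s\<in>{0<..1}. \<forall>\<^sub>F r in at s within {0<..1}. (?g s = ?h s) = (?g r = ?h r)"
  proof
    fix s :: real assume s: "s \<in> {0<..1}"
    have g: "(?g \<longlongrightarrow> ?g s) (at s within {0<..1})" and h: "(?h \<longlongrightarrow> ?h s) (at s within {0<..1})"
      using P(1) Q(1) s by (auto simp: continuous_on_def)
    show "\<forall>\<^sub>F r in at s within {0<..1}. (?g s = ?h s) = (?g r = ?h r)"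
    proof (cases "?g s = ?h s")
      case True
      have "det (crit_deriv (?g s)) \<noteq> 0" using P(2)[OF s] by (simp add: regular_fibre_def)
      then obtain U where U: "open U" "?g s \<in> U" "inj_on crit U"
        by (rule local_inverse[OF _ open_UNIV UNIV_I])
      have "\<forall>\<^sub>F r in at s within {0<..1}. ?g r \<in> U"
        using topological_tendstoD[OF g U(1,2)] .
      moreover have "\<forall>\<^sub>F r in at s within {0<..1}. ?h r \<in> U"
        using topological_tendstoD[OF h U(1)] U(2) True by simp
      moreover have "\<forall>\<^sub>F r in at s within {0<..1}. r \<in> {0<..1}"
        by (simp add: eventually_at_filter)
      ultimately show ?thesis
      proof eventually_elim
        case (elim r)
        have "crit (?g r) = crit (?h r)"
          using P(2)[OF elim(3)] Q(2)[OF elim(3)] by (simp add: regular_fibre_def)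
        then have "?g r = ?h r" using inj_onD[OF U(3)] elim(1,2) by blast
        with True show ?case by simp
      qed
    next
      case False
      have "((\<lambda>r. ?g r - ?h r) \<longlongrightarrow> ?g s - ?h s) (at s within {0<..1})"
        by (intro tendsto_diff g h)
      then have "\<forall>\<^sub>F r in at s within {0<..1}. ?g r - ?h r \<noteq> 0"
        by (rule tendsto_imp_eventually_ne) (use False in simp)
      then show ?thesis by (rule eventually_mono) (use False in simp)
    qed
  qed
  then have "(?g t = ?h t) = (?g 1 = ?h 1)"
    using t(1) by (intro connected_local_const[of "{0<..1}"]) auto
  then have "?g 1 = ?h 1" using t(2) by simp
  moreover have 1: "(1::real) \<in> {0<..1}" by simp
  ultimately show ?thesis
    by (intro ratio_eq_imp_eq[OF P(4)[OF 1] Q(4)[OF 1] P(3)[OF 1] Q(3)[OF 1]])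
qed

text \<open>Distinct paths give distinct regular points at every time, and maximality leaves no room
  for others.\<close>

lemma solution_paths_cover_fibres:
  assumes H: "H = homotopy f z \<gamma> y \<alpha>"
    and fin: "finite (solutions (\<lambda>w. H w 1))"
    and max: "max_isolated_solutions f (card (solutions (\<lambda>w. H w 1)))"
    and paths: "\<And>w. w \<in> solutions (\<lambda>w. H w 1) \<Longrightarrow> solution_path H (\<Xi> w) \<and> \<Xi> w 1 = w"
    and t: "t \<in> {0<..1}"
  shows "regular_fibre (point y (complex_of_real t * \<gamma> * z)) =
      (\<lambda>w. ratio (\<Xi> w t)) ` solutions (\<lambda>w. H w 1)"
    and "card (regular_fibre (point y (complex_of_real t * \<gamma> * z))) = card (solutions (\<lambda>w. H w 1))"
proof -
  let ?S = "solutions (\<lambda>w. H w 1)" and ?Z = "regular_fibre (point y (complex_of_real t * \<gamma> * z))"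
  have "inj_on (\<lambda>w. ratio (\<Xi> w t)) ?S"
  proof (rule inj_onI)
    fix w w' assume w: "w \<in> ?S" "w' \<in> ?S" "ratio (\<Xi> w t) = ratio (\<Xi> w' t)"
    then have "\<Xi> w 1 = \<Xi> w' 1"
      using paths t unfolding H by (intro solution_paths_do_not_meet[where t = t]) auto
    then show "w = w'" using w paths by metis
  qed
  then have c: "card ((\<lambda>w. ratio (\<Xi> w t)) ` ?S) = card ?S" by (rule card_image)
  moreover have "(\<lambda>w. ratio (\<Xi> w t)) ` ?S \<subseteq> ?Z"
    using paths t ratio_path(2) unfolding H by blast
  moreover have "finite ?Z" "card ?Z \<le> card ?S"
    using fibre_card_le[OF max] by auto
  ultimately have "(\<lambda>w. ratio (\<Xi> w t)) ` ?S = ?Z"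
    by (intro card_seteq) auto
  then show "?Z = (\<lambda>w. ratio (\<Xi> w t)) ` ?S" "card ?Z = card ?S"
    using c by auto
qed

end

lemma poly_fun_twice_differentiable:
  assumes "poly_fun f"
  shows "\<exists>D E. twice_differentiable_polynomial f D E"
proof -
  obtain D where D: "\<And>a. poly_fun (D a)"
    "\<And>v. (f has_derivative (\<lambda>h. \<Sum>a\<in>UNIV. D a v * h $ a)) (at v)"
    using poly_fun_has_derivative[OF assms] by blast
  have "\<forall>a. \<exists>E. (\<forall>b. poly_fun (E b)) \<and>
      (\<forall>v. (D a has_derivative (\<lambda>h. \<Sum>b\<in>UNIV. E b v * h $ b)) (at v))"
    using poly_fun_has_derivative[OF D(1)] by blast
  from choice[OF this] obtain E where "\<forall>a. (\<forall>b. poly_fun (E a b)) \<and>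
      (\<forall>v. (D a has_derivative (\<lambda>h. \<Sum>b\<in>UNIV. E a b v * h $ b)) (at v))"
    by (rule exE)
  with D assms have "twice_differentiable_polynomial f D E"
    by unfold_locales auto
  then show ?thesis by blast
qed

section \<open>Real critical points near a real zero\<close>

lemma complex_vec_nth [simp]: "complex_vec x $ a = complex_of_real (x $ a)"
  by (simp add: complex_vec_def)

lemma continuous_on_complex_vec: "continuous_on S complex_vec"
  unfolding complex_vec_def by (intro continuous_on_vec_lambda continuous_intros)

lemma line_has_vector_derivative:
  assumes "\<And>v. (p has_derivative (\<lambda>h. \<Sum>a\<in>UNIV. P a v * h $ a)) (at v)"
  shows "((\<lambda>\<tau>. p (complex_vec (x + \<tau> *\<^sub>R h))) has_vector_derivative
    (\<Sum>a\<in>UNIV. P a (complex_vec (x + \<tau> *\<^sub>R h)) * of_real (h $ a))) (at \<tau>)"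
proof -
  have "((\<lambda>\<tau>. complex_vec (x + \<tau> *\<^sub>R h)) has_derivative (\<lambda>d. complex_vec (d *\<^sub>R h))) (at \<tau>)"
  proof (rule has_derivative_vec)
    fix a
    have "((\<lambda>\<tau>. complex_of_real (x $ a + \<tau> * h $ a)) has_derivative (\<lambda>d. complex_of_real (d * h $ a))) (at \<tau>)"
      by (auto intro!: derivative_eq_intros)
    then show "((\<lambda>\<tau>. complex_vec (x + \<tau> *\<^sub>R h) $ a) has_derivative (\<lambda>d. complex_vec (d *\<^sub>R h) $ a)) (at \<tau>)"
      by simp
  qed
  from has_derivative_compose[OF this assms]
  have "((\<lambda>\<tau>. p (complex_vec (x + \<tau> *\<^sub>R h))) has_derivative
      (\<lambda>d. \<Sum>a\<in>UNIV. P a (complex_vec (x + \<tau> *\<^sub>R h)) * complex_vec (d *\<^sub>R h) $ a)) (at \<tau>)" .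
  moreover have "(\<Sum>a\<in>UNIV. P a u * complex_vec (d *\<^sub>R h) $ a) =
      d *\<^sub>R (\<Sum>a\<in>UNIV. P a u * of_real (h $ a))" for d u
    unfolding scaleR_sum_right
  proof (intro sum.cong refl)
    fix a
    have "complex_vec (d *\<^sub>R h) $ a = of_real d * of_real (h $ a)" by simp
    then show "P a u * complex_vec (d *\<^sub>R h) $ a = d *\<^sub>R (P a u * of_real (h $ a))"
      by (simp only: scaleR_conv_of_real mult_ac)
  qed
  ultimately show ?thesis
    unfolding has_vector_derivative_def by simp
qed

text \<open>The imaginary part of \<open>p\<close> is identically 0 along a real line, hence so is
  its derivative in the direction of the axis \<open>a\<close>.\<close>

lemma real_partials:
  assumes "\<And>v. (p has_derivative (\<lambda>h. \<Sum>a\<in>UNIV. P a v * h $ a)) (at v)"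
    and real: "\<And>x. p (complex_vec x) \<in> \<real>"
  shows "P a (complex_vec x) \<in> \<real>"
proof -
  have "((\<lambda>\<tau>. Im (p (complex_vec (x + \<tau> *\<^sub>R axis a 1)))) has_vector_derivative
      Im (\<Sum>b\<in>UNIV. P b (complex_vec (x + 0 *\<^sub>R axis a 1)) * of_real (axis a 1 $ b))) (at 0)"
    by (rule bounded_linear.has_vector_derivative[OF bounded_linear_Im line_has_vector_derivative[OF assms(1)]])
  moreover have "Im (p (complex_vec u)) = 0" for u
    using real[of u] by (simp add: complex_is_Real_iff)
  ultimately have "((\<lambda>\<tau>. 0) has_vector_derivative
      Im (\<Sum>b\<in>UNIV. P b (complex_vec (x + 0 *\<^sub>R axis a 1)) * of_real (axis a 1 $ b))) (at (0::real))"
    by simp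
  then have "Im (\<Sum>b\<in>UNIV. P b (complex_vec (x + 0 *\<^sub>R axis a 1)) * of_real (axis a 1 $ b)) = 0"
    using has_vector_derivative_const vector_derivative_unique_at by blast
  moreover have "(\<Sum>b\<in>UNIV. P b (complex_vec x) * of_real (axis a 1 $ b)) = P a (complex_vec x)"
    by (simp add: axis_def if_distrib[of "\<lambda>x. _ * x"] if_distrib[of complex_of_real] cong: if_cong)
  ultimately show ?thesis by (simp add: complex_is_Real_iff)
qed

locale nonnegative_polynomial = twice_differentiable_polynomial f D E
  for f :: "complex ^ 'n::finite \<Rightarrow> complex" and D E +
  assumes f_real: "f (complex_vec x) \<in> \<real>" and f_nonneg: "Re (f (complex_vec x)) \<ge> 0"
begin

definition fr :: "real ^ 'n \<Rightarrow> real" where "fr x = Re (f (complex_vec x))"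
definition G :: "'n \<Rightarrow> real ^ 'n \<Rightarrow> real" where "G a x = Re (D a (complex_vec x))"
definition Hess :: "'n \<Rightarrow> 'n \<Rightarrow> real ^ 'n \<Rightarrow> real" where "Hess a b x = Re (E a b (complex_vec x))"

lemma f_complex_vec: "f (complex_vec x) = of_real (fr x)"
  using f_real by (simp add: fr_def)

lemma D_real: "D a (complex_vec x) \<in> \<real>"
  by (rule real_partials[OF f_deriv f_real])

lemma D_complex_vec: "D a (complex_vec x) = of_real (G a x)"
  using D_real by (simp add: G_def)

lemma E_complex_vec: "E a b (complex_vec x) = of_real (Hess a b x)"
  using real_partials[OF D_deriv D_real] by (simp add: Hess_def)

lemma fr_nonneg: "fr x \<ge> 0"
  using f_nonneg by (simp add: fr_def)

lemma continuous_on_fr: "continuous_on S fr"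
  unfolding fr_def
  by (intro continuous_intros continuous_on_compose2[OF poly_fun_continuous_on[OF f_poly, of UNIV]]
      continuous_on_complex_vec) auto

lemma Re_line_derivative:
  assumes "\<And>v. (p has_derivative (\<lambda>h. \<Sum>a\<in>UNIV. P a v * h $ a)) (at v)"
  shows "((\<lambda>\<tau>. Re (p (complex_vec (x + \<tau> *\<^sub>R h)))) has_real_derivative
    (\<Sum>a\<in>UNIV. Re (P a (complex_vec (x + \<tau> *\<^sub>R h))) * h $ a)) (at \<tau>)"
  using bounded_linear.has_vector_derivative[OF bounded_linear_Re line_has_vector_derivative[OF assms]]
  by (simp add: has_real_derivative_iff_has_vector_derivative)

lemma fr_line: "((\<lambda>\<tau>. fr (x + \<tau> *\<^sub>R h)) has_real_derivative (\<Sum>a\<in>UNIV. G a (x + \<tau> *\<^sub>R h) * h $ a)) (at \<tau>)"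
  unfolding fr_def G_def by (rule Re_line_derivative[OF f_deriv])

lemma G_line: "((\<lambda>\<tau>. G a (x + \<tau> *\<^sub>R h)) has_real_derivative (\<Sum>b\<in>UNIV. Hess a b (x + \<tau> *\<^sub>R h) * h $ b)) (at \<tau>)"
  unfolding G_def Hess_def by (rule Re_line_derivative[OF D_deriv])

text \<open>The factor 2 makes stationarity read x - y + \<mu> \<nabla>f(x) = 0, the first equation
  of a critical point with multiplier \<mu>.\<close>

definition penalty :: "real ^ 'n \<Rightarrow> real \<Rightarrow> real ^ 'n \<Rightarrow> real" where
  "penalty y \<mu> x = (\<Sum>a\<in>UNIV. (x $ a - y $ a)\<^sup>2) + 2 * \<mu> * fr x"

lemma penalty_eq: "penalty y \<mu> x = (norm (x - y))\<^sup>2 + 2 * \<mu> * fr x"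
  by (simp add: penalty_def norm_vec_def L2_set_def sum_nonneg)

text \<open>Nonnegativity of \<open>fr\<close> bounds the penalty below by the squared distance to
  \<open>y\<close>, so outside the ball \<open>?K\<close> it exceeds its value at \<open>y\<close>.
  Inside, compactness applies.\<close>

lemma penalty_minimum:
  assumes "\<mu> \<ge> 0"
  obtains x where "\<And>u. penalty y \<mu> x \<le> penalty y \<mu> u"
proof -
  let ?K = "cball y (sqrt (penalty y \<mu> y))"
  have nn: "penalty y \<mu> u \<ge> 0" for u
    using assms fr_nonneg by (simp add: penalty_eq)
  have "continuous_on ?K (penalty y \<mu>)"
    unfolding penalty_def by (intro continuous_intros continuous_on_fr)
  moreover have y: "y \<in> ?K" using nn by simp
  ultimately obtain x where x: "x \<in> ?K" "\<And>u. u \<in> ?K \<Longrightarrow> penalty y \<mu> x \<le> penalty y \<mu> u"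
    using continuous_attains_inf[of ?K] by (metis compact_cball empty_iff)
  have "penalty y \<mu> x \<le> penalty y \<mu> u" for u
  proof (cases "u \<in> ?K")
    case False
    then have "sqrt (penalty y \<mu> y) < norm (u - y)"
      by (simp add: dist_norm norm_minus_commute)
    then have "penalty y \<mu> y < (norm (u - y))\<^sup>2"
      using power_strict_mono[of "sqrt (penalty y \<mu> y)" "norm (u - y)" 2] nn[of y] by simp
    also have "\<dots> \<le> penalty y \<mu> u" using assms fr_nonneg by (simp add: penalty_eq)
    finally show ?thesis using x(2)[OF y] by simp
  qed (rule x(2))
  then show thesis by (rule that)
qed

text \<open>First and second order necessary conditions, obtained by restriction to the lines
  through \<open>x\<close>.\<close>

lemma penalty_minimum_conditions:
  assumes "\<And>u. penalty y \<mu> x \<le> penalty y \<mu> u"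
  shows "x $ a - y $ a + \<mu> * G a x = 0"
    and "(\<Sum>a\<in>UNIV. (h $ a)\<^sup>2) + \<mu> * (\<Sum>a\<in>UNIV. h $ a * (\<Sum>b\<in>UNIV. Hess a b x * h $ b)) \<ge> 0"
proof -
  define g' where "g' h \<tau> = 2 * (\<Sum>a\<in>UNIV. (x $ a + \<tau> * h $ a - y $ a + \<mu> * G a (x + \<tau> *\<^sub>R h)) * h $ a)"
    for h :: "real ^ 'n" and \<tau>
  have g: "((\<lambda>\<tau>. penalty y \<mu> (x + \<tau> *\<^sub>R h)) has_real_derivative g' h \<tau>) (at \<tau>)" for h \<tau>
    unfolding penalty_def
    by (auto intro!: derivative_eq_intros fr_line
        simp: g'_def sum_distrib_left sum.distrib sum_subtractf algebra_simps)
  have g0: "g' h 0 = 0" for h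
    by (rule DERIV_local_min[OF g zero_less_one]) (use assms in simp)
  from g0[of "axis a 1"] show "x $ a - y $ a + \<mu> * G a x = 0"
    by (simp add: g'_def axis_def if_distrib[of "\<lambda>x. _ * x"] cong: if_cong)
  let ?c = "2 * (\<Sum>a\<in>UNIV. (h $ a + \<mu> * (\<Sum>b\<in>UNIV. Hess a b x * h $ b)) * h $ a)"
  have g'': "(g' h has_real_derivative ?c) (at 0)"
    unfolding g'_def
    by (auto intro!: derivative_eq_intros G_line[of _ x h 0, simplified]
        simp: sum_distrib_left sum_distrib_right algebra_simps)
  have "?c \<ge> 0"
  proof (rule ccontr)
    assume "\<not> ?c \<ge> 0"
    \<comment> \<open>A negative second derivative makes the first one negative just to the right of
      0; the mean value theorem then gives a value below the minimum.\<close>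
    then obtain d where d: "d > 0" "\<And>k. 0 < k \<Longrightarrow> k < d \<Longrightarrow> g' h k < 0"
      using DERIV_neg_dec_right[OF g''] g0 by auto
    obtain k where k: "0 < k" "k < d / 2"
      "penalty y \<mu> (x + (d / 2) *\<^sub>R h) - penalty y \<mu> (x + 0 *\<^sub>R h) = (d / 2 - 0) * g' h k"
      using MVT2[of 0 "d / 2" "\<lambda>\<tau>. penalty y \<mu> (x + \<tau> *\<^sub>R h)" "g' h"] g d(1) by auto
    then have "(d / 2 - 0) * g' h k < 0" using d by (simp add: mult_pos_neg)
    then show False using k(3) assms[of "x + (d / 2) *\<^sub>R h"] by simp
  qed
  also have "?c = 2 * ((\<Sum>a\<in>UNIV. (h $ a)\<^sup>2) + \<mu> * (\<Sum>a\<in>UNIV. h $ a * (\<Sum>b\<in>UNIV. Hess a b x * h $ b)))"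
    by (simp add: sum.distrib sum_distrib_left power2_eq_square algebra_simps)
  finally show "(\<Sum>a\<in>UNIV. (h $ a)\<^sup>2) + \<mu> * (\<Sum>a\<in>UNIV. h $ a * (\<Sum>b\<in>UNIV. Hess a b x * h $ b)) \<ge> 0"
    by simp
qed

text \<open>Pairing the kernel equation with \<open>u\<close> removes the border term and gives N +
  (1 - \<theta>) \<mu> Q = 0. Together with N + \<mu> Q \<ge> 0 this yields \<theta> N \<le>
  0.\<close>

lemma real_kernel_trivial:
  fixes u :: "real ^ 'n"
  assumes psd: "\<And>h. (\<Sum>a\<in>UNIV. (h $ a)\<^sup>2) + \<mu> * (\<Sum>a\<in>UNIV. h $ a * (\<Sum>b\<in>UNIV. Hess a b x * h $ b)) \<ge> 0"
    and \<theta>: "0 < \<theta>" "\<theta> < 1"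
    and ker: "\<And>a. u $ a + (1 - \<theta>) * \<mu> * (\<Sum>b\<in>UNIV. Hess a b x * u $ b) + G a x * r = 0"
      "(\<Sum>b\<in>UNIV. G b x * u $ b) = 0"
  shows "u = 0"
proof -
  define N Q where "N = (\<Sum>a\<in>UNIV. (u $ a)\<^sup>2)" and "Q = (\<Sum>a\<in>UNIV. u $ a * (\<Sum>b\<in>UNIV. Hess a b x * u $ b))"
  have "0 = (\<Sum>a\<in>UNIV. u $ a * (u $ a + (1 - \<theta>) * \<mu> * (\<Sum>b\<in>UNIV. Hess a b x * u $ b) + G a x * r))"
    using ker(1) by simp
  also have "\<dots> = (\<Sum>a\<in>UNIV. (u $ a)\<^sup>2 + (1 - \<theta>) * \<mu> * (u $ a * (\<Sum>b\<in>UNIV. Hess a b x * u $ b)) + r * (G a x * u $ a))"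
    by (intro sum.cong refl) (simp only: power2_eq_square distrib_left mult_ac)
  also have "\<dots> = N + (1 - \<theta>) * \<mu> * Q + r * (\<Sum>a\<in>UNIV. G a x * u $ a)"
    by (simp add: N_def Q_def sum.distrib sum_distrib_left)
  finally have "N + (1 - \<theta>) * (\<mu> * Q) = 0" using ker(2) by (simp add: mult.assoc)
  moreover have "(1 - \<theta>) * (N + \<mu> * Q) \<ge> 0"
    using psd[of u] \<theta> unfolding N_def Q_def by (intro mult_nonneg_nonneg) auto
  moreover have "(1 - \<theta>) * (N + \<mu> * Q) = N - \<theta> * N + (1 - \<theta>) * (\<mu> * Q)"
    by (simp add: algebra_simps)
  ultimately have "\<theta> * N \<le> 0" by linarith
  then have "N \<le> 0" using \<theta> by (simp add: mult_le_0_iff)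
  then have "\<forall>a\<in>UNIV. (u $ a)\<^sup>2 = 0"
    unfolding N_def using sum_nonneg_eq_0_iff[of UNIV "\<lambda>a. (u $ a)\<^sup>2"] sum_nonneg[of UNIV "\<lambda>a. (u $ a)\<^sup>2"] by force
  then show ?thesis by (simp add: vec_eq_iff)
qed

text \<open>
  Moving \<open>y\<close> towards the minimiser \<open>x\<close> and shrinking the multiplier by the same factor keeps
  \<open>x\<close> critical and makes the Hessian positive definite, so \<open>x\<close> becomes a regular point.
\<close>

lemma regular_real_critical_points:
  assumes p: "fr p = 0" and y: "fr y \<noteq> 0" and \<mu>: "\<mu> > 0" "(norm (p - y))\<^sup>2 < 2 * \<mu> * fr y"
  obtains x where "fr x > 0" "2 * \<mu> * fr x \<le> (norm (p - y))\<^sup>2" "norm (x - y) \<le> norm (p - y)"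
    "\<And>\<theta>. 0 < \<theta> \<Longrightarrow> \<theta> < 1 \<Longrightarrow> point (complex_vec x) (of_real ((1 - \<theta>) * \<mu>)) \<in>
      regular_fibre (point (complex_vec (y + \<theta> *\<^sub>R (x - y))) (of_real (fr x)))"
proof -
  obtain x where x: "\<And>u. penalty y \<mu> x \<le> penalty y \<mu> u"
    using penalty_minimum[of \<mu> y] \<mu> by auto
  have crit: "x $ a - y $ a + \<mu> * G a x = 0" for a
    by (rule penalty_minimum_conditions[OF x])
  have psd: "(\<Sum>a\<in>UNIV. (h $ a)\<^sup>2) + \<mu> * (\<Sum>a\<in>UNIV. h $ a * (\<Sum>b\<in>UNIV. Hess a b x * h $ b)) \<ge> 0" for h :: "real ^ 'n"
    by (rule penalty_minimum_conditions[OF x])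
  have le: "(norm (x - y))\<^sup>2 + 2 * \<mu> * fr x \<le> (norm (p - y))\<^sup>2"
    using x[of p] by (simp add: penalty_eq p)
  \<comment> \<open>The penalty at \<open>y\<close> is \<open>2 * \<mu> * fr y\<close>, larger than
    the penalty at \<open>p\<close>.\<close>
  have "x \<noteq> y" using le \<mu>(2) by auto
  then have G: "\<exists>a. G a x \<noteq> 0" using crit
    by (metis add.right_neutral eq_iff_diff_eq_0 mult_zero_right vec_eq_iff)
  \<comment> \<open>A zero of \<open>fr\<close> is a minimum of it, so the gradient would vanish
    there.\<close>
  have "fr x \<noteq> 0"
  proof
    assume "fr x = 0"
    have "(\<Sum>b\<in>UNIV. G b (x + 0 *\<^sub>R h) * h $ b) = 0" for h
      by (rule DERIV_local_min[OF fr_line zero_less_one]) (use \<open>fr x = 0\<close> fr_nonneg in simp)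
    from this[of "axis _ 1"] have "G a x = 0" for a
      by (simp add: axis_def if_distrib[of "\<lambda>x. _ * x"] cong: if_cong)
    then show False using G by simp
  qed
  show thesis
  proof (rule that[of x])
    show "fr x > 0" using \<open>fr x \<noteq> 0\<close> fr_nonneg[of x] by simp
    show "2 * \<mu> * fr x \<le> (norm (p - y))\<^sup>2" using le zero_le_power2[of "norm (x - y)"] by linarith
    have "2 * \<mu> * fr x \<ge> 0" using \<mu> fr_nonneg by simp
    then have "(norm (x - y))\<^sup>2 \<le> (norm (p - y))\<^sup>2" using le by linarith
    then show "norm (x - y) \<le> norm (p - y)" by (rule power2_le_imp_le) simp
  next
    fix \<theta> :: real assume \<theta>: "0 < \<theta>" "\<theta> < 1"
    let ?v = "point (complex_vec x) (complex_of_real ((1 - \<theta>) * \<mu>))"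
    have "x $ a - (y $ a + \<theta> * (x $ a - y $ a)) + (1 - \<theta>) * \<mu> * G a x = 0" for a
    proof -
      have "x $ a - (y $ a + \<theta> * (x $ a - y $ a)) + (1 - \<theta>) * \<mu> * G a x =
          (1 - \<theta>) * (x $ a - y $ a + \<mu> * G a x)"
        by (simp add: algebra_simps)
      then show ?thesis using crit by simp
    qed
    then have "complex_of_real (x $ a - (y $ a + \<theta> * (x $ a - y $ a)) + (1 - \<theta>) * \<mu> * G a x) = 0" for a
      by simp
    then have "crit ?v = point (complex_vec (y + \<theta> *\<^sub>R (x - y))) (of_real (fr x))"
      unfolding crit_point by (simp add: f_complex_vec D_complex_vec)
    moreover have "det (crit_deriv ?v) \<noteq> 0"
      unfolding det_nz_iff_ker
    proof (intro allI impI)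
      fix h assume "crit_deriv ?v *v h = 0"
      then have h: "(\<Sum>b\<in>UNIV. of_real (G b x) * h $ Some b) = 0"
        "\<And>a. h $ Some a + of_real ((1 - \<theta>) * \<mu>) * (\<Sum>b\<in>UNIV. of_real (Hess a b x) * h $ Some b) +
          of_real (G a x) * h $ None = 0"
        using crit_deriv_mult[of ?v h] by (simp_all add: D_complex_vec E_complex_vec)
      \<comment> \<open>The coefficients are real, so the real and the imaginary part of
        \<open>h\<close> each solve the kernel equations.\<close>
      have "(\<chi> a. Re (h $ Some a)) = 0"
        using arg_cong[OF h(1), of Re] arg_cong[OF h(2), of Re]
        by (intro real_kernel_trivial[OF psd \<theta>, where r = "Re (h $ None)"]) (simp_all add: mult.assoc)
      moreover have "(\<chi> a. Im (h $ Some a)) = 0"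
        using arg_cong[OF h(1), of Im] arg_cong[OF h(2), of Im]
        by (intro real_kernel_trivial[OF psd \<theta>, where r = "Im (h $ None)"]) (simp_all add: mult.assoc)
      ultimately have hS: "h $ Some a = 0" for a
        by (simp add: vec_eq_iff complex_eq_iff)
      moreover have "h $ None = 0" using h(2) G by (auto simp: hS)
      ultimately show "h = 0" by (simp add: vec_eq_iff split_option_all)
    qed
    ultimately show "?v \<in> regular_fibre (point (complex_vec (y + \<theta> *\<^sub>R (x - y))) (of_real (fr x)))"
      by (simp add: regular_fibre_def)
  qed
qed

end

section \<open>Limits of minimisers and endpoints of solution paths\<close>

lemma tendsto_point:
  assumes "(f \<longlongrightarrow> x) A" "(g \<longlongrightarrow> m) A"
  shows "((\<lambda>t. point (f t) (g t)) \<longlongrightarrow> point x m) A"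
proof (rule vec_tendstoI)
  show "((\<lambda>t. point (f t) (g t) $ i) \<longlongrightarrow> point x m $ i) A" for i
    using assms by (cases i) (auto intro: tendsto_vec_nth)
qed

lemma tendsto_complex_vec: "(g \<longlongrightarrow> x) A \<Longrightarrow> ((\<lambda>t. complex_vec (g t)) \<longlongrightarrow> complex_vec x) A"
  using continuous_on_tendsto_compose[where s = UNIV, OF continuous_on_complex_vec] by simp

context nonnegative_polynomial
begin

text \<open>As \<theta> tends to 0, regular points over the moved targets approach the given point.
  If it were not in the maximal fibre, a closed ball around it would be free of regular points over
  all nearby targets.\<close>

lemma minimum_in_maximal_fibre:
  assumes fin: "\<And>c. finite (regular_fibre c)"
    and max: "\<And>c. card (regular_fibre c) \<le> card (regular_fibre (point (complex_vec y) s))"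
    and near: "\<And>\<theta>. 0 < \<theta> \<Longrightarrow> \<theta> < 1 \<Longrightarrow> point (complex_vec x) (of_real ((1 - \<theta>) * \<mu>)) \<in>
      regular_fibre (point (complex_vec (y + \<theta> *\<^sub>R (x - y))) s)"
  shows "point (complex_vec x) (of_real \<mu>) \<in> regular_fibre (point (complex_vec y) s)"
proof (rule ccontr)
  let ?Z = "regular_fibre (point (complex_vec y) s)" and ?v = "point (complex_vec x) (complex_of_real \<mu>)"
  assume "?v \<notin> ?Z"
  then obtain r where r: "r > 0" "cball ?v r \<subseteq> - ?Z"
    using fin finite_imp_closed open_contains_cball by (metis ComplI open_Compl)
  have ev: "\<forall>\<^sub>F c in nhds (point (complex_vec y) s). regular_fibre c \<subseteq> - cball ?v r"
    using r(2) by (intro maximal_fibre_upper_semicontinuous[OF fin max]) auto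
  have "((\<lambda>\<theta>. point (complex_vec (y + \<theta> *\<^sub>R (x - y))) s) \<longlongrightarrow>
      point (complex_vec (y + 0 *\<^sub>R (x - y))) s) (at_right 0)"
    by (intro tendsto_point tendsto_complex_vec tendsto_intros)
  then have "((\<lambda>\<theta>. point (complex_vec (y + \<theta> *\<^sub>R (x - y))) s) \<longlongrightarrow>
      point (complex_vec y) s) (at_right 0)"
    by simp
  with ev have "\<forall>\<^sub>F \<theta> in at_right 0. regular_fibre (point (complex_vec (y + \<theta> *\<^sub>R (x - y))) s) \<subseteq> - cball ?v r"
    by (rule eventually_compose_filterlim)
  moreover have "((\<lambda>\<theta>. point (complex_vec x) (complex_of_real ((1 - \<theta>) * \<mu>))) \<longlongrightarrow>
      point (complex_vec x) (of_real ((1 - 0) * \<mu>))) (at_right 0)"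
    by (intro tendsto_point tendsto_intros)
  then have "\<forall>\<^sub>F \<theta> in at_right 0. point (complex_vec x) (complex_of_real ((1 - \<theta>) * \<mu>)) \<in> ball ?v r"
    by (rule topological_tendstoD) (use r(1) in auto)
  moreover have "\<forall>\<^sub>F \<theta> in at_right 0. \<theta> \<in> {0<..<1::real}"
    by (rule eventually_at_right_real) simp
  ultimately have "\<forall>\<^sub>F \<theta> in at_right (0::real). False"
  proof eventually_elim
    case (elim \<theta>)
    then have "point (complex_vec x) (complex_of_real ((1 - \<theta>) * \<mu>)) \<in> - cball ?v r"
      using near[of \<theta>] by (meson greaterThanLessThan_iff subsetD)
    then show ?case using elim(2) by auto
  qed
  then show False by simp
qed

text \<open>Minimisers for multipliers tending to infinity: since
  \<open>2 * \<mu> k * fr (X k)\<close> is bounded, the values of \<open>fr\<close> are forced to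
  0.\<close>

lemma real_critical_sequence:
  assumes p: "fr p = 0" and y: "fr y \<noteq> 0"
  obtains X :: "nat \<Rightarrow> real ^ 'n" and \<mu> :: "nat \<Rightarrow> real"
  where "\<And>k. fr (X k) > 0" "(\<lambda>k. fr (X k)) \<longlonglongrightarrow> 0" "\<And>k. norm (X k - y) \<le> norm (p - y)"
    "\<And>k. \<mu> k \<ge> real k"
    "\<And>k \<theta>. 0 < \<theta> \<Longrightarrow> \<theta> < 1 \<Longrightarrow> point (complex_vec (X k)) (of_real ((1 - \<theta>) * \<mu> k)) \<in>
      regular_fibre (point (complex_vec (y + \<theta> *\<^sub>R (X k - y))) (of_real (fr (X k))))"
proof -
  have "fr y > 0" using y fr_nonneg[of y] by simp
  define B where "B = (norm (p - y))\<^sup>2"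
  have "B \<ge> 0" by (simp add: B_def)
  \<comment> \<open>The first summand alone gives equality in the bound on
    \<open>2 * \<mu> k * fr y\<close>, the \<open>1\<close> makes it strict, and
    \<open>real k\<close> drives the multipliers to infinity.\<close>
  define \<mu> where "\<mu> k = B / (2 * fr y) + 1 + real k" for k
  have \<mu>: "\<mu> k \<ge> 1 + real k" for k using \<open>B \<ge> 0\<close> \<open>fr y > 0\<close> by (simp add: \<mu>_def)
  have lt: "(norm (p - y))\<^sup>2 < 2 * \<mu> k * fr y" for k
  proof -
    have "2 * \<mu> k * fr y = B + 2 * (1 + real k) * fr y"
      using \<open>fr y > 0\<close> by (simp add: \<mu>_def field_simps)
    moreover have "2 * (1 + real k) * fr y > 0" using \<open>fr y > 0\<close> by simp
    ultimately show ?thesis unfolding B_def by linarith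
  qed
  have "\<forall>k. \<exists>x. fr x > 0 \<and> 2 * \<mu> k * fr x \<le> B \<and> norm (x - y) \<le> norm (p - y) \<and>
      (\<forall>\<theta>. 0 < \<theta> \<longrightarrow> \<theta> < 1 \<longrightarrow> point (complex_vec x) (of_real ((1 - \<theta>) * \<mu> k)) \<in>
      regular_fibre (point (complex_vec (y + \<theta> *\<^sub>R (x - y))) (of_real (fr x))))"
  proof
    fix k
    have "\<mu> k > 0" using \<mu>[of k] by simp
    from regular_real_critical_points[OF p y this lt]
    obtain x where "fr x > 0" "2 * \<mu> k * fr x \<le> B" "norm (x - y) \<le> norm (p - y)"
      "\<And>\<theta>. 0 < \<theta> \<Longrightarrow> \<theta> < 1 \<Longrightarrow> point (complex_vec x) (of_real ((1 - \<theta>) * \<mu> k)) \<in>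
        regular_fibre (point (complex_vec (y + \<theta> *\<^sub>R (x - y))) (of_real (fr x)))"
      unfolding B_def by blast
    then show "\<exists>x. fr x > 0 \<and> 2 * \<mu> k * fr x \<le> B \<and> norm (x - y) \<le> norm (p - y) \<and>
      (\<forall>\<theta>. 0 < \<theta> \<longrightarrow> \<theta> < 1 \<longrightarrow> point (complex_vec x) (of_real ((1 - \<theta>) * \<mu> k)) \<in>
      regular_fibre (point (complex_vec (y + \<theta> *\<^sub>R (x - y))) (of_real (fr x))))"
      by blast
  qed
  from choice[OF this] obtain X where X: "\<And>k. fr (X k) > 0" "\<And>k. 2 * \<mu> k * fr (X k) \<le> B"
    "\<And>k. norm (X k - y) \<le> norm (p - y)"
    "\<And>k \<theta>. 0 < \<theta> \<Longrightarrow> \<theta> < 1 \<Longrightarrow> point (complex_vec (X k)) (of_real ((1 - \<theta>) * \<mu> k)) \<in>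
      regular_fibre (point (complex_vec (y + \<theta> *\<^sub>R (X k - y))) (of_real (fr (X k))))"
    by blast
  have "fr (X k) \<le> B * (1 / Suc k)" for k
  proof -
    have "Suc k * fr (X k) \<le> 2 * \<mu> k * fr (X k)"
      using \<mu>[of k] X(1)[of k] by (intro mult_right_mono) auto
    then show ?thesis using X(2)[of k] by (simp add: field_simps)
  qed
  then have le: "\<forall>\<^sub>F k in sequentially. fr (X k) \<le> B * (1 / Suc k)"
    by (intro always_eventually allI)
  have ge: "\<forall>\<^sub>F k in sequentially. 0 \<le> fr (X k)"
    by (intro always_eventually allI fr_nonneg)
  have "(\<lambda>k. B * (1 / Suc k)) \<longlonglongrightarrow> 0"
    using tendsto_mult_left[OF LIMSEQ_inverse_real_of_nat, of B] by (simp add: inverse_eq_divide)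
  from tendsto_sandwich[OF ge le tendsto_const this]
  have "(\<lambda>k. fr (X k)) \<longlonglongrightarrow> 0" .
  moreover have "\<mu> k \<ge> real k" for k using \<mu>[of k] by simp
  ultimately show thesis using X by (intro that[of X \<mu>])
qed

text \<open>Regular points with unbounded multipliers lie over targets that tend to
  \<open>(y, 0)\<close>, whereas the fibres near a maximal fibre stay in a fixed ball.\<close>

lemma zero_fibre_not_maximal:
  assumes fin: "\<And>c. finite (regular_fibre c)" and p: "fr p = 0" and y: "fr y \<noteq> 0"
  shows "\<not> (\<forall>c. card (regular_fibre c) \<le> card (regular_fibre (point (complex_vec y) 0)))"
proof
  let ?c = "point (complex_vec y) 0"
  assume max: "\<forall>c. card (regular_fibre c) \<le> card (regular_fibre ?c)"
  obtain X \<mu> where X: "\<And>k. fr (X k) > 0" "(\<lambda>k. fr (X k)) \<longlonglongrightarrow> 0"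
    "\<And>k. norm (X k - y) \<le> norm (p - y)" "\<And>k. \<mu> k \<ge> real k"
    "\<And>k \<theta>. 0 < \<theta> \<Longrightarrow> \<theta> < 1 \<Longrightarrow> point (complex_vec (X k)) (of_real ((1 - \<theta>) * \<mu> k)) \<in>
      regular_fibre (point (complex_vec (y + \<theta> *\<^sub>R (X k - y))) (of_real (fr (X k))))"
    using real_critical_sequence[OF p y] by blast
  obtain R where R: "regular_fibre ?c \<subseteq> ball 0 R"
    using finite_imp_bounded[OF fin] bounded_subset_ballD by blast
  \<comment> \<open>Tending to 0, it makes the targets converge; being at most 1/2, it keeps the
    reduced multipliers above \<open>real k / 2\<close>.\<close>
  define \<theta> where "\<theta> k = 1 / (real k + 2)" for k
  define c where "c k = point (complex_vec (y + \<theta> k *\<^sub>R (X k - y))) (complex_of_real (fr (X k)))" for k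
  have \<theta>: "0 < \<theta> k" "\<theta> k < 1" "\<theta> k \<le> 1 / 2" for k by (simp_all add: \<theta>_def)
  have "(\<lambda>k. \<theta> k *\<^sub>R (X k - y)) \<longlonglongrightarrow> 0"
  proof (rule Lim_null_comparison)
    have "\<theta> k * norm (X k - y) \<le> \<theta> k * norm (p - y)" for k
      using X(3) \<theta>(1)[of k] by (intro mult_left_mono) auto
    then show "\<forall>\<^sub>F k in sequentially. norm (\<theta> k *\<^sub>R (X k - y)) \<le> \<theta> k * norm (p - y)"
      using \<theta>(1) by (intro always_eventually) (auto simp: abs_of_pos)
    show "(\<lambda>k. \<theta> k * norm (p - y)) \<longlonglongrightarrow> 0"
      unfolding \<theta>_def by real_asymp
  qed
  then have "(\<lambda>k. y + \<theta> k *\<^sub>R (X k - y)) \<longlonglongrightarrow> y + 0" by (intro tendsto_intros)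
  then have "c \<longlonglongrightarrow> point (complex_vec (y + 0)) (of_real 0)"
    unfolding c_def by (intro tendsto_point tendsto_complex_vec tendsto_of_real X(2))
  then have lim: "c \<longlonglongrightarrow> ?c" by simp
  have "\<forall>\<^sub>F c in nhds ?c. regular_fibre c \<subseteq> ball 0 R"
    using max R by (intro maximal_fibre_upper_semicontinuous[OF fin]) auto
  from this lim have "\<forall>\<^sub>F k in sequentially. regular_fibre (c k) \<subseteq> ball 0 R"
    by (rule eventually_compose_filterlim)
  moreover have "\<forall>\<^sub>F k in sequentially. real k > 2 * R"
    using filterlim_real_sequentially by (simp add: filterlim_at_top_dense)
  ultimately have "\<forall>\<^sub>F k::nat in sequentially. False"
  proof eventually_elim
    case (elim k)
    let ?v = "point (complex_vec (X k)) (complex_of_real ((1 - \<theta> k) * \<mu> k))"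
    have "?v \<in> ball 0 R" using X(5)[OF \<theta>(1,2)] elim(1) unfolding c_def by blast
    then have "norm (?v $ None) < R" using Finite_Cartesian_Product.norm_nth_le[of ?v None] by simp
    then have "\<bar>(1 - \<theta> k) * \<mu> k\<bar> < R" by (simp only: point_simps norm_of_real)
    then have "(1 - \<theta> k) * \<mu> k < R" by linarith
    moreover have "(1 / 2) * real k \<le> (1 - \<theta> k) * \<mu> k"
      using X(4)[of k] \<theta>(3)[of k] by (intro mult_mono) auto
    ultimately show ?case using elim(2) by linarith
  qed
  then show False by simp
qed

text \<open>If no endpoint lies over a real zero, the paths eventually avoid a neighbourhood of a
  limit \<open>x\<close> of minimisers. The minimisers show that the cluster at \<open>x\<close> is
  nonempty for small positive \<open>s\<close>, hence also in the direction of the paths, which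
  contradicts that the paths cover these fibres.\<close>

lemma real_endpoint:
  assumes p: "fr p = 0" and y: "fr y \<noteq> 0"
    and H: "H = homotopy f z \<gamma> (complex_vec y) \<alpha>"
    and fin: "finite (solutions (\<lambda>w. H w 1))"
    and max: "max_isolated_solutions f (card (solutions (\<lambda>w. H w 1)))"
    and trackable: "\<forall>w\<in>solutions (\<lambda>w. H w 1). \<exists>\<xi>. solution_path H \<xi> \<and> \<xi> 1 = w"
    and converges: "\<forall>\<xi>. solution_path H \<xi> \<longrightarrow> (\<exists>e. (\<xi> \<longlongrightarrow> e) (at_right 0))"
  shows "\<exists>x. fr x = 0 \<and> complex_vec x \<in> x_part ` endpoints H"
proof (rule ccontr)
  assume none: "\<not> ?thesis"
  let ?S = "solutions (\<lambda>w. H w 1)" and ?Z = "\<lambda>s. regular_fibre (point (complex_vec y) s)"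
  define g where "g = \<gamma> * z"
  obtain \<Xi> where \<Xi>: "\<And>w. w \<in> ?S \<Longrightarrow> solution_path H (\<Xi> w) \<and> \<Xi> w 1 = w"
    using bchoice[OF trackable] by blast
  have finZ: "finite (regular_fibre c)" and leZ: "card (regular_fibre c) \<le> card ?S" for c
    using fibre_card_le[OF max] by auto
  have cover: "?Z (complex_of_real t * g) = (\<lambda>w. ratio (\<Xi> w t)) ` ?S"
    "card (?Z (complex_of_real t * g)) = card ?S" if "t \<in> {0<..1}" for t
    using solution_paths_cover_fibres[OF H fin max \<Xi> that] by (simp_all add: g_def mult.assoc)
  \<comment> \<open>Otherwise all paths would lie over the single target \<open>(y, 0)\<close>,
    whose fibre would be maximal.\<close>
  have g: "g \<noteq> 0"
  proof
    assume "g = 0"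
    then have "card (?Z 0) = card ?S" using cover(2)[of 1] by simp
    then show False using zero_fibre_not_maximal[OF finZ p y] leZ by simp
  qed
  have small: "\<forall>\<^sub>F t in at_right 0. t \<in> {0<..1} \<and> complex_of_real t * g \<in> ball 0 \<delta> - {0}" if "\<delta> > 0" for \<delta>
  proof -
    have "((\<lambda>t. complex_of_real t * g) \<longlongrightarrow> of_real 0 * g) (at_right 0)"
      by (intro tendsto_intros)
    then have "\<forall>\<^sub>F t in at_right 0. complex_of_real t * g \<in> ball 0 \<delta>"
      by (rule topological_tendstoD) (use that in auto)
    moreover have "\<forall>\<^sub>F t in at_right 0. t \<in> {0<..<1::real}"
      by (rule eventually_at_right_real) simp
    ultimately show ?thesis by eventually_elim (use g in auto)
  qed
  \<comment> \<open>With no confined coordinate the cluster is the whole regular fibre. Its size is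
    constant on a punctured disc, and the paths determine it in the direction of
    \<open>g\<close>.\<close>
  obtain \<delta>0 where \<delta>0: "\<delta>0 > 0" "\<And>s. s \<in> ball 0 \<delta>0 - {0} \<Longrightarrow> card (?Z s) = card ?S"
  proof -
    obtain \<eta> \<delta> where "0 < \<eta>" "\<eta> < 1" and \<delta>: "\<delta> > 0" and const: "\<And>s t. s \<in> ball 0 \<delta> - {0} \<Longrightarrow>
        t \<in> ball 0 \<delta> - {0} \<Longrightarrow>
        card (regular_fibre (upd (point (complex_vec y) 0) None s) \<inter> {v. \<forall>i\<in>{}. dist (v $ i) (0 $ i) < \<eta>}) =
        card (regular_fibre (upd (point (complex_vec y) 0) None t) \<inter> {v. \<forall>i\<in>{}. dist (v $ i) (0 $ i) < \<eta>})"
      by (rule cluster_card_constant[OF finZ zero_less_one, where X = "{}" and b = None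
            and c = "point (complex_vec y) 0" and e = 0]) (rule that)
    have const: "card (?Z s) = card (?Z t)" if "s \<in> ball 0 \<delta> - {0}" "t \<in> ball 0 \<delta> - {0}" for s t
      using const[OF that] by (simp add: upd_point)
    obtain t where "t \<in> {0<..1}" "complex_of_real t * g \<in> ball 0 \<delta> - {0}"
      using eventually_happens[OF small[OF \<delta>]] by auto
    then show thesis
      using const[of _ "complex_of_real t * g"] cover(2)[of t] by (intro that[OF \<delta>]) simp
  qed
  obtain X \<mu> where X: "\<And>k. fr (X k) > 0" "(\<lambda>k. fr (X k)) \<longlonglongrightarrow> 0"
    "\<And>k. norm (X k - y) \<le> norm (p - y)" "\<And>k. \<mu> k \<ge> real k"
    "\<And>k \<theta>. 0 < \<theta> \<Longrightarrow> \<theta> < 1 \<Longrightarrow> point (complex_vec (X k)) (of_real ((1 - \<theta>) * \<mu> k)) \<in>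
      regular_fibre (point (complex_vec (y + \<theta> *\<^sub>R (X k - y))) (of_real (fr (X k))))"
    using real_critical_sequence[OF p y] by blast
  \<comment> \<open>Over small values the fibre is maximal, so the minimiser itself is a regular
    point without moving \<open>y\<close>.\<close>
  have real_pt: "point (complex_vec (X k)) (of_real (\<mu> k)) \<in> ?Z (of_real (fr (X k)))" if "fr (X k) < \<delta>0" for k
  proof (rule minimum_in_maximal_fibre[OF finZ _ X(5)])
    have "complex_of_real (fr (X k)) \<in> ball 0 \<delta>0 - {0}"
      using X(1)[of k] that by simp
    from \<delta>0(2)[OF this] show "card (regular_fibre c) \<le> card (?Z (of_real (fr (X k))))" for c
      using leZ by simp
  qed
  have "\<forall>k. X k \<in> cball y (norm (p - y))"
    using X(3) by (simp add: dist_norm norm_minus_commute)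
  then obtain x r where r: "strict_mono r" "(X \<circ> r) \<longlonglongrightarrow> x"
    by (rule seq_compactE[OF compact_imp_seq_compact[OF compact_cball]]) (rule that)
  have "(\<lambda>k. fr (X (r k))) \<longlonglongrightarrow> fr x"
    using continuous_on_tendsto_compose[where s = UNIV, OF continuous_on_fr r(2)] by (simp add: o_def)
  moreover have fr0: "(\<lambda>k. fr (X (r k))) \<longlonglongrightarrow> 0"
    using LIMSEQ_subseq_LIMSEQ[OF X(2) r(1)] by (simp add: o_def)
  ultimately have "fr x = 0" by (rule LIMSEQ_unique)
  have "\<exists>a d. d > 0 \<and> (\<forall>\<^sub>F t in at_right 0. dist (\<Xi> w t $ Inl a) (complex_of_real (x $ a)) > d)"
    if w: "w \<in> ?S" for w
  proof -
    obtain e where e: "(\<Xi> w \<longlongrightarrow> e) (at_right 0)" using converges \<Xi>[OF w] by blast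
    then have "e \<in> endpoints H" using \<Xi>[OF w] by (auto simp: endpoints_def)
    then have "x_part e \<noteq> complex_vec x" using none \<open>fr x = 0\<close> by force
    then obtain a where a: "e $ Inl a \<noteq> complex_of_real (x $ a)"
      by (auto simp: vec_eq_iff x_part_def)
    define d where "d = dist (e $ Inl a) (complex_of_real (x $ a)) / 2"
    have "d > 0" using a by (simp add: d_def)
    have "((\<lambda>t. dist (\<Xi> w t $ Inl a) (complex_of_real (x $ a))) \<longlongrightarrow> 2 * d) (at_right 0)"
      using tendsto_dist[OF tendsto_vec_nth[OF e, of "Inl a"] tendsto_const] by (simp add: d_def)
    then have "\<forall>\<^sub>F t in at_right 0. dist (\<Xi> w t $ Inl a) (complex_of_real (x $ a)) > d"
      by (rule order_tendstoD) (use \<open>d > 0\<close> in simp)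
    then show ?thesis using \<open>d > 0\<close> by blast
  qed
  then obtain a d where ad: "\<And>w. w \<in> ?S \<Longrightarrow> d w > 0"
    "\<And>w. w \<in> ?S \<Longrightarrow> \<forall>\<^sub>F t in at_right 0. dist (\<Xi> w t $ Inl (a w)) (complex_of_real (x $ a w)) > d w"
    by metis
  \<comment> \<open>Clusters of smaller radius miss every path for small times. The inserted
    \<open>1\<close> keeps \<open>Min\<close> defined when \<open>?S\<close> is empty.\<close>
  define \<eta>0 where "\<eta>0 = Min (insert 1 (d ` ?S))"
  have "\<eta>0 > 0" using fin ad(1) by (auto simp: \<eta>0_def)
  have \<eta>0_le: "\<eta>0 \<le> d w" if "w \<in> ?S" for w using fin that by (auto simp: \<eta>0_def)
  have away: "\<forall>\<^sub>F t in at_right 0. \<forall>w\<in>?S. dist (\<Xi> w t $ Inl (a w)) (complex_of_real (x $ a w)) > d w"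
    using fin ad(2) by (simp add: eventually_ball_finite)
  \<comment> \<open>The multiplier coordinate \<open>None\<close> stays free because the multipliers
    of the minimisers tend to infinity.\<close>
  define Q where "Q \<eta> = {v. \<forall>i\<in>range Some. dist (v $ i) (point (complex_vec x) 0 $ i) < \<eta>}" for \<eta>
  obtain \<eta> \<delta> where \<eta>: "0 < \<eta>" "\<eta> < \<eta>0" "\<delta> > 0"
    "\<And>s t. s \<in> ball 0 \<delta> - {0} \<Longrightarrow> t \<in> ball 0 \<delta> - {0} \<Longrightarrow>
      card (regular_fibre (upd (point (complex_vec y) 0) None s) \<inter>
        {v. \<forall>i\<in>range Some. dist (v $ i) (point (complex_vec x) 0 $ i) < \<eta>}) =
      card (regular_fibre (upd (point (complex_vec y) 0) None t) \<inter>
        {v. \<forall>i\<in>range Some. dist (v $ i) (point (complex_vec x) 0 $ i) < \<eta>})"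
    by (rule cluster_card_constant[OF finZ \<open>\<eta>0 > 0\<close>, where X = "range Some" and b = None
          and c = "point (complex_vec y) 0" and e = "point (complex_vec x) 0"]) (rule that)
  note \<eta> = \<eta>(1-3) \<eta>(4)[folded Q_def, unfolded upd_point]
  have "\<forall>\<^sub>F k in sequentially. fr (X (r k)) < min \<delta>0 \<delta>"
    using \<delta>0(1) \<eta>(3) by (intro order_tendstoD(2)[OF fr0]) auto
  moreover have "\<forall>\<^sub>F k in sequentially. dist ((X \<circ> r) k) x < \<eta>"
    using r(2) \<eta>(1) by (rule tendstoD)
  ultimately have "\<forall>\<^sub>F k in sequentially. fr (X (r k)) < min \<delta>0 \<delta> \<and> dist (X (r k)) x < \<eta>"
    by eventually_elim simp
  then obtain k where k: "fr (X (r k)) < min \<delta>0 \<delta>" "dist (X (r k)) x < \<eta>"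
    using eventually_happens'[OF sequentially_bot] by blast
  let ?s = "complex_of_real (fr (X (r k)))"
  have "point (complex_vec (X (r k))) (of_real (\<mu> (r k))) \<in> ?Z ?s \<inter> Q \<eta>"
  proof
    show "point (complex_vec (X (r k))) (of_real (\<mu> (r k))) \<in> Q \<eta>"
      unfolding Q_def
    proof (intro CollectI ballI)
      fix i assume "i \<in> range (Some :: 'n \<Rightarrow> 'n option)"
      then obtain b where "i = Some b" by blast
      moreover have "dist (X (r k) $ b) (x $ b) < \<eta>"
        using dist_vec_nth_le[of "X (r k)" b x] k(2) by linarith
      ultimately show "dist (point (complex_vec (X (r k))) (complex_of_real (\<mu> (r k))) $ i)
          (point (complex_vec x) 0 $ i) < \<eta>"
        by (simp add: dist_of_real)
    qed
  qed (use real_pt k(1) in simp)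
  then have "card (?Z ?s \<inter> Q \<eta>) > 0" using finZ by (auto simp: card_gt_0_iff)
  moreover have "?s \<in> ball 0 \<delta> - {0}" using k(1) X(1)[of "r k"] by simp
  \<comment> \<open>Constancy of the count transfers the point found for positive real
    \<open>?s\<close> to every direction of \<open>s\<close>, in particular to that of
    \<open>g\<close>.\<close>
  ultimately have pos: "card (?Z s \<inter> Q \<eta>) > 0" if "s \<in> ball 0 \<delta> - {0}" for s
    using \<eta>(4) that by metis
  obtain t where t: "t \<in> {0<..1}" "complex_of_real t * g \<in> ball 0 \<delta> - {0}"
    "\<And>w. w \<in> ?S \<Longrightarrow> dist (\<Xi> w t $ Inl (a w)) (complex_of_real (x $ a w)) > d w"
    using eventually_happens[OF eventually_conj[OF small[OF \<eta>(3)] away]] by auto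
  obtain v where v: "v \<in> ?Z (complex_of_real t * g)" "v \<in> Q \<eta>"
    using pos[OF t(2)] by (metis IntE card_gt_0_iff equals0I)
  then obtain w where w: "w \<in> ?S" "v = ratio (\<Xi> w t)" using cover(1)[OF t(1)] by blast
  have "dist (v $ Some (a w)) (complex_of_real (x $ a w)) < \<eta>" using v(2) by (simp add: Q_def)
  then have "dist (\<Xi> w t $ Inl (a w)) (complex_of_real (x $ a w)) < \<eta>"
    by (simp add: w(2) ratio_def x_part_def)
  then show False using t(3)[OF w(1)] \<eta>0_le[OF w(1)] \<eta>(2) by linarith
qed

end

section \<open>Local rigidity\<close>

lemma poly_fun_coord: "poly_fun (\<lambda>x. coord idx x i k)"
  unfolding coord_def by (cases "(i, k) \<in> range idx") (auto intro: poly_fun.intros)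

lemma poly_fun_eps_member_constraint: "poly_fun (eps_member_constraint n Es idx q \<epsilon>)"
  unfolding eps_member_constraint_def[abs_def] member_constraint_def sphere_constraint_def sq_dist_def
  by (intro poly_fun_intros poly_fun_coord)

lemma coord_complex_vec: "coord idx (complex_vec x) i k = complex_of_real (coord idx x i k)"
  by (simp add: coord_def)

lemma sq_dist_complex_vec: "sq_dist idx (complex_vec x) i j = complex_of_real (sq_dist idx x i j)"
  by (simp add: sq_dist_def coord_complex_vec)

text \<open>Dropped coordinates are 0 in both points, so only the retained pairs contribute, and
  \<open>idx\<close> reindexes them.\<close>

lemma sum_coord_eq_norm:
  fixes idx :: "'N::finite \<Rightarrow> nat \<times> 'd::{finite,linorder}"
  assumes "bij_betw idx UNIV (retained_pairs n)"
  shows "(\<Sum>k\<in>UNIV. \<Sum>i\<in>{1..n}. (coord idx x i k - coord idx q i k)\<^sup>2) = (norm (x - q))\<^sup>2"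
proof -
  have inj: "inj idx" and range: "range idx = retained_pairs n"
    using assms by (auto simp: bij_betw_def)
  have sub: "range idx \<subseteq> {1..n} \<times> UNIV"
    unfolding range by (auto simp: retained_pairs_def)
  let ?g = "\<lambda>(i, k). (coord idx x i k - coord idx q i k)\<^sup>2"
  have "(\<Sum>k\<in>UNIV. \<Sum>i\<in>{1..n}. (coord idx x i k - coord idx q i k)\<^sup>2) = (\<Sum>p\<in>{1..n} \<times> UNIV. ?g p)"
    by (subst sum.swap) (simp add: sum.cartesian_product)
  also have "\<dots> = (\<Sum>p\<in>range idx. ?g p)"
    using sub by (intro sum.mono_neutral_right) (auto simp: coord_def)
  also have "\<dots> = (\<Sum>a\<in>UNIV. ?g (idx a))"
    using inj by (simp add: sum.reindex)
  also have "\<dots> = (\<Sum>a\<in>UNIV. (x $ a - q $ a)\<^sup>2)"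
  proof (intro sum.cong refl)
    fix a
    have "coord idx u (fst (idx a)) (snd (idx a)) = u $ a" for u :: "real ^ 'N"
      using inj by (simp add: coord_def)
    then show "?g (idx a) = (x $ a - q $ a)\<^sup>2" by (simp add: case_prod_unfold)
  qed
  also have "\<dots> = (norm (x - q))\<^sup>2"
    by (simp add: norm_vec_def L2_set_def sum_nonneg)
  finally show ?thesis .
qed

lemma eps_member_constraint_complex_vec:
  assumes "bij_betw idx UNIV (retained_pairs n)"
  shows "eps_member_constraint n Es idx q \<epsilon> (complex_vec x) = complex_of_real
    ((\<Sum>e\<in>Es. (sq_dist idx x (fst e) (snd e) - sq_dist idx q (fst e) (snd e))\<^sup>2) +
     (\<epsilon>\<^sup>2 - (norm (x - q))\<^sup>2)\<^sup>2)"
  unfolding sum_coord_eq_norm[OF assms, symmetric]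
  by (simp add: eps_member_constraint_def member_constraint_def sphere_constraint_def
      sq_dist_complex_vec coord_complex_vec)

text \<open>By the intermediate value theorem the path has distance exactly \<epsilon> from
  \<open>q\<close> at some time. There the member constraints and the sphere constraint vanish
  together.\<close>

lemma flex_crosses_sphere:
  assumes "flex n Es idx q p" "t \<in> {0..1}" "p t \<notin> ball q \<epsilon>" "\<epsilon> > 0"
    and idx: "bij_betw idx UNIV (retained_pairs n)"
  shows "\<exists>x. eps_member_constraint n Es idx q \<epsilon> (complex_vec x) = 0"
proof -
  have cont: "continuous_on {0..1} p" and p0: "p 0 = q"
    and mem: "\<And>s e. s \<in> {0..1} \<Longrightarrow> e \<in> Es \<Longrightarrow> member_constraint idx q e (complex_vec (p s)) = 0"
    using assms(1) by (auto simp: flex_def deformation_def)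
  have "continuous_on {0..t} (\<lambda>s. norm (p s - q))"
    using assms(2) by (intro continuous_intros continuous_on_subset[OF cont]) auto
  moreover have "\<epsilon> \<le> norm (p t - q)"
    using assms(3) by (simp add: dist_norm norm_minus_commute)
  ultimately obtain s where s: "0 \<le> s" "s \<le> t" "norm (p s - q) = \<epsilon>"
    using IVT'[of "\<lambda>s. norm (p s - q)" 0 \<epsilon> t] assms(2,4) p0 by auto
  have "sq_dist idx (p s) (fst e) (snd e) = sq_dist idx q (fst e) (snd e)" if "e \<in> Es" for e
    using mem[of s e] that s assms(2) by (simp add: member_constraint_def sq_dist_complex_vec)
  then have "eps_member_constraint n Es idx q \<epsilon> (complex_vec (p s)) = 0"
    unfolding eps_member_constraint_complex_vec[OF idx] s(3) by simp
  then show ?thesis by blast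
qed

theorem theorem5:
  fixes n :: nat
    and Es :: "(nat \<times> nat) set"
    and p0 :: "nat \<Rightarrow> real ^ 'd::{finite,linorder}"
    and idx :: "'N::finite \<Rightarrow> nat \<times> 'd"
    and q :: "real ^ 'N"
    and \<epsilon> z :: real
    and \<gamma> :: complex
    and y :: "real ^ 'N"
    and \<alpha> :: "complex ^ 2"
    and f :: "complex ^ 'N \<Rightarrow> complex"
    and H :: "complex ^ ('N + 2) \<Rightarrow> complex \<Rightarrow> complex ^ ('N + 2)"
  assumes graph: "connected_graph n Es"
    and config: "admissible_configuration n p0"
    and idx: "bij_betw idx UNIV (retained_pairs n)"
    and frame: "moving_frame_configuration n idx p0 q"
    and eps: "\<epsilon> > 0"
    and f_def: "f = eps_member_constraint n Es idx q \<epsilon>"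
    and y: "f (complex_vec y) \<noteq> 0"
    and H_def: "H = homotopy f (complex_of_real z) \<gamma> (complex_vec y) \<alpha>"
    and start_finite: "finite (solutions (\<lambda>w. H w 1))"
    and start_nonsingular:
      "\<forall>w\<in>solutions (\<lambda>w. H w 1). nonsingular_solution (\<lambda>w. H w 1) w"
    and start_max: "max_isolated_solutions f (card (solutions (\<lambda>w. H w 1)))"
    and trackable: "\<forall>w\<in>solutions (\<lambda>w. H w 1). \<exists>\<xi>. solution_path H \<xi> \<and> \<xi> 1 = w"
    and converges: "\<forall>\<xi>. solution_path H \<xi> \<longrightarrow> (\<exists>e. (\<xi> \<longlongrightarrow> e) (at_right 0))"
    and no_real_endpoint:
      "x_part ` endpoints H \<inter> {x. f x = 0} \<inter> range complex_vec = {}"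
  shows "eps_locally_rigid n Es idx q \<epsilon>"
proof -
  have "poly_fun f" unfolding f_def by (rule poly_fun_eps_member_constraint)
  then obtain D E where "twice_differentiable_polynomial f D E"
    using poly_fun_twice_differentiable by blast
  then interpret twice_differentiable_polynomial f D E .
  interpret nonnegative_polynomial f D E
  proof
    show "f (complex_vec x) \<in> \<real>" for x
      unfolding f_def eps_member_constraint_complex_vec[OF idx] by (rule Reals_of_real)
    show "Re (f (complex_vec x)) \<ge> 0" for x
      unfolding f_def eps_member_constraint_complex_vec[OF idx] Re_complex_of_real
      by (intro add_nonneg_nonneg sum_nonneg) auto
  qed
  \<comment> \<open>A real zero would produce an endpoint over a real zero, which the last
    hypothesis excludes.\<close>
  have "f (complex_vec x) \<noteq> 0" for x
  proof
    assume "f (complex_vec x) = 0"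
    then have "fr x = 0" by (simp add: fr_def)
    moreover have "fr y \<noteq> 0" using y by (simp add: f_complex_vec)
    ultimately obtain u where u: "fr u = 0" "complex_vec u \<in> x_part ` endpoints H"
      using real_endpoint[OF _ _ H_def start_finite start_max trackable converges] by blast
    then have "complex_vec u \<in> x_part ` endpoints H \<inter> {x. f x = 0} \<inter> range complex_vec"
      by (simp add: f_complex_vec)
    then show False using no_real_endpoint by simp
  qed
  then show ?thesis
    unfolding eps_locally_rigid_def f_def using flex_crosses_sphere[OF _ _ _ eps idx] by blast
qed

end
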